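(* For real $x>1/2$ let $$f_5(x)=\frac{(30x-11)\,\Gamma(x)^4}{4x(2x-1)\,\Gamma(2x)^2}.$$ Then the following series converge and $$\sum_{k=1}^\infty f_5'(k)=-24\zeta(4),\qquad \sum_{k=1}^\infty f_5''(k)=8\big(23\zeta(5)-2\zeta(2)\zeta(3)\big),$$ $$\sum_{k=1}^\infty f_5^{(3)}(k)=24\big(2\zeta(3)^2-49\zeta(6)\big),\qquad \sum_{k=1}^\infty f_5^{(4)}(k)=96\big(177\zeta(7)-46\zeta(2)\zeta(5)-2\zeta(3)\zeta(4)\big),$$ $$\sum_{k=1}^\infty f_5^{(5)}(k)=640\big(9\zeta(3)\zeta(5)-3\zeta(2)\zeta(3)^2-12\zeta(5,3)-146\zeta(8)\big),$$ $$\frac{1}{960}\sum_{k=1}^\infty f_5^{(6)}(k)=3001\zeta(9)+8\zeta(3)^3-6\zeta(3)\zeta(6)-138\zeta(4)\zeta(5)-1062\zeta(2)\zeta(7).$$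
   Context: $\Gamma$ is Euler's gamma function and $f^{(m)}$ (also $f',f''$) is the $m$-th derivative with respect to $x$. $\zeta(s)=\sum_{n\ge1}n^{-s}$ is the Riemann zeta function and $\zeta(5,3)=\sum_{k_1>k_2>0}\frac{1}{k_1^5k_2^3}$. *)

theory Defs
  imports "HOL-Analysis.Analysis"
begin

text \<open>
  The series represents the Riemann zeta function only for \<open>s > 1\<close>, where it converges.
\<close>

definition zeta :: "real \<Rightarrow> real" where
  "zeta s = (\<Sum>n. 1 / real (Suc n) powr s)"

text \<open>
  The double zeta value \<open>\<zeta>(a,b)\<close>; the family is absolutely summable for \<open>a \<ge> 2\<close> and \<open>b \<ge> 1\<close>.
\<close>

definition double_zeta :: "nat \<Rightarrow> nat \<Rightarrow> real" where
  "double_zeta a b =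
     (\<Sum>\<^sub>\<infinity>(k1, k2) \<in> {(k1, k2). k2 > 0 \<and> k1 > k2}. 1 / (real k1 ^ a * real k2 ^ b))"

text \<open>
  The function of interest lives on \<open>x > 1/2\<close>. Here it is total, but its derivatives
  at positive integers depend only on its values in that open half-line.
\<close>

definition f5 :: "real \<Rightarrow> real" where
  "f5 x = ((30 * x - 11) * Gamma x ^ 4) / (4 * x * (2 * x - 1) * Gamma (2 * x) ^ 2)"

end

theory Submission
  imports Defs "HOL-Complex_Analysis.Complex_Analysis" "HOL-Computational_Algebra.Fundamental_Theorem_Algebra"
begin

text \<open>
  The sum \<open>\<Sum>k\<ge>1. f5 (k + a)\<close> equals \<open>4 P(a) V(a)\<close>, where \<open>P(a) = \<Gamma>(1 + a)^4 / \<Gamma>(1 + 2 a)^2\<close> and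
  \<open>V\<close> is a very-well-poised series: a WZ certificate gives a first-order recurrence for \<open>V\<close> under \<open>a \<mapsto> a + 1\<close>, and the sum
  telescopes. So the claim amounts to the Taylor coefficients at \<open>a = 0\<close> of \<open>P\<close> (from the digamma function) and of \<open>V\<close>.

  For \<open>V\<close> one embeds the series into a family with five parameters \<open>y1, ..., y5\<close>, visibly symmetric in
  \<open>y1, ..., y4\<close>. A second WZ certificate shows that it is symmetric in all five. Let \<open>e1, ..., e4\<close> be elementary
  symmetric functions of the five parameters, and scale the parameters by \<open>a\<close>. The coefficient of \<open>a^n\<close> is then a polynomial of degree
  at most \<open>n\<close> in the fifth parameter \<open>X\<close> that takes the same value at all roots of \<open>Q(X) = w\<close>, for the quintic
  \<open>Q(X) = X^5 - e1 X^4 + e2 X^3 - e3 X^2 + e4 X\<close>. Hence for \<open>n \<le> 6\<close> it is \<open>\<alpha> + \<beta> Q(X)\<close>, with \<open>\<beta> = 0\<close> if \<open>n < 5\<close>.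
  The series \<open>V\<close> is the case \<open>X = 2\<close> of \<open>(e1, ..., e4) = (8, 25, 38, 28)\<close>. At \<open>X = 0\<close> the series telescopes, which gives \<open>\<alpha>\<close>.
  The number \<open>\<beta>\<close> is read off the derivative at \<open>X = 0\<close>, after deforming \<open>(38, 28)\<close> to \<open>(36, 24)\<close>, where the quartic factors
  become even around their centre and the derivative is an explicit combination of double zeta values.
\<close>

section \<open>A very-well-poised series and its symmetry\<close>

text \<open>The numbers (8, 25, 38, 28) are \<open>e1, ..., e4\<close> of the parameters 1, 1, 2, 2,
  2. The fifth elementary symmetric function is the value \<open>w\<close> over whose fibre the five
  parameters lie. The series depends only on \<open>e1, ..., e4\<close> and \<open>X\<close>, so
  fixing these four numbers and varying \<open>w\<close> yields all fibres of one quintic. This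
  matters because X = 2 (w = 8, with multiple roots) and X = 0 (w = 0) lie in different fibres, and
  symmetry alone cannot compare them; constancy on the squarefree fibres can, since it is a
  statement about a polynomial in \<open>X\<close>. The linear coefficient of \<open>Q\<close> is
  \<open>e4\<close>, so the derivative at X = 0 is \<open>\<beta> e4\<close>. It is used in two
  ways: for nonzero \<open>e4\<close> it determines \<open>\<beta>\<close>, and for
  \<open>e4 = 0\<close> it is an equation between double zeta values, which removes the unwanted
  ones. Direct differentiation at (38, 28) is avoided because the products in the summand differ
  from 1 there, and their expansion would bring in nested sums of greater depth. The symmetry
  argument relies on a shift that moves \<open>y4\<close> and \<open>y5\<close> by the same amount,
  so that exchanging them respects the recurrence.\<close>

definition wprod :: "complex \<Rightarrow> complex \<Rightarrow> complex \<Rightarrow> complex \<Rightarrow> complex \<Rightarrow> nat \<Rightarrow> complex" where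
  "wprod y1 y2 y3 y4 h k = (\<Prod>j<k.
        ((of_nat (Suc j) + h - y1) * (of_nat (Suc j) + h - y2) * (of_nat (Suc j) + h - y3) * (of_nat (Suc j) + h - y4)) /
        ((of_nat (Suc j) + y1) * (of_nat (Suc j) + y2) * (of_nat (Suc j) + y3) * (of_nat (Suc j) + y4)))"

text \<open>With \<open>h\<close> half of \<open>y1 + y2 + y3 + y4 - y5\<close>, reflecting
  \<open>n\<close> at \<open>- h / 2\<close> exchanges \<open>n + yi\<close> and
  \<open>n + h - yi\<close> up to sign, and the linear factor vanishes at this centre. In the
  centred parameters \<open>ci = yi - h / 2\<close> one has
  \<open>y5 = c1 + c2 + c3 + c4\<close>.\<close>

definition wsummand :: "complex \<Rightarrow> complex \<Rightarrow> complex \<Rightarrow> complex \<Rightarrow> complex \<Rightarrow> nat \<Rightarrow> complex" where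
  "wsummand y1 y2 y3 y4 y5 k =
     (of_nat (Suc k) + (y1 + y2 + y3 + y4 - y5) / 4) /
     ((of_nat (Suc k) + y1) * (of_nat (Suc k) + y2) * (of_nat (Suc k) + y3) * (of_nat (Suc k) + y4)) *
     wprod y1 y2 y3 y4 ((y1 + y2 + y3 + y4 - y5) / 2) k"

text \<open>
  This polynomial, and with it \<open>wcert\<close> below, comes from Gosper's algorithm applied to the difference
  in \<open>wz_relation\<close>; \<open>s\<close> is the summation variable moved to the centre of the well-poised summand.
\<close>

definition wpol :: "complex \<Rightarrow> complex \<Rightarrow> complex \<Rightarrow> complex \<Rightarrow> complex \<Rightarrow> complex" where
  "wpol s t c2 c3 c4 = s^3 + 2 * s^2 * t + 2 * s * t^2 + (c2+c3+c4) * s * (s + 2 * t) + (c2 * c3 + c2 * c4 + c3 * c4) * s - c2 * c3 * c4"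

lemma wz_identity:
  "2 * (t+c2+c3+c4) * s * (s+t) * (s+1+t) * ((s+1+c2) * (s+1+c3) * (s+1+c4))
       + 2 * (s+1) * ((s-c2) * (s-c3) * (s-c4)) * ((t+c2) * (t+c3) * (t+c4))
     = wpol s t c2 c3 c4 * (s+1+t) * ((s+1+c2) * (s+1+c3) * (s+1+c4)) - wpol (s+1) t c2 c3 c4 * ((s+1-t) * ((s-c2) * (s-c3) * (s-c4)))"
  unfolding wpol_def by algebra

section \<open>The contiguous shift and its WZ relation\<close>

lemma wprod_shift_aux:
  fixes P Q L K a b0 c1 c2 c3 c4 n1 n2 n3 n4 N2 N3 N4 :: "'a :: field"
  assumes "P * L * b0 = Q * (n2 * n3 * n4) * K / a" "c1 \<noteq> 0" "c2 \<noteq> 0" "c3 \<noteq> 0" "c4 \<noteq> 0"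
  shows "P * ((n1 * N2 * N3 * N4) / (c1 * c2 * c3 * c4)) * L * (b0 * c1 * c2 * c3 * c4) =
    Q * ((n1 * n2 * n3 * n4) / a) * (N2 * N3 * N4) * K"
proof -
  have "P * ((n1 * N2 * N3 * N4) / (c1 * c2 * c3 * c4)) * L * (b0 * c1 * c2 * c3 * c4) =
    (P * L * b0) * (n1 * N2 * N3 * N4)"
    using assms(2-) by (simp add: divide_simps)
  also have "\<dots> = Q * ((n1 * n2 * n3 * n4) / a) * (N2 * N3 * N4) * K"
    unfolding assms(1) by (simp add: divide_simps)
  finally show ?thesis .
qed

text \<open>Under the shift the numerator factors with \<open>y1\<close> stay fixed, those with
  \<open>y2, y3, y4\<close> move by one place, and the denominators move by two or one places, so
  the quotient of the two products telescopes. The form without division covers vanishing boundary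
  factors \<open>1 + h - yi\<close>.\<close>

lemma wprod_shift:
  assumes nz: "\<And>m. of_nat (Suc m) + y1 \<noteq> 0" "\<And>m. of_nat (Suc m) + y2 \<noteq> 0"
    "\<And>m. of_nat (Suc m) + y3 \<noteq> 0" "\<And>m. of_nat (Suc m) + y4 \<noteq> 0"
  shows "wprod (y1 + 2) (y2 + 1) (y3 + 1) (y4 + 1) (h + 2) k * ((1 + h - y2) * (1 + h - y3) * (1 + h - y4)) *
      ((of_nat (Suc k) + y1) * (of_nat (Suc (Suc k)) + y1) * (of_nat (Suc k) + y2) * (of_nat (Suc k) + y3) * (of_nat (Suc k) + y4))
    = wprod y1 y2 y3 y4 h k * ((of_nat (Suc k) + h - y2) * (of_nat (Suc k) + h - y3) * (of_nat (Suc k) + h - y4)) *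
      ((1 + y1) * (2 + y1) * (1 + y2) * (1 + y3) * (1 + y4))"
proof (induction k)
  case 0
  have "(of_nat (Suc (Suc 0)) :: complex) = 2" "(of_nat (Suc 0) :: complex) = 1" by simp_all
  then show ?case unfolding wprod_def by (simp only: lessThan_0 prod.empty mult_1_left mult_1_right)
next
  case (Suc k)
  define m where "m = (of_nat (Suc k) :: complex)"
  define P where "P = wprod (y1 + 2) (y2 + 1) (y3 + 1) (y4 + 1) (h + 2) k"
  define Q where "Q = wprod y1 y2 y3 y4 h k"
  define K where "K = (1 + y1) * (2 + y1) * (1 + y2) * (1 + y3) * (1 + y4)"
  define L where "L = (1 + h - y2) * (1 + h - y3) * (1 + h - y4)"
  have nz': "m + y1 \<noteq> 0" "m + y2 \<noteq> 0" "m + y3 \<noteq> 0" "m + y4 \<noteq> 0"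
    "m + 1 + y1 \<noteq> 0" "m + 2 + y1 \<noteq> 0" "m + 1 + y2 \<noteq> 0" "m + 1 + y3 \<noteq> 0" "m + 1 + y4 \<noteq> 0"
    using nz(1)[of k] nz(2)[of k] nz(3)[of k] nz(4)[of k] nz(1)[of "Suc k"] nz(1)[of "Suc (Suc k)"]
      nz(2)[of "Suc k"] nz(3)[of "Suc k"] nz(4)[of "Suc k"] by (simp_all add: m_def algebra_simps)
  have IH: "P * L * ((m + y1) * (m + 1 + y1) * (m + y2) * (m + y3) * (m + y4))
     = Q * ((m + h - y2) * (m + h - y3) * (m + h - y4)) * K"
  proof -
    have "of_nat (Suc (Suc k)) = m + 1" by (simp add: m_def)
    then show ?thesis using Suc.IH unfolding P_def[symmetric] Q_def[symmetric] K_def[symmetric] L_def[symmetric] m_def[symmetric]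
      by (simp only:)
  qed
  have 1: "wprod (y1 + 2) (y2 + 1) (y3 + 1) (y4 + 1) (h + 2) (Suc k) =
     P * (((m + h - y1) * (m + 1 + h - y2) * (m + 1 + h - y3) * (m + 1 + h - y4)) /
       ((m + 2 + y1) * (m + 1 + y2) * (m + 1 + y3) * (m + 1 + y4)))"
  proof -
    have e: "of_nat (Suc k) + (h + 2) - (y1 + 2) = m + h - y1" "of_nat (Suc k) + (y1 + 2) = m + 2 + y1"
      "of_nat (Suc k) + (h + 2) - (y + 1) = m + 1 + h - y" "of_nat (Suc k) + (y + 1) = m + 1 + y" for y
      by (simp_all add: m_def)
    show ?thesis by (simp only: wprod_def P_def prod.lessThan_Suc e)
  qed
  have 2: "wprod y1 y2 y3 y4 h (Suc k) =
     Q * (((m + h - y1) * (m + h - y2) * (m + h - y3) * (m + h - y4)) /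
       ((m + y1) * (m + y2) * (m + y3) * (m + y4)))"
    unfolding wprod_def Q_def m_def by simp
  have 3: "of_nat (Suc (Suc k)) = m + 1" "of_nat (Suc (Suc (Suc k))) = m + 2" by (simp_all add: m_def)
  have "P * L * (m + 1 + y1) = Q * ((m + h - y2) * (m + h - y3) * (m + h - y4)) * K /
       ((m + y1) * (m + y2) * (m + y3) * (m + y4))"
    unfolding eq_divide_eq using IH nz' by (simp add: mult_ac)
  then show ?case unfolding 1 2 3 using wprod_shift_aux[OF _ nz'(6-9)]
    unfolding L_def K_def by blast
qed

definition wrho :: "complex \<Rightarrow> complex \<Rightarrow> complex \<Rightarrow> complex \<Rightarrow> complex \<Rightarrow> complex" where
  "wrho y1 y2 y3 y4 y5 = (let h = (y1 + y2 + y3 + y4 - y5) / 2 in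
     - ((1 + h - y2) * (1 + h - y3) * (1 + h - y4) *
        ((1 + h + y5 - y2 - y3) * (1 + h + y5 - y2 - y4) * (1 + h + y5 - y3 - y4))) /
     ((1 + y1) * (2 + y1) * ((1 + y2) * (1 + y3) * (1 + y4) * (1 + y5))))"

definition wcert :: "complex \<Rightarrow> complex \<Rightarrow> complex \<Rightarrow> complex \<Rightarrow> complex \<Rightarrow> nat \<Rightarrow> complex" where
  "wcert y1 y2 y3 y4 y5 k = (let h = (y1 + y2 + y3 + y4 - y5) / 2; n = of_nat (Suc k) in
     wprod y1 y2 y3 y4 h k * wpol (n + h / 2) (1 + y1 - h / 2) (y2 - h / 2) (y3 - h / 2) (y4 - h / 2) /
     (2 * (1 + y5) * ((n + y1) * (n + y2) * (n + y3) * (n + y4)) * (n + 1 + y1)))"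

text \<open>In centred variables the shift raises \<open>s\<close> and \<open>c1\<close> by 1 and
  fixes \<open>c2, c3, c4\<close>, with \<open>t = c1 + 1\<close>. All four terms are then multiples
  of one common factor \<open>I\<close>, and \<open>wz_identity\<close> relates the
  cofactors.\<close>

lemma wz_relation:
  assumes nz: "\<And>m. of_nat (Suc m) + y1 \<noteq> 0" "\<And>m. of_nat (Suc m) + y2 \<noteq> 0"
    "\<And>m. of_nat (Suc m) + y3 \<noteq> 0" "\<And>m. of_nat (Suc m) + y4 \<noteq> 0" "1 + y5 \<noteq> 0"
  shows "wsummand y1 y2 y3 y4 y5 k -
      wrho y1 y2 y3 y4 y5 * wsummand (y1 + 2) (y2 + 1) (y3 + 1) (y4 + 1) (y5 + 1) k
    = wcert y1 y2 y3 y4 y5 k - wcert y1 y2 y3 y4 y5 (Suc k)"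
proof -
  define h where "h = (y1 + y2 + y3 + y4 - y5) / 2"
  define m where "m = (of_nat (Suc k) :: complex)"
  define s t c2 c3 c4 where sdefs: "s = m + h / 2" "t = 1 + y1 - h / 2" "c2 = y2 - h / 2" "c3 = y3 - h / 2" "c4 = y4 - h / 2"
  define P where "P = wprod (y1 + 2) (y2 + 1) (y3 + 1) (y4 + 1) (h + 2) k"
  define Q where "Q = wprod y1 y2 y3 y4 h k"
  have nz': "m + y1 \<noteq> 0" "m + y2 \<noteq> 0" "m + y3 \<noteq> 0" "m + y4 \<noteq> 0"
    "m + 1 + y1 \<noteq> 0" "m + 2 + y1 \<noteq> 0" "m + 1 + y2 \<noteq> 0" "m + 1 + y3 \<noteq> 0" "m + 1 + y4 \<noteq> 0"
    "1 + y1 \<noteq> 0" "2 + y1 \<noteq> 0" "1 + y2 \<noteq> 0" "1 + y3 \<noteq> 0" "1 + y4 \<noteq> 0"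
    using nz(1)[of k] nz(2)[of k] nz(3)[of k] nz(4)[of k] nz(1)[of "Suc k"] nz(1)[of "Suc (Suc k)"]
      nz(2)[of "Suc k"] nz(3)[of "Suc k"] nz(4)[of "Suc k"] nz(1)[of 0] nz(2)[of 0] nz(3)[of 0] nz(4)[of 0] nz(1)[of 1]
    by (simp_all add: m_def algebra_simps)
  define D where "D = (m + y1) * (m + y2) * (m + y3) * (m + y4)"
  define D' where "D' = (m + 1 + y2) * (m + 1 + y3) * (m + 1 + y4)"
  define R where "R = (m + h - y2) * (m + h - y3) * (m + h - y4)"
  define Z where "Z = (1 + h + y5 - y2 - y3) * (1 + h + y5 - y2 - y4) * (1 + h + y5 - y3 - y4)"
  define u where "u = 1 + y5"
  define a where "a = m + 1 + y1"
  define b where "b = m + 2 + y1"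
  have nz2: "D \<noteq> 0" "D' \<noteq> 0" "u \<noteq> 0" "a \<noteq> 0" "b \<noteq> 0" using nz' nz(5) by (simp_all add: D_def D'_def u_def a_def b_def)
  have h': "(y1 + 2 + (y2 + 1) + (y3 + 1) + (y4 + 1) - (y5 + 1)) / 2 = h + 2"
           "(y1 + 2 + (y2 + 1) + (y3 + 1) + (y4 + 1) - (y5 + 1)) / 4 = h/2 + 1"
           "(y1 + y2 + y3 + y4 - y5) / 4 = h/2"
    by (simp_all add: h_def field_simps)
  have A: "wsummand y1 y2 y3 y4 y5 k = s / D * Q"
    unfolding wsummand_def h' h_def[symmetric] by (simp add: Q_def D_def m_def sdefs)
  have C0: "wcert y1 y2 y3 y4 y5 k = Q * wpol s t c2 c3 c4 / (2 * u * D * a)"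
    unfolding wcert_def Let_def h_def[symmetric] m_def[symmetric]
    by (simp add: Q_def D_def u_def a_def sdefs mult_ac)
  have Q1: "wprod y1 y2 y3 y4 h (Suc k) = Q * ((m + h - y1) * R / D)"
    unfolding wprod_def Q_def m_def R_def D_def by (simp add: mult_ac)
  have C1: "wcert y1 y2 y3 y4 y5 (Suc k) = Q * (m + h - y1) * R / D * wpol (s + 1) t c2 c3 c4 / (2 * u * (a * D') * b)"
  proof -
    have "of_nat (Suc (Suc k)) = m + 1" by (simp add: m_def)
    then show ?thesis
    unfolding wcert_def Let_def h_def[symmetric] Q1
    by (simp add: D'_def u_def a_def b_def sdefs mult_ac add_ac)
  qed
  have B: "wrho y1 y2 y3 y4 y5 * wsummand (y1 + 2) (y2 + 1) (y3 + 1) (y4 + 1) (y5 + 1) k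
      = - Q * R * Z / (u * D * a) * (s + 1) / (b * D')"
  proof -
    define L where "L = (1 + h - y2) * (1 + h - y3) * (1 + h - y4)"
    define K where "K = (1 + y1) * (2 + y1) * (1 + y2) * (1 + y3) * (1 + y4)"
    have K0: "K \<noteq> 0" using nz' by (simp add: K_def)
    have m1: "of_nat (Suc (Suc k)) = m + 1" by (simp add: m_def)
    have PL: "P * L * (D * a) = Q * R * K"
      using wprod_shift[OF nz(1-4), where h = h and k = k]
      unfolding P_def[symmetric] Q_def[symmetric] m_def[symmetric] m1
      by (simp add: L_def K_def R_def D_def a_def mult_ac)
    have PL': "P * L = Q * R * K / (D * a)" using PL nz2 by (simp add: field_simps)
    have "wrho y1 y2 y3 y4 y5 = - (L * Z) / (K * u)"
      unfolding wrho_def Let_def h_def[symmetric] L_def Z_def K_def u_def by (simp add: mult_ac)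
    moreover have "wsummand (y1 + 2) (y2 + 1) (y3 + 1) (y4 + 1) (y5 + 1) k = (s + 1) / (b * D') * P"
      unfolding wsummand_def h' P_def[symmetric] m_def[symmetric] by (simp add: D'_def b_def sdefs add_ac mult_ac)
    ultimately have "wrho y1 y2 y3 y4 y5 * wsummand (y1 + 2) (y2 + 1) (y3 + 1) (y4 + 1) (y5 + 1) k
       = - (P * L) * Z / (K * u) * (s + 1) / (b * D')" by simp
    also have "\<dots> = - Q * R * Z / (u * D * a) * (s + 1) / (b * D')" unfolding PL' using K0 by (simp add: mult_ac)
    finally show ?thesis .
  qed
  have id: "2* u* s* a* b* D' + 2*(s+1)* R* Z = wpol s t c2 c3 c4 * b * D' - wpol (s+1) t c2 c3 c4 * ((m+h-y1) * R)"
  proof -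
    have e1: "t + c2 + c3 + c4 = u" "s + t = a" "s + 1 + t = b" "s + 1 + c2 = m + 1 + y2" "s + 1 + c3 = m + 1 + y3" "s + 1 + c4 = m + 1 + y4"
      "s - c2 = m + h - y2" "s - c3 = m + h - y3" "s - c4 = m + h - y4" "s + 1 - t = m + h - y1"
      unfolding sdefs by (simp_all add: u_def a_def b_def h_def field_simps)
    have e2: "t + c2 = 1 + h + y5 - y3 - y4" "t + c3 = 1 + h + y5 - y2 - y4" "t + c4 = 1 + h + y5 - y2 - y3"
      unfolding sdefs by (simp_all add: h_def field_simps)
    show ?thesis using wz_identity[of t c2 c3 c4 s]
      unfolding e1 unfolding e2 by (simp add: D'_def R_def Z_def mult_ac)
  qed
  define I where "I = Q / (2 * u * D * a * b * D')"
  define v w w' f where "v = s + 1" and "w = wpol s t c2 c3 c4" and "w' = wpol v t c2 c3 c4" and "f = m + h - y1"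
  have 1: "s / D * Q = I * (2 * u * s * a * b * D')"
    unfolding I_def using nz2 by (simp add: divide_simps)
  have 2: "- Q * R * Z / (u * D * a) * v / (b * D') = - (I * (2 * v * R * Z))"
    unfolding I_def using nz2 by (simp add: divide_simps)
  have 3: "Q * w / (2 * u * D * a) = I * (w * b * D')"
    unfolding I_def using nz2 by (simp add: divide_simps)
  have 4: "Q * f * R / D * w' / (2 * u * (a * D') * b) = I * (w' * (f * R))"
    unfolding I_def using nz2 by (simp add: divide_simps)
  have "I * (2 * u * s * a * b * D' + 2 * v * R * Z) = I * (w * b * D' - w' * (f * R))"
    using id unfolding v_def w_def w'_def f_def by simp
  then show ?thesis unfolding A B C0 C1 v_def[symmetric] w_def[symmetric] w'_def[symmetric] f_def[symmetric] 1 2 3 4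
    by (simp only: distrib_left right_diff_distrib diff_minus_eq_add)
qed

section \<open>Bounds that are uniform along all shifts\<close>

lemma cmod_ratio_le:
  fixes a b :: complex
  assumes "cmod a \<le> M + 1/25" "cmod b \<ge> M - 1/25" "m \<le> M" "1 \<le> m"
  shows "cmod (a / b) \<le> 1 + 1 / (12 * m)"
proof -
  have "0 < M - 1/25" "M > 0" "m > 0" using assms by auto
  have "cmod (a / b) \<le> (M + 1/25) / (M - 1/25)"
    unfolding norm_divide using assms \<open>0 < M - 1/25\<close> \<open>M > 0\<close>
    by (intro frac_le) auto
  also have "\<dots> \<le> 1 + 1 / (12 * m)"
  proof -
    have "24 * m \<le> 25 * M - 1" using assms by linarith
    then have "2 / (25 * M - 1) \<le> 2 / (24 * m)" using \<open>m > 0\<close> by (intro frac_le) auto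
    moreover have "(M + 1/25) / (M - 1/25) = 1 + 2 / (25 * M - 1)" using \<open>0 < M - 1/25\<close> by (simp add: divide_simps) (simp add: algebra_simps)
    ultimately show ?thesis by simp
  qed
  finally show ?thesis .
qed

lemma prod_Suc_quotient: "(\<Prod>j<k. 1 + 1 / real (Suc j)) = real (Suc k)"
  by (induction k) (simp_all add: field_simps)

lemma cmod_times_prod_le:
  fixes f :: complex and r :: "nat \<Rightarrow> complex"
  assumes "cmod f \<le> C / real (Suc k) ^ 3" "\<And>j. cmod (r j) \<le> 1 + 1 / real (Suc j)"
  shows "cmod (f * (\<Prod>j<k. r j)) \<le> C / real (Suc k) ^ 2"
proof -
  have C: "C \<ge> 0"
    using assms(1) norm_ge_zero[of f] by (smt (verit) divide_nonneg_nonneg divide_neg_pos of_nat_0_less_iff zero_less_Suc zero_less_power)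
  have "cmod (f * (\<Prod>j<k. r j)) \<le> C / real (Suc k) ^ 3 * (\<Prod>j<k. 1 + 1 / real (Suc j))"
    unfolding norm_mult prod_norm[symmetric] using assms C
    by (intro mult_mono prod_mono prod_nonneg) auto
  also have "\<dots> = C / real (Suc k) ^ 2" unfolding prod_Suc_quotient by (simp add: power2_eq_square power3_eq_cube)
  finally show ?thesis .
qed

lemma summable_inverse_squares: "summable (\<lambda>k. C / real (Suc k) ^ 2)"
  using inverse_squares_sums[THEN sums_summable, THEN summable_mult, of C] by (simp add: add_ac)

text \<open>The reason for the 12 in \<open>cmod_ratio_le\<close>: four such ratios together stay
  below \<open>1 + 1 / m\<close>, whose product telescopes to linear growth. One of the three powers
  in the prefactor pays for it, and a summable \<open>1 / k^2\<close> is left.\<close>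

lemma pow4_bound:
  fixes m :: real assumes "m \<ge> 1" shows "(1 + 1 / (12 * m)) ^ 4 \<le> 1 + 1 / m"
proof -
  define x where "x = 1 / (12 * m)"
  have x: "0 \<le> x" "x \<le> 1/12" using assms by (auto simp: x_def field_simps)
  have "x^2 \<le> x / 12" "x^3 \<le> x / 144" "x^4 \<le> x/1728"
  proof -
    show 1: "x^2 \<le> x / 12" using mult_left_mono[OF x(2) x(1)] by (simp add: power2_eq_square)
    show 2: "x^3 \<le> x / 144" using mult_left_mono[OF 1 x(1)] 1 by (simp add: power2_eq_square power3_eq_cube)
    show "x^4 \<le> x / 1728" using mult_left_mono[OF 2 x(1)] 1 by (simp add: power2_eq_square power3_eq_cube power4_eq_xxxx)
  qed
  moreover have "(1 + x)^4 = 1 + 4 * x + 6 * x^2 + 4 * x^3 + x^4"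
    by (simp add: power4_eq_xxxx power2_eq_square power3_eq_cube algebra_simps)
  ultimately have "(1 + x)^4 \<le> 1 + 12 * x" using x by linarith
  then show ?thesis using assms by (simp add: x_def)
qed

lemma prod4_bound:
  fixes z1 z2 z3 z4 :: complex
  assumes "m \<ge> 1" "cmod z1 \<le> 1 + 1 / (12 * m)" "cmod z2 \<le> 1 + 1 / (12 * m)" "cmod z3 \<le> 1 + 1 / (12 * m)" "cmod z4 \<le> 1 + 1 / (12 * m)"
  shows "cmod (z1 * z2 * z3 * z4) \<le> 1 + 1 / m"
proof -
  have "cmod (z1 * z2 * z3 * z4) \<le> (1 + 1 / (12 * m)) * (1 + 1 / (12 * m)) * (1 + 1 / (12 * m)) * (1 + 1 / (12 * m))"
    unfolding norm_mult using assms by (intro mult_mono) auto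
  also have "\<dots> \<le> 1 + 1 / m" using pow4_bound[OF assms(1)] by (simp add: power4_eq_xxxx)
  finally show ?thesis .
qed

text \<open>
  The radius 1/200 makes every factor that occurs differ from an integer by at most 1/25, which is what the explicit
  bounds need; only some neighbourhood of 0 matters later.
\<close>

locale small5 =
  fixes v1 v2 v3 v4 v5 :: complex
  assumes small: "cmod v1 \<le> 1/200" "cmod v2 \<le> 1/200" "cmod v3 \<le> 1/200" "cmod v4 \<le> 1/200" "cmod v5 \<le> 1/200"
begin

definition "w = (v1 + v2 + v3 + v4 - v5) / 2"

abbreviation "ws n \<equiv> wsummand (v1 + 2 * of_nat n) (v2 + of_nat n) (v3 + of_nat n) (v4 + of_nat n) (v5 + of_nat n)"
abbreviation "wp n \<equiv> wprod (v1 + 2 * of_nat n) (v2 + of_nat n) (v3 + of_nat n) (v4 + of_nat n) (w + 2 * of_nat n)"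

lemma w_small: "cmod w \<le> 5/400"
proof -
  have "cmod (v1 + v2 + v3 + v4 - v5) \<le> cmod v1 + cmod v2 + cmod v3 + cmod v4 + cmod v5"
    by (smt (verit) norm_triangle_ineq norm_triangle_ineq4)
  then show ?thesis using small unfolding w_def norm_divide by simp
qed

lemma near: "cmod (of_nat a + z) \<le> real a + 1/25" "cmod (of_nat a + z) \<ge> real a - 1/25" if "cmod z \<le> 1/25"
  using that norm_triangle_ineq[of "of_nat a" z] norm_diff_ineq[of "of_nat a :: complex" z] by simp_all

lemma sm: "cmod (w - v1) \<le> 1/25" "cmod (w - v2) \<le> 1/25" "cmod (w - v3) \<le> 1/25" "cmod (w - v4) \<le> 1/25"
  "cmod v1 \<le> 1/25" "cmod v2 \<le> 1/25" "cmod v3 \<le> 1/25" "cmod v4 \<le> 1/25" "cmod v5 \<le> 1/25" "cmod (w/2) \<le> 1/25"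
  "cmod (w + v5 - v2 - v3) \<le> 1/25" "cmod (w + v5 - v2 - v4) \<le> 1/25" "cmod (w + v5 - v3 - v4) \<le> 1/25"
proof -
  note [simp] = w_small
  have A: "cmod (w - u) \<le> 7/400" if "cmod u \<le> 1/200" for u using norm_triangle_ineq4[of w u] w_small that by linarith
  have B: "cmod (w + v5 - u - u') \<le> 11/400" if "cmod u \<le> 1/200" "cmod u' \<le> 1/200" for u u'
    using norm_triangle_ineq4[of "w + v5 - u" u'] norm_triangle_ineq4[of "w + v5" u] norm_triangle_ineq[of w v5]
     w_small that small(5) by linarith
  show "cmod (w - v1) \<le> 1/25" "cmod (w - v2) \<le> 1/25" "cmod (w - v3) \<le> 1/25" "cmod (w - v4) \<le> 1/25"
    using A[OF small(1)] A[OF small(2)] A[OF small(3)] A[OF small(4)] by linarith+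
  show "cmod v1 \<le> 1/25" "cmod v2 \<le> 1/25" "cmod v3 \<le> 1/25" "cmod v4 \<le> 1/25" "cmod v5 \<le> 1/25"
    using small by linarith+
  show "cmod (w/2) \<le> 1/25" using w_small by (simp add: norm_divide)
  show "cmod (w + v5 - v2 - v3) \<le> 1/25" "cmod (w + v5 - v2 - v4) \<le> 1/25" "cmod (w + v5 - v3 - v4) \<le> 1/25"
    using B[OF small(2) small(3)] B[OF small(2) small(4)] B[OF small(3) small(4)] by linarith+
qed

lemma wp_factor_bound:
  fixes m n :: nat assumes "m \<ge> 1"
  shows "cmod (((of_nat m + (w + 2 * of_nat n) - (v1 + 2 * of_nat n)) * (of_nat m + (w + 2 * of_nat n) - (v2 + of_nat n)) *
      (of_nat m + (w + 2 * of_nat n) - (v3 + of_nat n)) * (of_nat m + (w + 2 * of_nat n) - (v4 + of_nat n))) /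
    ((of_nat m + (v1 + 2 * of_nat n)) * (of_nat m + (v2 + of_nat n)) * (of_nat m + (v3 + of_nat n)) * (of_nat m + (v4 + of_nat n))))
    \<le> 1 + 1 / real m"
proof -
  have r: "cmod ((of_nat m + (w + 2 * of_nat n) - (v + of_nat n)) / (of_nat m + (v + of_nat n))) \<le> 1 + 1 / (12 * real m)"
    if "cmod (w - v) \<le> 1/25" "cmod v \<le> 1/25" for v
  proof (rule cmod_ratio_le[where M = "real (m + n)"])
    have eq: "of_nat m + (w + 2 * of_nat n) - (v + of_nat n) = of_nat (m + n) + (w - v)" by simp
    show "cmod (of_nat m + (w + 2 * of_nat n) - (v + of_nat n)) \<le> real (m + n) + 1/25" unfolding eq by (rule near(1)[OF that(1)])
    have eq: "of_nat m + (v + of_nat n) = of_nat (m + n) + v" by simp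
    show "cmod (of_nat m + (v + of_nat n)) \<ge> real (m + n) - 1/25" unfolding eq by (rule near(2)[OF that(2)])
  qed (use assms in auto)
  have r1: "cmod ((of_nat m + (w + 2 * of_nat n) - (v1 + 2 * of_nat n)) / (of_nat m + (v1 + 2 * of_nat n))) \<le> 1 + 1 / (12 * real m)"
  proof (rule cmod_ratio_le[where M = "real m"])
    have eq: "of_nat m + (w + 2 * of_nat n) - (v1 + 2 * of_nat n) = of_nat m + (w - v1)" by simp
    show "cmod (of_nat m + (w + 2 * of_nat n) - (v1 + 2 * of_nat n)) \<le> real m + 1/25" unfolding eq by (rule near(1)[OF sm(1)])
    have eq: "of_nat m + (v1 + 2 * of_nat n) = of_nat (m + 2 * n) + v1" by simp
    show "cmod (of_nat m + (v1 + 2 * of_nat n)) \<ge> real m - 1/25" unfolding eq using near(2)[OF sm(5), of "m + 2 * n"] by simp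
  qed (use assms in auto)
  show ?thesis
    using prod4_bound[OF _ r1 r[OF sm(2) sm(6)] r[OF sm(3) sm(7)] r[OF sm(4) sm(8)]] assms by simp
qed

text \<open>Independence of \<open>n\<close> is the point: it keeps the difference of the two series
  bounded while the shift is iterated.\<close>

lemma ws_bound: "cmod (ws n k) \<le> 2 / real (Suc k) ^ 2"
proof -
  define m where "m = Suc k"
  have m: "m \<ge> 1" by (simp add: m_def)
  have h: "(v1 + 2 * of_nat n + (v2 + of_nat n) + (v3 + of_nat n) + (v4 + of_nat n) - (v5 + of_nat n)) / 2 = w + 2 * of_nat n"
    "(v1 + 2 * of_nat n + (v2 + of_nat n) + (v3 + of_nat n) + (v4 + of_nat n) - (v5 + of_nat n)) / 4 = w/2 + of_nat n"
    by (simp_all add: w_def field_simps)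
  have r: "cmod ((of_nat m + (w/2 + of_nat n)) / (of_nat m + (v2 + of_nat n))) \<le> 1 + 1 / (12 * real m)"
  proof (rule cmod_ratio_le[where M = "real (m + n)"])
    have eq: "of_nat m + (w/2 + of_nat n) = of_nat (m + n) + w/2" by simp
    show "cmod (of_nat m + (w/2 + of_nat n)) \<le> real (m + n) + 1/25" unfolding eq by (rule near(1)[OF sm(10)])
    have eq: "of_nat m + (v2 + of_nat n) = of_nat (m + n) + v2" by simp
    show "cmod (of_nat m + (v2 + of_nat n)) \<ge> real (m + n) - 1/25" unfolding eq by (rule near(2)[OF sm(6)])
  qed (use m in auto)
  have d: "cmod (1 / (of_nat m + (v + of_nat i))) \<le> (25/24) / real m" if "cmod v \<le> 1/25" for v and i :: nat
  proof -
    have eq: "of_nat m + (v + of_nat i) = of_nat (m + i) + v" by simp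
    have "cmod (of_nat m + (v + of_nat i)) \<ge> real (m + i) - 1/25"
      unfolding eq by (rule near(2)[OF that])
    then have "cmod (of_nat m + (v + of_nat i)) \<ge> 24/25 * real m" using m by simp
    then have "1 / cmod (of_nat m + (v + of_nat i)) \<le> 1 / (24/25 * real m)"
      using m by (intro divide_left_mono mult_pos_pos) auto
    then show ?thesis using m by (simp add: norm_divide)
  qed
  have "cmod ((of_nat m + (w/2 + of_nat n)) / (of_nat m + (v2 + of_nat n)) * (1 / (of_nat m + (v1 + of_nat (2 * n))))
     * (1 / (of_nat m + (v3 + of_nat n))) * (1 / (of_nat m + (v4 + of_nat n))))
     \<le> (13/12) * ((25/24) / real m) * ((25/24) / real m) * ((25/24) / real m)"
    unfolding norm_mult using r d[OF sm(5), of "2 * n"] d[OF sm(7), of n] d[OF sm(8), of n] m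
    by (intro mult_mono order_trans[OF r]) (auto simp: field_simps)
  also have "\<dots> \<le> 2 / real m ^ 3" using m by (simp add: field_simps power3_eq_cube)
  finally have pre: "cmod ((of_nat m + (w/2 + of_nat n)) / ((of_nat m + (v1 + 2 * of_nat n)) * (of_nat m + (v2 + of_nat n)) *
      (of_nat m + (v3 + of_nat n)) * (of_nat m + (v4 + of_nat n)))) \<le> 2 / real m ^ 3"
    by (simp add: mult_ac)
  show ?thesis unfolding wsummand_def h wprod_def
    using pre unfolding m_def by (intro cmod_times_prod_le wp_factor_bound) simp_all
qed

lemma wp_bound: "cmod (wp n k) \<le> real (Suc k)"
proof -
  have "cmod (wp n k) \<le> (\<Prod>j<k. 1 + 1 / real (Suc j))"
    unfolding wprod_def prod_norm[symmetric]
    by (intro prod_mono conjI norm_ge_zero wp_factor_bound) simp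
  then show ?thesis by (simp only: prod_Suc_quotient)
qed

lemma ws_summable: "summable (ws n)"
  by (rule summable_comparison_test'[OF summable_inverse_squares]) (rule ws_bound)

lemma ws_sum_bound: "cmod (suminf (ws n)) \<le> (\<Sum>k. 2 / real (Suc k) ^ 2)"
  by (rule norm_suminf_le[OF ws_bound summable_inverse_squares])

end

section \<open>Decay of the certificate and invariance of the recurrence under exchanging
  \<open>y4\<close> and \<open>y5\<close>\<close>

lemma tendsto_shift_quotient: "(\<lambda>k. (of_nat (Suc k) + c) / of_nat (Suc k) :: complex) \<longlonglongrightarrow> 1"
proof -
  have "(\<lambda>k. 1 + c * inverse (of_nat (Suc k)) :: complex) \<longlonglongrightarrow> 1 + c * 0"
    by (intro tendsto_intros LIMSEQ_Suc[OF lim_inverse_n])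
  moreover have "1 + c * inverse (of_nat (Suc k)) = (of_nat (Suc k) + c) / of_nat (Suc k)" for k
    by (simp add: field_simps del: of_nat_Suc)
  ultimately show ?thesis by (simp only: mult_zero_right add_0_right)
qed

lemma tendsto_wpol:
  "(\<lambda>k. wpol (of_nat (Suc k) + d) t c2 c3 c4 / of_nat (Suc k) ^ 3) \<longlonglongrightarrow> 1"
proof -
  define a b where "a k = (of_nat (Suc k) + d) / of_nat (Suc k)" and "b k = inverse (of_nat (Suc k) :: complex)" for k
  have ab: "a \<longlonglongrightarrow> 1" "b \<longlonglongrightarrow> 0"
    unfolding a_def b_def by (rule tendsto_shift_quotient LIMSEQ_Suc[OF lim_inverse_n])+
  have "(\<lambda>k. a k ^ 3 + 2 * a k ^ 2 * (t * b k) + 2 * a k * (t * b k)^2 + (c2+c3+c4) * b k * a k * (a k + 2 * (t * b k))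
     + (c2* c3+c2* c4+c3* c4) * b k ^ 2 * a k - c2* c3* c4* b k ^ 3) \<longlonglongrightarrow>
     1^3 + 2 * 1^2 * (t * 0) + 2 * 1 * (t * 0)^2 + (c2+c3+c4) * 0 * 1 * (1 + 2 * (t * 0)) + (c2* c3+c2* c4+c3* c4) * 0^2 * 1 - c2* c3* c4*0^3"
    by (intro tendsto_intros ab)
  moreover have "a k ^ 3 + 2 * a k ^ 2 * (t * b k) + 2 * a k * (t * b k)^2 + (c2+c3+c4) * b k * a k * (a k + 2 * (t * b k))
     + (c2* c3+c2* c4+c3* c4) * b k ^ 2 * a k - c2* c3* c4* b k ^ 3 = wpol (of_nat (Suc k) + d) t c2 c3 c4 / of_nat (Suc k) ^ 3" for k
  proof -
    define n where "n = (of_nat (Suc k) :: complex)"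
    have n: "n \<noteq> 0" unfolding n_def by (simp del: of_nat_Suc)
    define s where "s = n + d"
    define i where "i = inverse n"
    show ?thesis unfolding a_def b_def n_def[symmetric] s_def[symmetric] wpol_def
      unfolding divide_inverse power_inverse[symmetric] i_def[symmetric] by algebra
  qed
  ultimately show ?thesis by simp
qed

text \<open>At index 0 the product is empty and the denominator is \<open>2 (2 + y1)\<close> times
  the product of all \<open>1 + yi\<close>, hence symmetric. What has to be checked is the symmetry
  of \<open>wpol\<close> at \<open>s = 1 + h / 2\<close>.\<close>

lemma wcert_0_swap: "wcert y1 y2 y3 y4 y5 0 = wcert y1 y2 y3 y5 y4 0"
proof -
  have *: "wpol (1 + h / 2) (1 + y1 - h / 2) (y2 - h / 2) (y3 - h / 2) (y4 - h / 2) =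
     wpol (1 + h' / 2) (1 + y1 - h' / 2) (y2 - h' / 2) (y3 - h' / 2) (y5 - h' / 2)"
    if "2 * h = y1 + y2 + y3 + y4 - y5" "h' = h + y5 - y4" for h h'
  proof -
    define e f where "e = h / 2" and "f = h' / 2"
    have "2 * e = h" "2 * f = h'" by (simp_all add: e_def f_def)
    then have "2 * f + 2 * e = 2 * h + y5 - y4" "2 * f - 2 * e = y5 - y4" using that(2) by simp_all
    moreover have "2 * h + y5 - y4 = y1 + y2 + y3" unfolding that(1) by simp
    ultimately have "y1 = 2 * f + 2 * e - y2 - y3" "y5 = y4 + 2 * f - 2 * e" by (simp_all add: algebra_simps)
    then show ?thesis unfolding wpol_def e_def[symmetric] f_def[symmetric] by algebra
  qed
  have "wpol (1 + (y1 + y2 + y3 + y4 - y5) / 2 / 2) (1 + y1 - (y1 + y2 + y3 + y4 - y5) / 2 / 2)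
       (y2 - (y1 + y2 + y3 + y4 - y5) / 2 / 2) (y3 - (y1 + y2 + y3 + y4 - y5) / 2 / 2) (y4 - (y1 + y2 + y3 + y4 - y5) / 2 / 2) =
     wpol (1 + (y1 + y2 + y3 + y5 - y4) / 2 / 2) (1 + y1 - (y1 + y2 + y3 + y5 - y4) / 2 / 2)
       (y2 - (y1 + y2 + y3 + y5 - y4) / 2 / 2) (y3 - (y1 + y2 + y3 + y5 - y4) / 2 / 2) (y5 - (y1 + y2 + y3 + y5 - y4) / 2 / 2)"
    by (rule *) (simp_all add: diff_divide_distrib add_divide_distrib)
  then show ?thesis
    unfolding wcert_def Let_def wprod_def lessThan_0 prod.empty of_nat_Suc of_nat_0 add_0_right mult_1_left
    by (simp only: mult_ac)
qed

text \<open>The exchange turns \<open>h\<close> into \<open>h + y5 - y4\<close> and permutes the six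
  numerator factors; for instance \<open>1 + h - y2\<close> becomes
  \<open>1 + h + y5 - y2 - y4\<close>.\<close>

lemma wrho_swap: "wrho y1 y2 y3 y4 y5 = wrho y1 y2 y3 y5 y4"
proof -
  define h where "h = (y1 + y2 + y3 + y4 - y5) / 2"
  have h': "(y1 + y2 + y3 + y5 - y4) / 2 = h + y5 - y4" by (simp add: h_def field_simps)
  have e: "1 + (h + y5 - y4) - y2 = 1 + h + y5 - y2 - y4" "1 + (h + y5 - y4) - y3 = 1 + h + y5 - y3 - y4"
    "1 + (h + y5 - y4) - y5 = 1 + h - y4" "1 + (h + y5 - y4) + y4 - y2 - y3 = 1 + h + y5 - y2 - y3"
    "1 + (h + y5 - y4) + y4 - y2 - y5 = 1 + h - y2" "1 + (h + y5 - y4) + y4 - y3 - y5 = 1 + h - y3" by simp_all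
  show ?thesis unfolding wrho_def Let_def h' h_def[symmetric] e by (simp only: mult_ac)
qed

context small5 begin

lemma nz: "of_nat (Suc m) + (v1 + 2 * of_nat n) \<noteq> 0" "of_nat (Suc m) + (v2 + of_nat n) \<noteq> 0"
   "of_nat (Suc m) + (v3 + of_nat n) \<noteq> 0" "of_nat (Suc m) + (v4 + of_nat n) \<noteq> 0" "of_nat (Suc m) + (v5 + of_nat n) \<noteq> 0"
proof -
  have *: "of_nat (Suc m) + (v + of_nat i) \<noteq> 0" if "cmod v \<le> 1/25" for v and i :: nat
  proof -
    have eq: "of_nat (Suc m) + (v + of_nat i) = of_nat (Suc m + i) + v" by simp
    have "cmod (of_nat (Suc m) + (v + of_nat i)) \<ge> real (Suc m + i) - 1/25"
      unfolding eq by (rule near(2)[OF that])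
    then show ?thesis by auto
  qed
  show "of_nat (Suc m) + (v1 + 2 * of_nat n) \<noteq> 0" using *[OF sm(5), of "2 * n"] by simp
  show "of_nat (Suc m) + (v2 + of_nat n) \<noteq> 0" by (rule *[OF sm(6)])
  show "of_nat (Suc m) + (v3 + of_nat n) \<noteq> 0" by (rule *[OF sm(7)])
  show "of_nat (Suc m) + (v4 + of_nat n) \<noteq> 0" by (rule *[OF sm(8)])
  show "of_nat (Suc m) + (v5 + of_nat n) \<noteq> 0" by (rule *[OF sm(9)])
qed

abbreviation "wc n \<equiv> wcert (v1 + 2 * of_nat n) (v2 + of_nat n) (v3 + of_nat n) (v4 + of_nat n) (v5 + of_nat n)"
abbreviation "wr n \<equiv> wrho (v1 + 2 * of_nat n) (v2 + of_nat n) (v3 + of_nat n) (v4 + of_nat n) (v5 + of_nat n)"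

text \<open>The polynomial \<open>wpol\<close> has degree 3 in the index against degree 5 in the
  denominator, and \<open>wp n k\<close> grows at most linearly, so the certificate is of order
  \<open>1 / k\<close>.\<close>

lemma wc_tendsto: "wc n \<longlonglongrightarrow> 0"
proof -
  have h: "(v1 + 2 * of_nat n + (v2 + of_nat n) + (v3 + of_nat n) + (v4 + of_nat n) - (v5 + of_nat n)) / 2 = w + 2 * of_nat n"
    by (simp add: w_def field_simps)
  define y1 y2 y3 y4 y5 where ys: "y1 = v1 + 2 * of_nat n" "y2 = v2 + of_nat n" "y3 = v3 + of_nat n" "y4 = v4 + of_nat n" "y5 = v5 + of_nat n"
  define h where "h = w + 2 * of_nat n"
  define W where "W k = wpol (of_nat (Suc k) + h / 2) (1 + y1 - h / 2) (y2 - h / 2) (y3 - h / 2) (y4 - h / 2)" for k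
  define X where "X k = inverse (of_nat (Suc k)) * ((W k / of_nat (Suc k) ^ 3) / (2 * (1 + y5) *
     (((of_nat (Suc k) + y1) / of_nat (Suc k)) * ((of_nat (Suc k) + y2) / of_nat (Suc k)) * ((of_nat (Suc k) + y3) / of_nat (Suc k)) *
     ((of_nat (Suc k) + y4) / of_nat (Suc k))) * ((of_nat (Suc k) + (1 + y1)) / of_nat (Suc k))))" for k
  have y5: "1 + y5 \<noteq> 0" using nz(5)[of 0 n] by (simp add: ys add_ac)
  have u: "2 * (1 + y5) * (1 * 1 * 1 * 1) * 1 \<noteq> 0" using y5 by (metis mult_eq_0_iff mult_1_right zero_neq_numeral)
  have "X \<longlonglongrightarrow> 0 * (1 / (2 * (1 + y5) * (1 * 1 * 1 * 1) * 1))"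
    unfolding X_def W_def
    by (intro tendsto_intros tendsto_shift_quotient tendsto_wpol LIMSEQ_Suc[OF lim_inverse_n] u)
  then have X0: "X \<longlonglongrightarrow> 0" by simp
  have eq: "wc n k = (wp n k / of_nat (Suc k)) * X k" for k
  proof -
    define m where "m = (of_nat (Suc k) :: complex)"
    define p1 p2 p3 p4 p5 u where ps: "p1 = m + y1" "p2 = m + y2" "p3 = m + y3" "p4 = m + y4" "p5 = m + (1 + y1)" "u = 2 * (1 + y5)"
    have m: "m \<noteq> 0" unfolding m_def by (simp del: of_nat_Suc)
    have "u \<noteq> 0" using y5 unfolding ps by (metis mult_eq_0_iff zero_neq_numeral)
    moreover have "p1 \<noteq> 0" "p2 \<noteq> 0" "p3 \<noteq> 0" "p4 \<noteq> 0" "p5 \<noteq> 0"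
      using nz(1)[of k n] nz(2)[of k n] nz(3)[of k n] nz(4)[of k n] nz(1)[of "Suc k" n] y5
      by (simp_all add: ps ys m_def add_ac)
    ultimately have pn: "p1 \<noteq> 0" "p2 \<noteq> 0" "p3 \<noteq> 0" "p4 \<noteq> 0" "p5 \<noteq> 0" "u \<noteq> 0" by blast+
    have "wc n k = wp n k * W k / (u * (p1 * p2 * p3 * p4) * p5)"
      unfolding wcert_def Let_def h W_def ps h_def ys m_def by (simp only: add.assoc)
    also have "\<dots> = (wp n k / m) * (inverse m * ((W k / m ^ 3) / (u * ((p1/m) * (p2/m) * (p3/m) * (p4/m)) * (p5/m))))"
      using m pn by (simp add: field_simps power3_eq_cube)
    finally show ?thesis unfolding X_def m_def ps .
  qed
  show ?thesis
  proof (rule Lim_null_comparison[OF always_eventually tendsto_norm_zero[OF X0]], rule allI)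
    fix k
    have "cmod (wp n k / of_nat (Suc k)) \<le> 1" using wp_bound[of n k] by (simp add: norm_divide del: of_nat_Suc)
    then show "cmod (wc n k) \<le> cmod (X k)" unfolding eq norm_mult by (simp add: mult_left_le_one_le)
  qed
qed

lemma ws_recurrence: "suminf (ws n) - wr n * suminf (ws (Suc n)) = wc n 0"
proof -
  have e: "v1 + 2 * of_nat (Suc n) = v1 + 2 * of_nat n + 2" "v2 + of_nat (Suc n) = v2 + of_nat n + 1"
    "v3 + of_nat (Suc n) = v3 + of_nat n + 1" "v4 + of_nat (Suc n) = v4 + of_nat n + 1" "v5 + of_nat (Suc n) = v5 + of_nat n + 1"
    by simp_all
  have "(\<lambda>k. ws n k - wr n * ws (Suc n) k) sums (suminf (ws n) - wr n * suminf (ws (Suc n)))"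
    by (intro sums_diff sums_mult summable_sums ws_summable)
  moreover have "(\<lambda>k. wc n k - wc n (Suc k)) sums (wc n 0 - 0)"
    by (rule telescope_sums'[OF wc_tendsto])
  moreover have "ws n k - wr n * ws (Suc n) k = wc n k - wc n (Suc k)" for k
    unfolding e by (rule wz_relation) (use nz nz(5)[of 0] in \<open>simp_all add: add_ac\<close>)
  ultimately show ?thesis using sums_unique2 by (simp only: diff_zero) blast
qed

text \<open>For large \<open>n\<close> six numerators and four denominators are about
  \<open>n\<close> and the denominators \<open>1 + y1\<close>, \<open>2 + y1\<close> about
  \<open>2 n\<close>, so the factor tends to -1/4. For a bound valid from \<open>n = 0\<close> on it
  suffices to exploit the second of these two denominators.\<close>

lemma wr_bound: "cmod (wr n) \<le> 9/10"
proof -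
  define N where "N = Suc n"
  have N: "N \<ge> 1" by (simp add: N_def)
  have h: "(v1 + 2 * of_nat n + (v2 + of_nat n) + (v3 + of_nat n) + (v4 + of_nat n) - (v5 + of_nat n)) / 2 = w + 2 * of_nat n"
    by (simp add: w_def field_simps)
  have a: "1 + (w + 2 * of_nat n) - (v + of_nat n) = of_nat N + (w - v)"
    "1 + (w + 2 * of_nat n) + (v5 + of_nat n) - (v + of_nat n) - (v' + of_nat n) = of_nat N + (w + v5 - v - v')"
    "1 + (v + of_nat n) = of_nat N + v" for v v' by (simp_all add: N_def)
  have r: "cmod ((of_nat N + u) / (of_nat N + v)) \<le> 13/12" if "cmod u \<le> 1/25" "cmod v \<le> 1/25" for u v
  proof -
    have "cmod ((of_nat N + u) / (of_nat N + v)) \<le> 1 + 1 / (12 * 1)"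
      using near(1)[OF that(1), of N] near(2)[OF that(2), of N] N by (intro cmod_ratio_le[where M = "real N"]) auto
    then show ?thesis by simp
  qed
  have q1: "cmod ((of_nat N + u) / (1 + (v1 + 2 * of_nat n))) \<le> 13/12" if "cmod u \<le> 1/25" for u
  proof -
    have eq: "1 + (v1 + 2 * of_nat n) = of_nat (N + n) + v1" by (simp add: N_def)
    have "cmod (1 + (v1 + 2 * of_nat n)) \<ge> real N - 1/25" unfolding eq using near(2)[OF sm(5), of "N + n"] by simp
    then have "cmod ((of_nat N + u) / (1 + (v1 + 2 * of_nat n))) \<le> 1 + 1 / (12 * 1)"
      using near(1)[OF that, of N] N by (intro cmod_ratio_le[where M = "real N"]) auto
    then show ?thesis by simp
  qed
  have q2: "cmod ((of_nat N + u) / (2 + (v1 + 2 * of_nat n))) \<le> 27/50" if "cmod u \<le> 1/25" for u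
  proof -
    have eq: "2 + (v1 + 2 * of_nat n) = of_nat (2 * N) + v1" by (simp add: N_def)
    have c: "cmod (2 + (v1 + 2 * of_nat n)) \<ge> 2 * real N - 1/25" unfolding eq using near(2)[OF sm(5), of "2 * N"] by simp
    have "cmod ((of_nat N + u) / (2 + (v1 + 2 * of_nat n))) \<le> (real N + 1/25) / (2 * real N - 1/25)"
      unfolding norm_divide using c near(1)[OF that, of N] N by (intro frac_le) auto
    also have "\<dots> \<le> 27/50" using N by (simp add: field_simps)
    finally show ?thesis .
  qed
  have "wr n = - ((of_nat N + (w - v2)) / (1 + (v1 + 2 * of_nat n)) * ((of_nat N + (w - v3)) / (2 + (v1 + 2 * of_nat n))) *
     ((of_nat N + (w - v4)) / (of_nat N + v2)) * ((of_nat N + (w + v5 - v2 - v3)) / (of_nat N + v3)) *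
     ((of_nat N + (w + v5 - v2 - v4)) / (of_nat N + v4)) * ((of_nat N + (w + v5 - v3 - v4)) / (of_nat N + v5)))"
    unfolding wrho_def Let_def h a by (simp add: mult_ac)
  also have "cmod \<dots> \<le> (13/12) * (27/50) * (13/12) * (13/12) * (13/12) * (13/12)"
    unfolding norm_minus_cancel norm_mult using q1[OF sm(2)] q2[OF sm(3)] r[OF sm(4) sm(6)] r[OF sm(11) sm(7)] r[OF sm(12) sm(8)] r[OF sm(13) sm(9)]
    by (intro mult_mono) auto
  also have "\<dots> \<le> 9/10" by simp
  finally show ?thesis .
qed

end

text \<open>
  Both series satisfy the recurrence of \<open>ws_recurrence\<close>, with the same coefficient and the same inhomogeneous term.
  Their difference is thus multiplied at each step by a factor of modulus at most 9/10 and remains bounded, so it vanishes.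
\<close>

theorem wsummand_swap:
  assumes "small5 v1 v2 v3 v4 v5"
  shows "suminf (wsummand v1 v2 v3 v4 v5) = suminf (wsummand v1 v2 v3 v5 v4)"
proof -
  interpret A: small5 v1 v2 v3 v4 v5 by fact
  interpret B: small5 v1 v2 v3 v5 v4 using assms by (simp add: small5_def)
  define D where "D n = suminf (A.ws n) - suminf (B.ws n)" for n
  define K where "K = (\<Sum>k. 2 / real (Suc k) ^ 2)"
  have D: "D n = A.wr n * D (Suc n)" for n
    using A.ws_recurrence[of n] B.ws_recurrence[of n]
    unfolding wcert_0_swap[of _ _ _ "v4 + of_nat n" "v5 + of_nat n"] wrho_swap[of _ _ _ "v4 + of_nat n" "v5 + of_nat n"] D_def
    by (simp add: algebra_simps)
  have bound: "cmod (D n) \<le> 2 * K" for n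
    using norm_triangle_ineq4[of "suminf (A.ws n)" "suminf (B.ws n)"] A.ws_sum_bound[of n] B.ws_sum_bound[of n]
    unfolding D_def K_def by linarith
  have "cmod (D 0) \<le> (9/10) ^ n * cmod (D n)" for n
  proof (induction n)
    case (Suc n)
    have "cmod (D n) \<le> 9/10 * cmod (D (Suc n))"
      unfolding D[of n] norm_mult by (intro mult_right_mono A.wr_bound) auto
    then have "(9/10) ^ n * cmod (D n) \<le> (9/10) ^ n * (9/10 * cmod (D (Suc n)))" by (intro mult_left_mono) auto
    with Suc have "cmod (D 0) \<le> (9/10) ^ n * (9/10 * cmod (D (Suc n)))" by linarith
    then show ?case by (simp only: power_Suc mult_ac)
  qed simp
  then have le: "cmod (D 0) \<le> (9/10) ^ n * (2 * K)" for n
    using mult_left_mono[OF bound, of "(9/10) ^ n" n] by (meson order_trans zero_le_power zero_le_divide_iff zero_le_numeral)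
  have "(\<lambda>n. (9/10) ^ n * (2 * K)) \<longlonglongrightarrow> 0 * (2 * K)"
    by (intro tendsto_intros LIMSEQ_power_zero) auto
  then have "cmod (D 0) \<le> 0" using le by (intro LIMSEQ_le_const) auto
  then show ?thesis unfolding D_def by simp
qed

section \<open>Taylor coefficients of the scaled series\<close>

text \<open>
  The type is left general so that \<open>a\<close> can be a complex number or the formal variable of a power series; the Taylor
  coefficients of the sum are then the sums of the coefficients of the formal summands.
\<close>

definition qpoly :: "'a::comm_ring_1 \<Rightarrow> 'a \<Rightarrow> 'a \<Rightarrow> 'a \<Rightarrow> 'a \<Rightarrow> 'a \<Rightarrow> 'a" where
  "qpoly E1 E2 E3 E4 a x = x^4 + a * E1 * x^3 + a^2 * E2 * x^2 + a^3 * E3 * x + a^4 * E4"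

definition gsummand :: "'a::{comm_ring_1,inverse} \<Rightarrow> 'a \<Rightarrow> 'a \<Rightarrow> 'a \<Rightarrow> 'a \<Rightarrow> 'a \<Rightarrow> nat \<Rightarrow> 'a" where
  "gsummand c E1 E2 E3 E4 a k = (of_nat (Suc k) + a * c) * inverse (qpoly E1 E2 E3 E4 a (of_nat (Suc k))) *
     (\<Prod>j<k. qpoly E1 E2 E3 E4 a (- of_nat (Suc j) - 2 * a * c) * inverse (qpoly E1 E2 E3 E4 a (of_nat (Suc j))))"

text \<open>The deviation from \<open>m^4\<close> carries the factor \<open>cmod a\<close>, because
  \<open>x + m = - 2 a c\<close> divides \<open>x^4 - m^4\<close> and every other term contains
  \<open>a\<close>. For small \<open>a\<close> the quartic divided by \<open>m^3\<close> is thus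
  within 1/25 of \<open>m\<close>, as \<open>cmod_ratio_le\<close> requires.\<close>

lemma qpoly_bound:
  fixes c :: complex
  shows "\<exists>L\<ge>0. \<forall>a m. cmod a \<le> 1 \<longrightarrow> m \<ge> 1 \<longrightarrow>
     cmod (qpoly E1 E2 E3 E4 a (- of_nat m - 2 * a * c) - of_nat m ^ 4) \<le> cmod a * L * real m ^ 3"
proof -
  define B where "B = 1 + 2 * cmod c"
  have B: "B \<ge> 1" by (simp add: B_def)
  define L where "L = (8 * cmod c + cmod E1 + cmod E2 + cmod E3 + cmod E4) * B ^ 3"
  have "cmod (qpoly E1 E2 E3 E4 a (- of_nat m - 2 * a * c) - of_nat m ^ 4) \<le> cmod a * L * real m ^ 3"
    if a: "cmod a \<le> 1" and m: "m \<ge> 1" for a and m :: nat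
  proof -
    define x where "x = (- of_nat m - 2 * a * c :: complex)"
    define R where "R = real m * B"
    have mR: "real m \<le> R" "1 \<le> R" using B m by (auto simp: R_def intro: order_trans[of 1 "real m"])
    have x: "cmod x \<le> R"
    proof -
      have "cmod x \<le> real m + 2 * (cmod a * cmod c)"
        unfolding x_def using norm_triangle_ineq4[of "- of_nat m" "2 * a * c"] by (simp add: norm_mult)
      also have "cmod a * cmod c \<le> real m * cmod c" using a m by (intro mult_right_mono) auto
      finally show ?thesis by (simp add: R_def B_def algebra_simps)
    qed
    have xp: "cmod (x ^ i) \<le> R ^ 3" if "i \<le> 3" for i
      using power_mono[OF x, of i] power_increasing[OF that mR(2)] by (simp add: norm_power)
    have ap: "cmod (a ^ i) \<le> cmod a" if "i \<ge> 1" for i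
      using power_decreasing[OF that _ a] by (simp add: norm_power)
    have t: "cmod (a ^ i * E * x ^ j) \<le> cmod a * cmod E * R ^ 3" if "i \<ge> 1" "j \<le> 3" for i j E
      unfolding norm_mult using xp[OF that(2)] ap[OF that(1)] by (intro mult_mono) auto
    have "x ^ 4 - of_nat m ^ 4 = (x + of_nat m) * (x - of_nat m) * (x ^ 2 + of_nat m ^ 2)"
      by (simp add: power4_eq_xxxx power2_eq_square algebra_simps)
    also have "cmod \<dots> \<le> (cmod a * (2 * cmod c)) * (2 * R) * (2 * R ^ 2)"
    proof -
      have 1: "cmod (x + of_nat m) \<le> cmod a * (2 * cmod c)" by (simp add: x_def norm_mult)
      have 2: "cmod (x - of_nat m) \<le> 2 * R" using norm_triangle_ineq4[of x "of_nat m"] x mR by simp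
      have "cmod (x ^ 2 + of_nat m ^ 2) \<le> cmod x ^ 2 + real m ^ 2"
        using norm_triangle_ineq[of "x^2" "of_nat m ^ 2"] by (simp add: norm_power)
      also have "\<dots> \<le> 2 * R ^ 2" using power_mono[OF x, of 2] power_mono[OF mR(1), of 2] by simp
      finally have 3: "cmod (x ^ 2 + of_nat m ^ 2) \<le> 2 * R ^ 2" .
      show ?thesis unfolding norm_mult[of "(x + of_nat m) * (x - of_nat m)"] norm_mult[of "x + of_nat m"]
        using 1 2 3 mR by (intro mult_mono mult_nonneg_nonneg) auto
    qed
    finally have 4: "cmod (x ^ 4 - of_nat m ^ 4) \<le> cmod a * (8 * cmod c) * R ^ 3"
      by (simp add: power2_eq_square power3_eq_cube mult_ac)
    have "qpoly E1 E2 E3 E4 a x - of_nat m ^ 4 = (x ^ 4 - of_nat m ^ 4) + a ^ 1 * E1 * x ^ 3 + a ^ 2 * E2 * x ^ 2 +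
        a ^ 3 * E3 * x ^ 1 + a ^ 4 * E4 * x ^ 0" by (simp add: qpoly_def)
    also have "cmod \<dots> \<le> cmod a * (8 * cmod c) * R ^ 3 + cmod a * cmod E1 * R ^ 3 + cmod a * cmod E2 * R ^ 3 +
        cmod a * cmod E3 * R ^ 3 + cmod a * cmod E4 * R ^ 3"
      by (intro norm_triangle_le add_mono 4 t) auto
    also have "\<dots> = cmod a * L * real m ^ 3" by (simp add: L_def R_def algebra_simps power_mult_distrib)
    finally show ?thesis unfolding x_def .
  qed
  moreover have "L \<ge> 0" using B by (simp add: L_def)
  ultimately show ?thesis by blast
qed

text \<open>This is \<open>qpoly_bound\<close> with \<open>c = 0\<close>; negating \<open>E1\<close>
  and \<open>E3\<close> undoes the sign of the argument.\<close>

lemma qpoly_bound0: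
  "\<exists>L\<ge>0. \<forall>a m. cmod a \<le> 1 \<longrightarrow> m \<ge> 1 \<longrightarrow>
     cmod (qpoly E1 E2 E3 E4 a (of_nat m) - of_nat m ^ 4) \<le> cmod a * L * real m ^ 3"
proof -
  obtain L where L: "L \<ge> 0" "\<And>a m. cmod a \<le> 1 \<Longrightarrow> m \<ge> 1 \<Longrightarrow>
     cmod (qpoly (-E1) E2 (-E3) E4 a (- of_nat m - 2 * a * 0) - of_nat m ^ 4) \<le> cmod a * L * real m ^ 3"
    using qpoly_bound[of "-E1" E2 "-E3" E4 0] by blast
  have "qpoly (-E1) E2 (-E3) E4 a (- of_nat m - 2 * a * 0) = qpoly E1 E2 E3 E4 a (of_nat m)" for a and m :: nat
    by (simp add: qpoly_def)
  with L show ?thesis by metis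
qed

lemma gsummand_bound:
  fixes c E1 E2 E3 E4 :: complex
  shows "\<exists>r>0. \<forall>a. cmod a \<le> r \<longrightarrow> (\<forall>m\<ge>1. qpoly E1 E2 E3 E4 a (of_nat m) \<noteq> 0) \<and>
     (\<forall>k. cmod (gsummand c E1 E2 E3 E4 a k) \<le> 3 / real (Suc k) ^ 2)"
proof -
  obtain L1 where L1: "L1 \<ge> 0" "\<And>a m. cmod a \<le> 1 \<Longrightarrow> m \<ge> 1 \<Longrightarrow>
     cmod (qpoly E1 E2 E3 E4 a (- of_nat m - 2 * a * c) - of_nat m ^ 4) \<le> cmod a * L1 * real m ^ 3"
    using qpoly_bound[of E1 E2 E3 E4 c] by blast
  obtain L2 where L2: "L2 \<ge> 0" "\<And>a m. cmod a \<le> 1 \<Longrightarrow> m \<ge> 1 \<Longrightarrow>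
     cmod (qpoly E1 E2 E3 E4 a (of_nat m) - of_nat m ^ 4) \<le> cmod a * L2 * real m ^ 3"
    using qpoly_bound0[of E1 E2 E3 E4] by blast
  \<comment> \<open>For \<open>cmod a \<le> 1 / K\<close> the deviations \<open>cmod a * L1\<close>,
    \<open>cmod a * L2\<close> and \<open>cmod a * cmod c\<close> are each at most 1/25.\<close>
  define K where "K = 25 * (1 + L1 + L2 + cmod c)"
  have K: "K \<ge> 25" using L1(1) L2(1) by (simp add: K_def)
  define r where "r = 1 / K"
  have r0: "r > 0" using K by (simp add: r_def)
  have "(\<forall>m\<ge>1. qpoly E1 E2 E3 E4 a (of_nat m) \<noteq> 0) \<and> (\<forall>k. cmod (gsummand c E1 E2 E3 E4 a k) \<le> 3 / real (Suc k) ^ 2)"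
    if a: "cmod a \<le> r" for a
  proof -
    have aK: "cmod a * K \<le> 1" using a K by (simp add: r_def field_simps)
    have a1: "cmod a \<le> 1" using a K by (simp add: r_def) (smt (verit) divide_le_eq_1)
    have "cmod a * (25 * (1 + L1 + L2 + cmod c)) \<le> 1" using aK unfolding K_def .
    then have "cmod a * L1 + cmod a * L2 + cmod a * cmod c + cmod a \<le> 1/25" by (simp add: algebra_simps)
    moreover have "cmod a * L1 \<ge> 0" "cmod a * L2 \<ge> 0" "cmod a * cmod c \<ge> 0" using L1(1) L2(1) by simp_all
    ultimately have aL: "cmod a * L1 \<le> 1/25" "cmod a * L2 \<le> 1/25" "cmod a * cmod c \<le> 1/25" using norm_ge_zero[of a] by linarith+
    have up: "cmod (qpoly E1 E2 E3 E4 a (- of_nat m - 2 * a * c) / of_nat m ^ 3) \<le> real m + 1/25" if m: "m \<ge> 1" for m :: nat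
    proof -
      have "cmod (qpoly E1 E2 E3 E4 a (- of_nat m - 2 * a * c) - of_nat m ^ 4) \<le> 1/25 * real m ^ 3"
        using L1(2)[OF a1 m] mult_right_mono[OF aL(1), of "real m ^ 3"] by simp
      then have "cmod (qpoly E1 E2 E3 E4 a (- of_nat m - 2 * a * c)) \<le> real m ^ 4 + 1/25 * real m ^ 3"
        using norm_triangle_sub[of "qpoly E1 E2 E3 E4 a (- of_nat m - 2 * a * c)" "of_nat m ^ 4"] by (simp add: norm_power)
      also have "\<dots> = (real m + 1/25) * real m ^ 3" by (simp add: power4_eq_xxxx power3_eq_cube algebra_simps)
      finally show ?thesis using m by (simp add: norm_divide norm_power divide_simps)
    qed
    have lo: "cmod (qpoly E1 E2 E3 E4 a (of_nat m) / of_nat m ^ 3) \<ge> real m - 1/25" if m: "m \<ge> 1" for m :: nat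
    proof -
      have "cmod (of_nat m ^ 4 - qpoly E1 E2 E3 E4 a (of_nat m)) \<le> 1/25 * real m ^ 3"
        using L2(2)[OF a1 m] mult_right_mono[OF aL(2), of "real m ^ 3"] by (simp add: norm_minus_commute)
      then have "cmod (qpoly E1 E2 E3 E4 a (of_nat m)) \<ge> real m ^ 4 - 1/25 * real m ^ 3"
        using norm_triangle_sub[of "of_nat m ^ 4" "qpoly E1 E2 E3 E4 a (of_nat m)"] by (simp add: norm_power)
      also have "real m ^ 4 - 1/25 * real m ^ 3 = (real m - 1/25) * real m ^ 3" by (simp add: power4_eq_xxxx power3_eq_cube algebra_simps)
      finally show ?thesis using m by (simp add: norm_divide norm_power divide_simps)
    qed
    have nz: "qpoly E1 E2 E3 E4 a (of_nat m) \<noteq> 0" if m: "m \<ge> 1" for m :: nat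
      using lo[OF m] m by (auto simp del: of_nat_Suc)
    have "cmod (gsummand c E1 E2 E3 E4 a k) \<le> 3 / real (Suc k) ^ 2" for k
      unfolding gsummand_def
    proof (rule cmod_times_prod_le)
      define m where "m = Suc k"
      have m: "m \<ge> 1" by (simp add: m_def)
      have "cmod (of_nat m + a * c) \<le> real m + 1/25"
        using norm_triangle_ineq[of "of_nat m" "a * c"] aL(3) by (simp add: norm_mult)
      then have *: "cmod ((of_nat m + a * c) / (qpoly E1 E2 E3 E4 a (of_nat m) / of_nat m ^ 3)) \<le> 1 + 1 / (12 * 1)"
        using lo[OF m] m by (intro cmod_ratio_le[where M = "real m"]) auto
      have "(of_nat m + a * c) * inverse (qpoly E1 E2 E3 E4 a (of_nat m)) =
          (of_nat m + a * c) / (qpoly E1 E2 E3 E4 a (of_nat m) / of_nat m ^ 3) / of_nat m ^ 3"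
        using m nz[OF m] by (simp add: field_simps)
      also have "cmod \<dots> \<le> 3 / real m ^ 3"
        unfolding norm_divide[of _ "of_nat m ^ 3"] norm_power norm_of_nat using * m by (intro divide_right_mono) auto
      finally show "cmod ((of_nat (Suc k) + a * c) * inverse (qpoly E1 E2 E3 E4 a (of_nat (Suc k)))) \<le> 3 / real (Suc k) ^ 3"
        unfolding m_def .
    next
      fix j
      define m where "m = Suc j"
      have m: "m \<ge> 1" by (simp add: m_def)
      have "qpoly E1 E2 E3 E4 a (- of_nat m - 2 * a * c) * inverse (qpoly E1 E2 E3 E4 a (of_nat m)) =
        (qpoly E1 E2 E3 E4 a (- of_nat m - 2 * a * c) / of_nat m ^ 3) / (qpoly E1 E2 E3 E4 a (of_nat m) / of_nat m ^ 3)"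
        using m by (simp add: field_simps)
      also have "cmod \<dots> \<le> 1 + 1 / (12 * real m)"
        using up[OF m] lo[OF m] m by (intro cmod_ratio_le[where M = "real m"]) auto
      also have "\<dots> \<le> 1 + 1 / real m" using m by (simp add: field_simps)
      finally show "cmod (qpoly E1 E2 E3 E4 a (- of_nat (Suc j) - 2 * a * c) * inverse (qpoly E1 E2 E3 E4 a (of_nat (Suc j))))
        \<le> 1 + 1 / real (Suc j)" unfolding m_def .
    qed
    with nz show ?thesis by blast
  qed
  with r0 show ?thesis by blast
qed

abbreviation "gfps c E1 E2 E3 E4 \<equiv> gsummand (fps_const c) (fps_const E1) (fps_const E2) (fps_const E3) (fps_const E4) (fps_X :: complex fps)"

lemma qpoly_expansion:
  fixes E1 E2 E3 E4 :: complex
  assumes "x has_fps_expansion F"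
  shows "(\<lambda>a. qpoly E1 E2 E3 E4 a (x a)) has_fps_expansion qpoly (fps_const E1) (fps_const E2) (fps_const E3) (fps_const E4) fps_X F"
  unfolding qpoly_def by (intro fps_expansion_intros assms)

lemma fps_of_nat_expansion: "(\<lambda>_. of_nat n) has_fps_expansion (of_nat n :: complex fps)"
  using has_fps_expansion_const[of "of_nat n :: complex"] by (simp add: fps_of_nat)

lemma qpoly_nth0: "fps_nth (qpoly (fps_const E1) (fps_const E2) (fps_const E3) (fps_const E4) fps_X F) 0 = fps_nth F 0 ^ 4"
  by (simp add: qpoly_def fps_nth_power_0)

lemma gsummand_expansion:
  fixes c E1 E2 E3 E4 :: complex
  shows "(\<lambda>a. gsummand c E1 E2 E3 E4 a k) has_fps_expansion gfps c E1 E2 E3 E4 k"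
  unfolding gsummand_def
  by (intro fps_expansion_intros qpoly_expansion fps_of_nat_expansion) (simp_all add: qpoly_nth0 del: of_nat_Suc)

definition gsum :: "complex \<Rightarrow> complex \<Rightarrow> complex \<Rightarrow> complex \<Rightarrow> complex \<Rightarrow> complex \<Rightarrow> complex" where
  "gsum c E1 E2 E3 E4 a = (\<Sum>k. gsummand c E1 E2 E3 E4 a k)"

text \<open>Uniform convergence near 0 passes to derivatives of every order, so the formal
  coefficients of the summands may be summed one by one.\<close>

lemma gsum_taylor:
  "\<exists>r>0. (gsum c E1 E2 E3 E4) holomorphic_on ball 0 r \<and>
     (\<forall>n. (\<lambda>k. fps_nth (gfps c E1 E2 E3 E4 k) n) sums fps_nth (fps_expansion (gsum c E1 E2 E3 E4) 0) n)"
proof -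
  obtain r where r: "r > 0" "\<And>a m. cmod a \<le> r \<Longrightarrow> m \<ge> 1 \<Longrightarrow> qpoly E1 E2 E3 E4 a (of_nat m) \<noteq> 0"
     "\<And>a k. cmod a \<le> r \<Longrightarrow> cmod (gsummand c E1 E2 E3 E4 a k) \<le> 3 / real (Suc k) ^ 2"
    using gsummand_bound[of E1 E2 E3 E4 c] by blast
  have u: "uniform_limit (ball 0 r) (\<lambda>n a. \<Sum>k<n. gsummand c E1 E2 E3 E4 a k) (gsum c E1 E2 E3 E4) sequentially"
    unfolding gsum_def by (rule Weierstrass_m_test[OF _ summable_inverse_squares[of 3]]) (use r(3) in auto)
  have hol: "(\<lambda>a. gsummand c E1 E2 E3 E4 a k) holomorphic_on ball 0 r" for k
    unfolding gsummand_def qpoly_def using r(2)[unfolded qpoly_def]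
    by (intro holomorphic_intros) (auto simp del: of_nat_Suc)
  have hol': "(\<lambda>a. \<Sum>k<n. gsummand c E1 E2 E3 E4 a k) holomorphic_on ball 0 r" for n
    by (intro holomorphic_intros hol)
  have 1: "gsum c E1 E2 E3 E4 holomorphic_on ball 0 r"
  proof (rule holomorphic_uniform_sequence[OF open_ball hol'])
    fix x :: complex assume "x \<in> ball 0 r"
    then obtain d where "d > 0" "cball x d \<subseteq> ball 0 r" using open_contains_cball[of "ball (0::complex) r"] open_ball by blast
    with uniform_limit_on_subset[OF u] show "\<exists>d>0. cball x d \<subseteq> ball 0 r \<and>
      uniform_limit (cball x d) (\<lambda>n a. \<Sum>k<n. gsummand c E1 E2 E3 E4 a k) (gsum c E1 E2 E3 E4) sequentially" by blast
  qed
  have 3: "(\<lambda>k. fps_nth (gfps c E1 E2 E3 E4 k) n) sums fps_nth (fps_expansion (gsum c E1 E2 E3 E4) 0) n" for n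
  proof -
    have "(\<lambda>N. (deriv ^^ n) (\<lambda>a. \<Sum>k<N. gsummand c E1 E2 E3 E4 a k) 0 / fact n) \<longlonglongrightarrow> (deriv ^^ n) (gsum c E1 E2 E3 E4) 0 / fact n"
      using higher_deriv_complex_uniform_limit[OF u always_eventually, of 0 n] hol' r(1)
      by (intro tendsto_divide) auto
    moreover have "(deriv ^^ n) (\<lambda>a. \<Sum>k<N. gsummand c E1 E2 E3 E4 a k) 0 / fact n = (\<Sum>k<N. fps_nth (gfps c E1 E2 E3 E4 k) n)" for N
    proof -
      have "(\<lambda>a. \<Sum>k<N. gsummand c E1 E2 E3 E4 a k) has_fps_expansion (\<Sum>k<N. gfps c E1 E2 E3 E4 k)"
        by (intro has_fps_expansion_sum gsummand_expansion)
      from fps_nth_fps_expansion[OF this, of n] show ?thesis by (simp add: fps_sum_nth)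
    qed
    ultimately show ?thesis unfolding sums_def fps_expansion_def by simp
  qed
  show ?thesis using r(1) 1 3 by blast
qed

section \<open>Power series depending polynomially on a parameter\<close>

text \<open>
  The \<open>n\<close>-th coefficient is a polynomial in the parameter of degree at most \<open>(n - s) / w\<close>, and is 0 for \<open>n < s\<close>: the
  parameter has weight \<open>w\<close>, the series order at least \<open>s\<close>.
\<close>

definition graded :: "nat \<Rightarrow> nat \<Rightarrow> (complex \<Rightarrow> complex fps) \<Rightarrow> bool" where
  "graded w s f \<longleftrightarrow> (\<forall>n. \<exists>p. degree p \<le> (n - s) div w \<and> (n < s \<longrightarrow> p = 0) \<and> (\<forall>x. fps_nth (f x) n = poly p x))"

lemma gradedE:
  assumes "graded w s f"
  obtains p where "\<And>n. degree (p n) \<le> (n - s) div w" "\<And>n. n < s \<Longrightarrow> p n = 0" "\<And>n x. fps_nth (f x) n = poly (p n) x"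
  using assms unfolding graded_def by metis

lemma graded_monom:
  assumes "s \<le> i" "degree q \<le> (i - s) div w"
  shows "graded w s (\<lambda>x. fps_X ^ i * fps_const (poly q x))"
  unfolding graded_def
proof
  fix n show "\<exists>p. degree p \<le> (n - s) div w \<and> (n < s \<longrightarrow> p = 0) \<and> (\<forall>x. fps_nth (fps_X ^ i * fps_const (poly q x)) n = poly p x)"
    by (rule exI[of _ "if n = i then q else 0"]) (use assms in \<open>auto simp: fps_X_power_nth\<close>)
qed

lemma graded_const: "graded w 0 (\<lambda>x. c)"
  unfolding graded_def
proof
  fix n show "\<exists>p. degree p \<le> (n - 0) div w \<and> (n < 0 \<longrightarrow> p = 0) \<and> (\<forall>x. fps_nth c n = poly p x)"
    by (rule exI[of _ "[:fps_nth c n:]"]) simp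
qed

lemma graded_add:
  assumes "graded w s f" "graded w s g" shows "graded w s (\<lambda>x. f x + g x)"
proof -
  obtain p where p: "\<And>n. degree (p n) \<le> (n - s) div w" "\<And>n. n < s \<Longrightarrow> p n = 0" "\<And>n x. fps_nth (f x) n = poly (p n) x"
    by (rule gradedE[OF assms(1)]) (rule that)
  obtain q where q: "\<And>n. degree (q n) \<le> (n - s) div w" "\<And>n. n < s \<Longrightarrow> q n = 0" "\<And>n x. fps_nth (g x) n = poly (q n) x"
    by (rule gradedE[OF assms(2)]) (rule that)
  show ?thesis unfolding graded_def
  proof
    fix n show "\<exists>p. degree p \<le> (n - s) div w \<and> (n < s \<longrightarrow> p = 0) \<and> (\<forall>x. fps_nth (f x + g x) n = poly p x)"
      by (rule exI[of _ "p n + q n"]) (use p q in \<open>auto intro: degree_add_le\<close>)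
  qed
qed

lemma graded_uminus:
  assumes "graded w s f" shows "graded w s (\<lambda>x. - f x)"
proof -
  obtain p where p: "\<And>n. degree (p n) \<le> (n - s) div w" "\<And>n. n < s \<Longrightarrow> p n = 0" "\<And>n x. fps_nth (f x) n = poly (p n) x"
    by (rule gradedE[OF assms(1)]) (rule that)
  show ?thesis unfolding graded_def
  proof
    fix n show "\<exists>p. degree p \<le> (n - s) div w \<and> (n < s \<longrightarrow> p = 0) \<and> (\<forall>x. fps_nth (- f x) n = poly p x)"
      by (rule exI[of _ "- p n"]) (use p in \<open>auto simp: fps_neg_nth\<close>)
  qed
qed

lemma graded_diff:
  assumes "graded w s f" "graded w s g" shows "graded w s (\<lambda>x. f x - g x)"
  using graded_add[OF assms(1) graded_uminus[OF assms(2)]] by simp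

text \<open>Floors are superadditive: \<open>x div w + y div w \<le> (x + y) div w\<close>. Where
  the truncated subtraction would spoil this, below the order of a factor, the coefficient is 0 by
  definition.\<close>

lemma graded_mult:
  assumes "graded w s f" "graded w s' g" shows "graded w (s + s') (\<lambda>x. f x * g x)"
proof -
  obtain p where p: "\<And>n. degree (p n) \<le> (n - s) div w" "\<And>n. n < s \<Longrightarrow> p n = 0" "\<And>n x. fps_nth (f x) n = poly (p n) x"
    by (rule gradedE[OF assms(1)]) (rule that)
  obtain q where q: "\<And>n. degree (q n) \<le> (n - s') div w" "\<And>n. n < s' \<Longrightarrow> q n = 0" "\<And>n x. fps_nth (g x) n = poly (q n) x"
    by (rule gradedE[OF assms(2)]) (rule that)
  show ?thesis unfolding graded_def
  proof
    fix n
    have t: "degree (p i * q (n - i)) \<le> (n - (s + s')) div w \<and> (n < s + s' \<longrightarrow> p i * q (n - i) = 0)" if "i \<le> n" for i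
    proof (cases "i < s \<or> n - i < s'")
      case True
      then show ?thesis using p(2) q(2) by auto
    next
      case False
      have "degree (p i * q (n - i)) \<le> (i - s) div w + (n - i - s') div w"
        using degree_mult_le[of "p i" "q (n - i)"] p(1)[of i] q(1)[of "n - i"] by linarith
      also have "\<dots> \<le> (n - (s + s')) div w"
      proof -
        have "(i - s) + (n - i - s') = n - (s + s')" using False that by auto
        then show ?thesis using div_add1_eq[of "i - s" "n - i - s'" w] by simp
      qed
      finally have "degree (p i * q (n - i)) \<le> (n - (s + s')) div w" .
      moreover have "\<not> n < s + s'" using False that by linarith
      ultimately show ?thesis by blast
    qed
    show "\<exists>p. degree p \<le> (n - (s + s')) div w \<and> (n < s + s' \<longrightarrow> p = 0) \<and> (\<forall>x. fps_nth (f x * g x) n = poly p x)"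
      by (rule exI[of _ "\<Sum>i=0..n. p i * q (n - i)"]) (use t in \<open>auto simp: fps_mult_nth poly_sum p(3) q(3) intro!: degree_sum_le sum.neutral\<close>)
  qed
qed

lemma graded_mult0:
  assumes "graded w 0 f" "graded w 0 g" shows "graded w 0 (\<lambda>x. f x * g x)"
  using graded_mult[OF assms] by simp

lemma graded_mult_shift:
  assumes "graded w 0 f" "graded w s g" shows "graded w s (\<lambda>x. f x * g x)" "graded w s (\<lambda>x. g x * f x)"
  using graded_mult[OF assms] graded_mult[OF assms(2,1)] by simp_all

lemma graded_power0: "graded w 0 f \<Longrightarrow> graded w 0 (\<lambda>x. f x ^ n)"
  by (induction n) (auto intro: graded_mult0 graded_const)

lemma graded_prod0: "(\<And>i. i \<in> A \<Longrightarrow> graded w 0 (f i)) \<Longrightarrow> graded w 0 (\<lambda>x. \<Prod>i\<in>A. f i x)"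
  by (induction A rule: infinite_finite_induct) (auto intro: graded_mult0 graded_const)

lemma graded_zero: "graded w s (\<lambda>x. 0)"
  unfolding graded_def by (auto intro!: exI[of _ 0])

lemma graded_sum: "(\<And>i. i \<in> A \<Longrightarrow> graded w s (f i)) \<Longrightarrow> graded w s (\<lambda>x. \<Sum>i\<in>A. f i x)"
  by (induction A rule: infinite_finite_induct) (auto intro: graded_add graded_zero)

text \<open>The constant coefficient has degree 0, so it is one nonzero number for all parameters.
  The recursion for the coefficients of the inverse divides by this number only and therefore stays
  within polynomials.\<close>

lemma graded_inverse:
  assumes "graded w 0 f" "\<And>x. fps_nth (f x) 0 \<noteq> 0"
  shows "graded w 0 (\<lambda>x. inverse (f x))"
proof -
  obtain p where p: "\<And>n. degree (p n) \<le> n div w" "\<And>n x. fps_nth (f x) n = poly (p n) x"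
    using gradedE[OF assms(1)] by auto
  obtain c where c: "p 0 = [:c:]" using p(1)[of 0] degree_eq_zeroE by (metis div_0 le_zero_eq)
  have c0: "c \<noteq> 0" using assms(2)[of 0] by (simp add: p(2) c)
  have f0: "fps_nth (f x) 0 = c" for x by (simp add: p(2) c)
  have "\<exists>q. degree q \<le> n div w \<and> (\<forall>x. fps_nth (inverse (f x)) n = poly q x)" for n
  proof (induction n rule: less_induct)
    case (less n)
    show ?case
    proof (cases n)
      case 0
      then show ?thesis by (intro exI[of _ "[:inverse c:]"]) (simp add: f0)
    next
      case (Suc m)
      have "\<exists>q. \<forall>i<n. degree (q i) \<le> i div w \<and> (\<forall>x. fps_nth (inverse (f x)) i = poly (q i) x)"
        using less by metis
      then obtain q where q: "\<And>i. i < n \<Longrightarrow> degree (q i) \<le> i div w" "\<And>i x. i < n \<Longrightarrow> fps_nth (inverse (f x)) i = poly (q i) x"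
        by blast
      define r where "r = smult (- inverse c) (\<Sum>i=1..n. p i * q (n - i))"
      have "degree (p i * q (n - i)) \<le> n div w" if "i \<in> {1..n}" for i
      proof -
        have "degree (p i * q (n - i)) \<le> i div w + (n - i) div w"
          using degree_mult_le[of "p i" "q (n - i)"] p(1)[of i] q(1)[of "n - i"] that Suc by (auto intro: order_trans add_mono)
        also have "\<dots> \<le> n div w" using div_add1_eq[of i "n - i" w] that by simp
        finally show ?thesis .
      qed
      then have "degree r \<le> n div w" unfolding r_def by (intro order_trans[OF degree_smult_le] degree_sum_le) auto
      moreover have "fps_nth (inverse (f x)) n = poly r x" for x
      proof -
        have "0 = fps_nth (f x * inverse (f x)) n" using assms(2)[of x] Suc by (subst inverse_mult_eq_1') auto
        also have "\<dots> = c * fps_nth (inverse (f x)) n + (\<Sum>i=1..n. fps_nth (f x) i * fps_nth (inverse (f x)) (n - i))"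
          unfolding fps_mult_nth using f0[of x] by (subst sum.atLeast_Suc_atMost) auto
        also have "(\<Sum>i=1..n. fps_nth (f x) i * fps_nth (inverse (f x)) (n - i)) = poly (\<Sum>i=1..n. p i * q (n - i)) x"
          unfolding poly_sum poly_mult p(2) using Suc by (intro sum.cong refl arg_cong2[of _ _ _ _ "(*)"] q(2)) auto
        finally show ?thesis using c0 by (simp add: r_def field_simps eq_neg_iff_add_eq_0)
      qed
      ultimately show ?thesis by blast
    qed
  qed
  then show ?thesis unfolding graded_def by simp
qed

section \<open>Differentiating the coefficients in the parameter\<close>

definition coeff_deriv :: "(complex \<Rightarrow> complex fps) \<Rightarrow> complex fps \<Rightarrow> bool" where
  "coeff_deriv f f' \<longleftrightarrow> (\<forall>n. ((\<lambda>x. fps_nth (f x) n) has_field_derivative fps_nth f' n) (at 0))"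

lemma coeff_deriv_const: "coeff_deriv (\<lambda>x. c) 0"
  by (simp add: coeff_deriv_def)

lemma coeff_deriv_fps_const: "(h has_field_derivative h') (at 0) \<Longrightarrow> coeff_deriv (\<lambda>x. fps_const (h x)) (fps_const h')"
  unfolding coeff_deriv_def by auto

lemma coeff_deriv_add: "coeff_deriv f f' \<Longrightarrow> coeff_deriv g g' \<Longrightarrow> coeff_deriv (\<lambda>x. f x + g x) (f' + g')"
  unfolding coeff_deriv_def by (auto intro: DERIV_add)

lemma coeff_deriv_diff: "coeff_deriv f f' \<Longrightarrow> coeff_deriv g g' \<Longrightarrow> coeff_deriv (\<lambda>x. f x - g x) (f' - g')"
  unfolding coeff_deriv_def by (auto intro: DERIV_diff)

lemma coeff_deriv_mult:
  assumes "coeff_deriv f f'" "coeff_deriv g g'"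
  shows "coeff_deriv (\<lambda>x. f x * g x) (f' * g 0 + f 0 * g')"
  unfolding coeff_deriv_def
proof
  fix n
  have eq: "(\<Sum>i=0..n. fps_nth f' i * fps_nth (g 0) (n - i) + fps_nth g' (n - i) * fps_nth (f 0) i) =
      fps_nth (f' * g 0 + f 0 * g') n"
    unfolding fps_add_nth fps_mult_nth sum.distrib
    by (intro arg_cong2[of _ _ _ _ "(+)"] sum.cong refl mult.commute)
  show "((\<lambda>x. fps_nth (f x * g x) n) has_field_derivative fps_nth (f' * g 0 + f 0 * g') n) (at 0)"
    using assms unfolding coeff_deriv_def eq[symmetric] fps_mult_nth[of "f _"] by (intro DERIV_sum DERIV_mult) auto
qed

lemma coeff_deriv_power:
  assumes "coeff_deriv f f'" shows "coeff_deriv (\<lambda>x. f x ^ n) (of_nat n * f 0 ^ (n - 1) * f')"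
proof (induction n)
  case (Suc n)
  have "of_nat (Suc n) * f 0 ^ (Suc n - 1) * f' = f' * f 0 ^ n + f 0 * (of_nat n * f 0 ^ (n - 1) * f')"
    by (cases n) (simp_all add: algebra_simps)
  then show ?case using coeff_deriv_mult[OF assms Suc] by simp
qed (simp add: coeff_deriv_const)

text \<open>Gradedness makes the coefficients of the inverse polynomials, hence differentiable; the
  value of the derivative then follows from differentiating
  \<open>f x * inverse (f x) = 1\<close>.\<close>

lemma coeff_deriv_inverse:
  assumes "coeff_deriv f f'" "graded w 0 f" "\<And>x. fps_nth (f x) 0 \<noteq> 0"
  shows "coeff_deriv (\<lambda>x. inverse (f x)) (- f' * inverse (f 0) ^ 2)"
proof -
  obtain q where q: "\<And>n x. fps_nth (inverse (f x)) n = poly (q n) x"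
    using gradedE[OF graded_inverse[OF assms(2,3)]] by metis
  define g' where "g' = Abs_fps (\<lambda>n. poly (pderiv (q n)) 0)"
  have g: "coeff_deriv (\<lambda>x. inverse (f x)) g'"
    unfolding coeff_deriv_def q g'_def by (auto intro: poly_DERIV)
  have 1: "f x * inverse (f x) = 1" for x by (rule inverse_mult_eq_1'[OF assms(3)])
  have "coeff_deriv (\<lambda>x. 1) (f' * inverse (f 0) + f 0 * g')"
    using coeff_deriv_mult[OF assms(1) g] unfolding 1 .
  then have 0: "f' * inverse (f 0) + f 0 * g' = 0"
    unfolding coeff_deriv_def fps_eq_iff using DERIV_unique[OF _ DERIV_const] by (metis fps_zero_nth)
  have 2: "f 0 * g' = - (f' * inverse (f 0))" using 0 by (simp add: eq_neg_iff_add_eq_0 add.commute)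
  have "g' = inverse (f 0) * (f 0 * g')" using 1[of 0] by (simp only: mult.assoc[symmetric] mult.commute[of "inverse (f 0)"] mult_1_left)
  also have "\<dots> = inverse (f 0) * (- (f' * inverse (f 0)))" unfolding 2 ..
  finally show ?thesis using g by (simp add: power2_eq_square mult_ac)
qed

lemma coeff_deriv_prod:
  fixes k :: nat
  assumes "\<And>j. coeff_deriv (f j) (f' j)" "\<And>j. fps_nth (f j 0) 0 \<noteq> 0"
  shows "coeff_deriv (\<lambda>x. \<Prod>j<k. f j x) ((\<Prod>j<k. f j 0) * (\<Sum>j<k. f' j * inverse (f j 0)))"
proof (induction k)
  case (Suc k)
  have 1: "f k 0 * inverse (f k 0) = 1" by (rule inverse_mult_eq_1'[OF assms(2)])
  have "(\<Prod>j<Suc k. f j 0) * (\<Sum>j<Suc k. f' j * inverse (f j 0)) =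
     ((\<Prod>j<k. f j 0) * (\<Sum>j<k. f' j * inverse (f j 0))) * f k 0 + (\<Prod>j<k. f j 0) * (f' k * (f k 0 * inverse (f k 0)))"
    by (simp add: algebra_simps)
  then show ?case using coeff_deriv_mult[OF Suc assms(1)[of k]] unfolding 1 by simp
qed (simp add: coeff_deriv_const)

text \<open>Induction on the degree bound: division by the linear factor at some \<open>a\<close> in
  \<open>S\<close> leaves quotients of smaller degree that still converge on
  \<open>S - {a}\<close>.\<close>

lemma poly_seq_limit_coeff:
  fixes p :: "nat \<Rightarrow> complex poly"
  assumes "infinite S" "\<And>k. degree (p k) \<le> N" "\<And>x. x \<in> S \<Longrightarrow> convergent (\<lambda>k. poly (p k) x)"
  shows "convergent (\<lambda>k. coeff (p k) i)"
  using assms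
proof (induction N arbitrary: S p i)
  case 0
  then have c: "p k = [:coeff (p k) 0:]" for k using 0(2)[of k] degree_0_id[of "p k"] by simp
  obtain x where "x \<in> S" using 0(1) by (metis finite.emptyI ex_in_conv)
  then have "convergent (\<lambda>k. poly (p k) x)" by (rule 0(3))
  moreover have "poly (p k) x = coeff (p k) 0" for k by (subst c) simp
  ultimately have "convergent (\<lambda>k. coeff (p k) 0)" by simp
  moreover have "coeff (p k) i = 0" if "i > 0" for k using 0(2)[of k] that by (intro coeff_eq_0) simp
  ultimately show ?case by (cases "i = 0") (simp_all add: convergent_const)
next
  case (Suc N)
  obtain a where a: "a \<in> S" using Suc(2) by (metis finite.emptyI ex_in_conv)
  define q where "q k = synthetic_div (p k) a" for k
  have pq: "p k = [:- a, 1:] * q k + [:poly (p k) a:]" for k unfolding q_def by (rule synthetic_div_correct'[symmetric])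
  have "convergent (\<lambda>k. coeff (q k) i)" for i
  proof (rule Suc.IH)
    show "infinite (S - {a})" using Suc(2) by simp
    show "degree (q k) \<le> N" for k using Suc(3)[of k] by (simp add: q_def degree_synthetic_div)
    fix x assume x: "x \<in> S - {a}"
    have "poly (q k) x = (poly (p k) x - poly (p k) a) * inverse (x - a)" for k
      using arg_cong[OF pq, of "\<lambda>p. poly p x" k] x by (simp add: field_simps)
    then show "convergent (\<lambda>k. poly (q k) x)" using x a Suc(4)
      by (auto intro!: convergent_mult convergent_diff convergent_const)
  qed
  note cq = this
  have "coeff (p k) i = - a * coeff (q k) i + (if i = 0 then 0 else coeff (q k) (i - 1)) + (if i = 0 then poly (p k) a else 0)" for k
    by (subst pq) (cases i; simp add: coeff_pCons)
  moreover have "convergent (\<lambda>k. - a * coeff (q k) i + (if i = 0 then 0 else coeff (q k) (i - 1)) + (if i = 0 then poly (p k) a else 0))"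
    using cq Suc(4)[OF a] by (cases "i = 0") (auto intro!: convergent_mult convergent_diff convergent_const)
  ultimately show ?case by simp
qed

text \<open>Because the degrees are bounded, pointwise convergence gives convergence of each
  coefficient. In particular coefficient 1, the derivative at 0, can be summed termwise without any
  uniformity in the parameter.\<close>

lemma poly_series_limit:
  fixes p :: "nat \<Rightarrow> complex poly"
  assumes "\<And>k. degree (p k) \<le> N" "\<And>x. (\<lambda>k. poly (p k) x) sums f x"
  shows "\<exists>q. degree q \<le> N \<and> (\<forall>x. f x = poly q x) \<and> (\<forall>i. (\<lambda>k. coeff (p k) i) sums coeff q i)"
proof -
  define P where "P n = (\<Sum>k<n. p k)" for n
  have d: "degree (P n) \<le> N" for n unfolding P_def using assms(1) by (intro degree_sum_le) auto
  have l: "(\<lambda>n. poly (P n) x) \<longlonglongrightarrow> f x" for x using assms(2)[of x] by (simp add: sums_def P_def poly_sum)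
  have c: "convergent (\<lambda>n. coeff (P n) i)" for i
    by (rule poly_seq_limit_coeff[of UNIV, OF infinite_UNIV_char_0 d]) (use l in \<open>auto simp: convergent_def\<close>)
  define q where "q = (\<Sum>i\<le>N. monom (lim (\<lambda>n. coeff (P n) i)) i)"
  have dq: "degree q \<le> N" unfolding q_def by (intro degree_sum_le) (auto intro: order_trans[OF degree_monom_le])
  have cq: "coeff q i = lim (\<lambda>n. coeff (P n) i)" for i
  proof (cases "i \<le> N")
    case False
    then have "coeff (P n) i = 0" for n using d[of n] by (intro coeff_eq_0) simp
    moreover have "coeff q i = 0" using False dq by (intro coeff_eq_0) simp
    ultimately show ?thesis by simp
  qed (simp add: q_def coeff_sum)
  have lq: "(\<lambda>n. coeff (P n) i) \<longlonglongrightarrow> coeff q i" for i unfolding cq using c by (simp add: convergent_LIMSEQ_iff)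
  have "f x = poly q x" for x
  proof (rule LIMSEQ_unique[OF l])
    have "poly r x = (\<Sum>i\<le>N. coeff r i * x ^ i)" if "degree r \<le> N" for r
      unfolding poly_altdef using that by (intro sum.mono_neutral_left) (auto intro: coeff_eq_0)
    then show "(\<lambda>n. poly (P n) x) \<longlonglongrightarrow> poly q x" using d dq lq by (auto intro!: tendsto_intros)
  qed
  with dq lq show ?thesis by (auto simp: sums_def P_def coeff_sum)
qed

text \<open>
  Divide with remainder: \<open>P = q Q + r\<close> with \<open>q\<close> of degree at most 1. On a fibre of 5 points \<open>r + w q\<close> has degree at most 4 and is constant,
  so it is a constant polynomial, for infinitely many \<open>w\<close>.
\<close>

lemma poly_constant_on_fibres:
  fixes P Q :: "complex poly"
  assumes "degree P \<le> 6" "degree Q = 5" "poly Q 0 = 0"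
    and fib: "\<And>w x x'. rsquarefree (Q - [:w:]) \<Longrightarrow> poly Q x = w \<Longrightarrow> poly Q x' = w \<Longrightarrow> poly P x = poly P x'"
  shows "\<exists>b. P = [:poly P 0:] + smult b Q"
proof -
  define r where "r = P mod Q"
  have Q0: "Q \<noteq> 0" using assms(2) by auto
  have dr: "degree r \<le> 4" using degree_mod_less[of Q P] assms(2) Q0 by (auto simp: r_def)
  define q where "q = P div Q"
  have P: "P = q * Q + r" by (simp add: q_def r_def)
  have dq: "degree q \<le> 1"
  proof (cases "q = 0")
    case False
    then have "degree (q * Q) = degree q + 5" using Q0 assms(2) by (simp add: degree_mult_eq)
    moreover from this have "degree P = degree (q * Q)" unfolding P using dr by (intro degree_add_eq_left) simp
    ultimately show ?thesis using assms(1) by simp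
  qed simp
  \<comment> \<open>Every \<open>w\<close> outside the finite set of critical values has five
    distinct preimages.\<close>
  have "finite (poly Q ` {x. poly (pderiv Q) x = 0})"
  proof -
    have "pderiv Q \<noteq> 0" using assms(2) by (simp add: pderiv_eq_0_iff)
    then show ?thesis by (intro finite_imageI poly_roots_finite)
  qed
  then have inf: "infinite (- poly Q ` {x. poly (pderiv Q) x = 0})" using infinite_UNIV_char_0[where ?'a = complex] by (metis Compl_eq_Diff_UNIV Diff_infinite_finite)
  have sep: "\<exists>c. r + smult w q = [:c:]" if "w \<in> - poly Q ` {x. poly (pderiv Q) x = 0}" for w
  proof -
    have sf: "rsquarefree (Q - [:w:])"
      unfolding rsquarefree_roots using that by (auto simp: pderiv_diff pderiv_pCons)
    have dQ: "degree (Q - [:w:]) = 5"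
  proof -
    have "degree (Q + [:-w:]) = 5" using degree_add_eq_left[of "[:-w:]" Q] assms(2) by simp
    moreover have "Q + [:-w:] = Q - [:w:]" by (simp only: diff_conv_add_uminus minus_pCons minus_zero)
    ultimately show ?thesis by simp
  qed
    then have nz: "Q - [:w:] \<noteq> 0" by auto
    define R where "R = {x. poly Q x = w}"
    have R: "R = {x. poly (Q - [:w:]) x = 0}" by (auto simp: R_def)
    have "card R = 5"
    proof -
      define l where "l = lead_coeff (Q - [:w:])"
      have l: "l \<noteq> 0" using nz unfolding l_def leading_coeff_0_iff .
      have "Q - [:w:] = smult l (\<Prod>z\<in>R. [:- z, 1:])"
        unfolding R l_def using complex_poly_decompose_rsquarefree[OF sf] by simp
      then have "degree (Q - [:w:]) = degree (smult l (\<Prod>z\<in>R. [:- z, 1:]))" by argo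
      also have "\<dots> = card R" using l by (simp add: degree_prod_sum_eq)
      finally show ?thesis using dQ by simp
    qed
    then have "R \<noteq> {}" by auto
    then obtain x0 where x0: "x0 \<in> R" by blast
    define T where "T = r + smult w q - [:poly P x0:]"
    have "T = 0"
    proof (rule ccontr)
      assume T: "T \<noteq> 0"
      have "poly T x = 0" if "x \<in> R" for x
      proof -
        have "poly P x = poly P x0" by (rule fib[OF sf]) (use that x0 in \<open>simp_all add: R_def\<close>)
        moreover have "poly P x = poly q x * w + poly r x" using that by (subst P) (simp add: R_def)
        ultimately show ?thesis by (simp add: T_def algebra_simps)
      qed
      then have "R \<subseteq> {x. poly T x = 0}" by blast
      then have "5 \<le> card {x. poly T x = 0}" using card_mono[OF poly_roots_finite[OF T], of R] \<open>card R = 5\<close> by simp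
      also have "\<dots> \<le> degree T" by (rule card_poly_roots_bound[OF T])
      also have "degree T \<le> 4" unfolding T_def using dr dq
        by (intro degree_diff_le degree_add_le order_trans[OF degree_smult_le]) auto
      finally show False by simp
    qed
    then show ?thesis by (intro exI[of _ "poly P x0"]) (simp add: T_def)
  qed
  \<comment> \<open>Two regular values suffice: subtracting the two constants
    \<open>r + w1 q\<close> and \<open>r + w2 q\<close> shows that \<open>q\<close> is constant, and
    then so is \<open>r\<close>.\<close>
  obtain w1 where w1: "w1 \<in> - poly Q ` {x. poly (pderiv Q) x = 0}" using infinite_imp_nonempty[OF inf] by blast
  obtain w2 where w2: "w2 \<in> - poly Q ` {x. poly (pderiv Q) x = 0}" "w2 \<noteq> w1"
    using infinite_imp_nonempty[OF infinite_remove[OF inf, of w1]] by blast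
  obtain c1 c2 where c: "r + smult w1 q = [:c1:]" "r + smult w2 q = [:c2:]" using sep w1 w2 by metis
  have "smult (w1 - w2) q = [:c1 - c2:]"
    using arg_cong2[OF c, of "(-)"] by (simp add: smult_diff_left)
  then have "smult (inverse (w1 - w2)) (smult (w1 - w2) q) = smult (inverse (w1 - w2)) [:c1 - c2:]" by argo
  then have "q = [:inverse (w1 - w2) * (c1 - c2):]" using w2(2) by simp
  then obtain b where b: "q = [:b:]" by blast
  have "r = [:c1:] - smult w1 q" using c(1) by (simp add: eq_diff_eq)
  then have d: "r = [:c1 - w1 * b:]" unfolding b by simp
  define d where "d = c1 - w1 * b"
  note d = d[folded d_def]
  have P': "P = [:d:] + smult b Q" unfolding P b d by simp
  then have "poly P 0 = d" using assms(3) by simp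
  with P' show ?thesis by metis
qed

section \<open>The coefficients as functions of the fifth parameter\<close>

lemma qpoly_factor:
  fixes a x :: complex
  shows "qpoly (y1+y2+y3+y4) (y1*y2+y1*y3+y1*y4+y2*y3+y2*y4+y3*y4) (y1*y2*y3+y1*y2*y4+y1*y3*y4+y2*y3*y4) (y1*y2*y3*y4) a x =
    (x + a * y1) * (x + a * y2) * (x + a * y3) * (x + a * y4)"
  unfolding qpoly_def by algebra

lemma gsummand_eq_wsummand:
  fixes a :: complex
  shows "gsummand ((y1+y2+y3+y4-y5)/4) (y1+y2+y3+y4) (y1*y2+y1*y3+y1*y4+y2*y3+y2*y4+y3*y4)
    (y1*y2*y3+y1*y2*y4+y1*y3*y4+y2*y3*y4) (y1*y2*y3*y4) a k = wsummand (a * y1) (a * y2) (a * y3) (a * y4) (a * y5) k"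
proof -
  define c where "c = (y1+y2+y3+y4-y5)/4"
  have c: "(a * y1 + a * y2 + a * y3 + a * y4 - a * y5) / 4 = a * c"
     "(a * y1 + a * y2 + a * y3 + a * y4 - a * y5) / 2 = 2 * a * c" by (simp_all add: c_def field_simps)
  \<comment> \<open>The four sign changes cancel, so the quartic at the reflected point is the
    numerator of \<open>wprod\<close>.\<close>
  have neg: "(- m - 2 * a * c + a * y1) * (- m - 2 * a * c + a * y2) * (- m - 2 * a * c + a * y3) * (- m - 2 * a * c + a * y4) =
     (m + 2 * a * c - a * y1) * (m + 2 * a * c - a * y2) * (m + 2 * a * c - a * y3) * (m + 2 * a * c - a * y4)" for m
    by algebra
  show ?thesis
    unfolding gsummand_def wsummand_def wprod_def c unfolding c_def[symmetric] qpoly_factor neg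
    unfolding divide_inverse ..
qed

text \<open>
  Here \<open>e1, ..., e4\<close> are elementary symmetric functions of five parameters, of which \<open>X\<close> is the fifth; the arguments
  of \<open>gsum\<close> are the elementary symmetric functions of the other four.
\<close>

definition psum :: "complex \<Rightarrow> complex \<Rightarrow> complex \<Rightarrow> complex \<Rightarrow> complex \<Rightarrow> complex \<Rightarrow> complex" where
  "psum e1 e2 e3 e4 X = gsum ((e1 - 2 * X) / 4) (e1 - X) (e2 - X * (e1 - X)) (e3 - X * (e2 - X * (e1 - X)))
     (e4 - X * (e3 - X * (e2 - X * (e1 - X))))"

definition pfps :: "complex \<Rightarrow> complex \<Rightarrow> complex \<Rightarrow> complex \<Rightarrow> nat \<Rightarrow> complex \<Rightarrow> complex fps" where
  "pfps e1 e2 e3 e4 k X = gfps ((e1 - 2 * X) / 4) (e1 - X) (e2 - X * (e1 - X)) (e3 - X * (e2 - X * (e1 - X)))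
     (e4 - X * (e3 - X * (e2 - X * (e1 - X)))) k"

definition pcoef :: "complex \<Rightarrow> complex \<Rightarrow> complex \<Rightarrow> complex \<Rightarrow> complex \<Rightarrow> nat \<Rightarrow> complex" where
  "pcoef e1 e2 e3 e4 X n = fps_nth (fps_expansion (psum e1 e2 e3 e4 X) 0) n"

lemma pfps_sums: "(\<lambda>k. fps_nth (pfps e1 e2 e3 e4 k X) n) sums pcoef e1 e2 e3 e4 X n"
  unfolding pfps_def pcoef_def psum_def using gsum_taylor by blast

lemma psum_roots:
  assumes "e1 = y1+y2+y3+y4+y5" "e2 = y1*y2+y1*y3+y1*y4+y2*y3+y2*y4+y3*y4 + (y1+y2+y3+y4)*y5"
    "e3 = y1*y2*y3+y1*y2*y4+y1*y3*y4+y2*y3*y4 + (y1*y2+y1*y3+y1*y4+y2*y3+y2*y4+y3*y4)*y5"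
    "e4 = y1*y2*y3*y4 + (y1*y2*y3+y1*y2*y4+y1*y3*y4+y2*y3*y4)*y5"
  shows "psum e1 e2 e3 e4 y5 a = suminf (wsummand (a * y1) (a * y2) (a * y3) (a * y4) (a * y5))"
proof -
  have 1: "e1 - y5 = y1+y2+y3+y4" by (simp add: assms(1))
  have 2: "e2 - y5 * (y1+y2+y3+y4) = y1*y2+y1*y3+y1*y4+y2*y3+y2*y4+y3*y4" by (simp add: assms(2))
  have 3: "e3 - y5 * (y1*y2+y1*y3+y1*y4+y2*y3+y2*y4+y3*y4) = y1*y2*y3+y1*y2*y4+y1*y3*y4+y2*y3*y4" by (simp add: assms(3))
  have 4: "e4 - y5 * (y1*y2*y3+y1*y2*y4+y1*y3*y4+y2*y3*y4) = y1*y2*y3*y4" by (simp add: assms(4))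
  have 0: "(e1 - 2 * y5) / 4 = (y1+y2+y3+y4-y5)/4" by (simp add: assms(1))
  show ?thesis unfolding psum_def gsum_def 0 1 2 3 4 gsummand_eq_wsummand ..
qed

definition quintic :: "complex \<Rightarrow> complex \<Rightarrow> complex \<Rightarrow> complex \<Rightarrow> complex poly" where
  "quintic e1 e2 e3 e4 = [:0, e4, - e3, e2, - e1, 1:]"

lemma quintic_roots:
  assumes "quintic e1 e2 e3 e4 - [:w:] = [:-y1,1:] * [:-y2,1:] * [:-y3,1:] * [:-y4,1:] * [:-y5,1:]"
  shows "e1 = y1+y2+y3+y4+y5" "e2 = y1*y2+y1*y3+y1*y4+y2*y3+y2*y4+y3*y4 + (y1+y2+y3+y4)*y5"
    "e3 = y1*y2*y3+y1*y2*y4+y1*y3*y4+y2*y3*y4 + (y1*y2+y1*y3+y1*y4+y2*y3+y2*y4+y3*y4)*y5"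
    "e4 = y1*y2*y3*y4 + (y1*y2*y3+y1*y2*y4+y1*y3*y4+y2*y3*y4)*y5"
proof -
  have "coeff (quintic e1 e2 e3 e4 - [:w:]) i = coeff ([:-y1,1:] * [:-y2,1:] * [:-y3,1:] * [:-y4,1:] * [:-y5,1:]) i" for i
    unfolding assms ..
  from this[of 4] this[of 3] this[of 2] this[of 1]
  have *: "- e1 = - y1 - y2 - y3 - y4 - y5" "e2 = y1*y2+y1*y3+y1*y4+y2*y3+y2*y4+y3*y4 + (y1+y2+y3+y4)*y5"
     "- e3 = - (y1*y2*y3+y1*y2*y4+y1*y3*y4+y2*y3*y4 + (y1*y2+y1*y3+y1*y4+y2*y3+y2*y4+y3*y4)*y5)"
     "e4 = y1*y2*y3*y4 + (y1*y2*y3+y1*y2*y4+y1*y3*y4+y2*y3*y4)*y5"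
    by (simp_all add: quintic_def coeff_pCons numeral_eq_Suc algebra_simps)
  show "e1 = y1+y2+y3+y4+y5" using *(1) by algebra
  show "e3 = y1*y2*y3+y1*y2*y4+y1*y3*y4+y2*y3*y4 + (y1*y2+y1*y3+y1*y4+y2*y3+y2*y4+y3*y4)*y5" using *(3) by algebra
  show "e2 = y1*y2+y1*y3+y1*y4+y2*y3+y2*y4+y3*y4 + (y1+y2+y3+y4)*y5" by (rule *(2))
  show "e4 = y1*y2*y3*y4 + (y1*y2*y3+y1*y2*y4+y1*y3*y4+y2*y3*y4)*y5" by (rule *(4))
qed

text \<open>The roots of \<open>Q - w\<close> serve as the five parameters. With \<open>X\<close>
  and \<open>X'\<close> in the last two places, \<open>wsummand_swap\<close> exchanges the roles of
  fourth and fifth parameter for all small \<open>a\<close>.\<close>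

lemma pcoef_fibre:
  assumes "rsquarefree (quintic e1 e2 e3 e4 - [:w:])"
    and X: "poly (quintic e1 e2 e3 e4) X = w" and X': "poly (quintic e1 e2 e3 e4) X' = w"
  shows "pcoef e1 e2 e3 e4 X n = pcoef e1 e2 e3 e4 X' n"
proof (cases "X = X'")
  case False
  define p where "p = quintic e1 e2 e3 e4 - [:w:]"
  have p: "p = [:-w, e4, -e3, e2, -e1, 1:]" by (simp add: p_def quintic_def)
  define R where "R = {z. poly p z = 0}"
  have lp: "lead_coeff p = 1" "degree p = 5" by (simp_all add: p)
  have fin: "finite R" unfolding R_def by (rule poly_roots_finite) (use lp in auto)
  have dec: "p = (\<Prod>z\<in>R. [:- z, 1:])"
    using complex_poly_decompose_rsquarefree[OF assms(1)] lp(1) unfolding p_def[symmetric] R_def by simp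
  have "degree p = card R" by (subst dec) (simp add: degree_prod_sum_eq)
  then have cR: "card R = 5" using lp by simp
  have XR: "X \<in> R" "X' \<in> R" using X X' by (simp_all add: R_def p_def)
  have "card (R - {X, X'}) = 3" using cR XR False fin by (simp add: card_Diff_subset)
  then obtain y1 y2 y3 where y: "R - {X, X'} = {y1, y2, y3}" "y1 \<noteq> y2" "y1 \<noteq> y3" "y2 \<noteq> y3"
    unfolding card_3_iff by blast
  have "R = {y1, y2, y3, X', X}" using y(1) XR by blast
  moreover have "y1 \<noteq> X" "y1 \<noteq> X'" "y2 \<noteq> X" "y2 \<noteq> X'" "y3 \<noteq> X" "y3 \<noteq> X'" using y(1) by blast+
  ultimately have f: "p = [:-y1,1:] * [:-y2,1:] * [:-y3,1:] * [:-X',1:] * [:-X,1:]"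
    using y(2-4) False by (subst dec) (simp add: mult.assoc del: mult_pCons_left mult_pCons_right)
  have f': "p = [:-y1,1:] * [:-y2,1:] * [:-y3,1:] * [:-X,1:] * [:-X',1:]"
    unfolding f by (simp only: mult_ac)
  define M where "M = 1 + cmod y1 + cmod y2 + cmod y3 + cmod X + cmod X'"
  \<comment> \<open>All products of \<open>a\<close> with a root must lie within the radius 1/200 of
    \<open>small5\<close>.\<close>
  define r where "r = 1 / (200 * M)"
  have M: "M \<ge> 1" by (simp add: M_def)
  have "psum e1 e2 e3 e4 X a = psum e1 e2 e3 e4 X' a" if a: "a \<in> ball 0 r" for a
  proof -
    have s: "cmod (a * v) \<le> 1 / 200" if "cmod v \<le> M" for v
    proof -
      have "cmod (a * v) \<le> r * M" unfolding norm_mult using a that by (intro mult_mono) (auto simp: r_def M_def)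
      then show ?thesis using M by (simp add: r_def)
    qed
    have "small5 (a * y1) (a * y2) (a * y3) (a * X') (a * X)"
      by unfold_locales (rule s, simp add: M_def)+
    from wsummand_swap[OF this] show ?thesis
      unfolding psum_roots[OF quintic_roots[OF f[unfolded p_def]]] psum_roots[OF quintic_roots[OF f'[unfolded p_def]]] .
  qed
  then have "eventually (\<lambda>a. psum e1 e2 e3 e4 X a = psum e1 e2 e3 e4 X' a) (nhds 0)"
    using M by (intro eventually_nhds_in_open[THEN eventually_mono, of "ball 0 r"]) (auto simp: r_def)
  then show ?thesis unfolding pcoef_def by (simp add: fps_expansion_cong)
qed simp

lemma graded_qpoly:
  assumes "graded w 0 F" "\<And>x. E1 x = poly q1 x" "\<And>x. E2 x = poly q2 x" "\<And>x. E3 x = poly q3 x" "\<And>x. E4 x = poly q4 x"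
    "degree q1 \<le> 1 div w" "degree q2 \<le> 2 div w" "degree q3 \<le> 3 div w" "degree q4 \<le> 4 div w"
  shows "graded w 0 (\<lambda>x. qpoly (fps_const (E1 x)) (fps_const (E2 x)) (fps_const (E3 x)) (fps_const (E4 x)) fps_X (F x))"
proof -
  have m: "graded w 0 (\<lambda>x. fps_X ^ i * fps_const (poly q x))" if "degree q \<le> i div w" for i q
    using graded_monom[of 0 i q w] that by simp
  have "graded w 0 (\<lambda>x. F x ^ 4 + fps_X ^ 1 * fps_const (poly q1 x) * F x ^ 3 + fps_X ^ 2 * fps_const (poly q2 x) * F x ^ 2 +
     fps_X ^ 3 * fps_const (poly q3 x) * F x ^ 1 + fps_X ^ 4 * fps_const (poly q4 x))"
    by (intro graded_add graded_mult0 graded_power0 m assms)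
  then show ?thesis unfolding qpoly_def assms(2-5) by simp
qed

lemma graded_X_const:
  assumes "\<And>x. c x = poly qc x" "degree qc \<le> 1 div w"
  shows "graded w 0 (\<lambda>x. fps_X * fps_const (c x))"
  using graded_monom[of 0 1 qc w] assms by simp

lemma graded_gsummand:
  assumes c: "\<And>x. c x = poly qc x" and E: "\<And>x. E1 x = poly q1 x" "\<And>x. E2 x = poly q2 x" "\<And>x. E3 x = poly q3 x" "\<And>x. E4 x = poly q4 x"
    and dc: "degree qc \<le> 1 div w" and d: "degree q1 \<le> 1 div w" "degree q2 \<le> 2 div w" "degree q3 \<le> 3 div w" "degree q4 \<le> 4 div w"
  shows "graded w 0 (\<lambda>x. gfps (c x) (E1 x) (E2 x) (E3 x) (E4 x) k)"
proof -
  have 2: "2 * fps_X * fps_const (c x) = fps_const 2 * (fps_X * fps_const (c x))" for x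
    by (simp add: numeral_fps_const mult.assoc)
  show ?thesis unfolding gsummand_def 2
    by (intro graded_mult0 graded_add graded_diff graded_const graded_X_const[OF c dc] graded_inverse graded_prod0 graded_qpoly[OF _ E d])
       (simp_all add: qpoly_nth0 del: of_nat_Suc)
qed

text \<open>\<open>X\<close> has weight 1 because the coefficient of \<open>a^i\<close> in the
  quartic is a polynomial of degree at most \<open>i\<close> in \<open>X\<close>, and
  \<open>c\<close> is linear in \<open>X\<close> and comes with \<open>a\<close>.\<close>

lemma graded_pfps: "graded 1 0 (pfps e1 e2 e3 e4 k)"
proof -
  have eq: "pfps e1 e2 e3 e4 k = (\<lambda>X. gfps ((e1 - 2 * X) / 4) (e1 - X) (e2 - X * (e1 - X)) (e3 - X * (e2 - X * (e1 - X)))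
     (e4 - X * (e3 - X * (e2 - X * (e1 - X)))) k)" by (rule ext) (simp add: pfps_def)
  show ?thesis unfolding eq
    by (rule graded_gsummand[where qc = "[:e1/4, -1/2:]" and ?q1.0 = "[:e1, -1:]" and ?q2.0 = "[:e2, -e1, 1:]" and ?q3.0 = "[:e3, -e2, e1, -1:]"
        and ?q4.0 = "[:e4, -e3, e2, -e1, 1:]"]) (simp_all add: field_simps)
qed

section \<open>The derivative in the fifth parameter at X = 0\<close>

definition dqpoly :: "complex \<Rightarrow> complex \<Rightarrow> complex \<Rightarrow> complex fps \<Rightarrow> complex fps" where
  "dqpoly e1 e2 e3 x = - (fps_X * (x^3 + fps_X * fps_const e1 * x^2 + fps_X^2 * fps_const e2 * x + fps_X^3 * fps_const e3))"

text \<open>Two sources of dependence on \<open>X\<close> are separated: \<open>dqpoly\<close>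
  differentiates the coefficients of the quartic, \<open>rqpoly\<close> its argument. The latter is
  \<open>a\<close> times the derivative in \<open>x\<close>, since the reflected point
  \<open>- m - a (e1 - 2 X) / 2\<close> moves with speed \<open>a\<close>.\<close>

definition rqpoly :: "complex \<Rightarrow> complex \<Rightarrow> complex \<Rightarrow> complex fps \<Rightarrow> complex fps" where
  "rqpoly e1 e2 e3 x = fps_X * (4 * x^3 + 3 * (fps_X * fps_const e1) * x^2 + 2 * (fps_X^2 * fps_const e2) * x + fps_X^3 * fps_const e3)"

abbreviation "qf e1 e2 e3 e4 \<equiv> qpoly (fps_const e1) (fps_const e2) (fps_const e3) (fps_const e4) (fps_X :: complex fps)"

definition reflpt :: "complex \<Rightarrow> nat \<Rightarrow> complex fps" where
  "reflpt e1 m = - of_nat m - 2 * fps_X * fps_const (e1 / 4)"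

lemma coeff_deriv_qpoly:
  assumes "coeff_deriv x (fps_const u * fps_X)" "x 0 = z"
  shows "coeff_deriv (\<lambda>X. qf (e1 - X) (e2 - X * (e1 - X)) (e3 - X * (e2 - X * (e1 - X))) (e4 - X * (e3 - X * (e2 - X * (e1 - X)))) (x X))
     (dqpoly e1 e2 e3 z + fps_const u * rqpoly e1 e2 e3 z)"
proof -
  have h: "coeff_deriv (\<lambda>X. fps_const (e1 - X)) (fps_const (- 1))"
    "coeff_deriv (\<lambda>X. fps_const (e2 - X * (e1 - X))) (fps_const (- e1))"
    "coeff_deriv (\<lambda>X. fps_const (e3 - X * (e2 - X * (e1 - X)))) (fps_const (- e2))"
    "coeff_deriv (\<lambda>X. fps_const (e4 - X * (e3 - X * (e2 - X * (e1 - X))))) (fps_const (- e3))"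
    by (rule coeff_deriv_fps_const; auto intro!: derivative_eq_intros)+
  note * = coeff_deriv_add[OF coeff_deriv_add[OF coeff_deriv_add[OF coeff_deriv_add[OF coeff_deriv_power[OF assms(1), of 4]
    coeff_deriv_mult[OF coeff_deriv_mult[OF coeff_deriv_const[of fps_X] h(1)] coeff_deriv_power[OF assms(1), of 3]]]
    coeff_deriv_mult[OF coeff_deriv_mult[OF coeff_deriv_const[of "fps_X^2"] h(2)] coeff_deriv_power[OF assms(1), of 2]]]
    coeff_deriv_mult[OF coeff_deriv_mult[OF coeff_deriv_const[of "fps_X^3"] h(3)] assms(1)]]
    coeff_deriv_mult[OF coeff_deriv_const[of "fps_X^4"] h(4)]]
  show ?thesis unfolding qpoly_def
    by (rule back_subst[where P = "coeff_deriv _", OF *])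
       (simp add: assms(2) dqpoly_def rqpoly_def fps_const_neg[symmetric] del: fps_const_neg, algebra)
qed

text \<open>
  \<open>qlogder\<close> is the logarithmic derivative of the \<open>j\<close>-th factor and \<open>pder\<close> the derivative of the summand \<open>pfps\<close>, with respect
  to \<open>X\<close> at \<open>X = 0\<close>.
\<close>

definition qlogder :: "complex \<Rightarrow> complex \<Rightarrow> complex \<Rightarrow> complex \<Rightarrow> nat \<Rightarrow> complex fps" where
  "qlogder e1 e2 e3 e4 j = (let A = qf e1 e2 e3 e4 (of_nat (Suc j)); B = qf e1 e2 e3 e4 (reflpt e1 (Suc j)) in
     ((dqpoly e1 e2 e3 (reflpt e1 (Suc j)) + rqpoly e1 e2 e3 (reflpt e1 (Suc j))) * inverse A
       - B * (dqpoly e1 e2 e3 (of_nat (Suc j)) * inverse A ^ 2)) * inverse (B * inverse A))"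

definition pder :: "complex \<Rightarrow> complex \<Rightarrow> complex \<Rightarrow> complex \<Rightarrow> nat \<Rightarrow> complex fps" where
  "pder e1 e2 e3 e4 k = (let A = qf e1 e2 e3 e4 (of_nat (Suc k)); N = of_nat (Suc k) + fps_X * fps_const (e1 / 4);
       R = (\<Prod>j<k. qf e1 e2 e3 e4 (reflpt e1 (Suc j)) * inverse (qf e1 e2 e3 e4 (of_nat (Suc j)))) in
     (fps_const (- 1/2) * fps_X * inverse A - N * (dqpoly e1 e2 e3 (of_nat (Suc k)) * inverse A ^ 2)) * R +
     N * inverse A * (R * (\<Sum>j<k. qlogder e1 e2 e3 e4 j)))"

lemma reflpt_nth0: "fps_nth (reflpt e1 m) 0 = - of_nat m" by (simp add: reflpt_def numeral_fps_const)

lemma coeff_deriv_pfps: "coeff_deriv (pfps e1 e2 e3 e4 k) (pder e1 e2 e3 e4 k)"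
proof -
  define QQ where "QQ = (\<lambda>X. qf (e1 - X) (e2 - X * (e1 - X)) (e3 - X * (e2 - X * (e1 - X))) (e4 - X * (e3 - X * (e2 - X * (e1 - X)))))"
  define N where "N = (\<lambda>k X. of_nat (Suc k) + fps_X * fps_const ((e1 - 2 * X) / 4) :: complex fps)"
  define Z where "Z = (\<lambda>j X. - of_nat (Suc j) - 2 * fps_X * fps_const ((e1 - 2 * X) / 4) :: complex fps)"
  have QQ0: "QQ 0 = qf e1 e2 e3 e4" by (simp add: QQ_def)
  have N0: "N k 0 = of_nat (Suc k) + fps_X * fps_const (e1 / 4)" by (simp add: N_def)
  have Z0: "Z j 0 = reflpt e1 (Suc j)" for j by (simp add: Z_def reflpt_def)
  have grA: "graded 1 0 (\<lambda>X. QQ X (F X))" if "graded 1 0 F" for F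
    unfolding QQ_def
    by (rule graded_qpoly[OF that, where ?q1.0 = "[:e1, -1:]" and ?q2.0 = "[:e2, -e1, 1:]" and ?q3.0 = "[:e3, -e2, e1, -1:]"
        and ?q4.0 = "[:e4, -e3, e2, -e1, 1:]"]) (simp_all add: field_simps)
  have dc: "((\<lambda>X. (e1 - 2 * X) / 4) has_field_derivative - 1/2) (at 0)" by (auto intro!: derivative_eq_intros)
  have dA: "coeff_deriv (\<lambda>X. QQ X (of_nat m)) (dqpoly e1 e2 e3 (of_nat m))" for m
    using coeff_deriv_qpoly[of "\<lambda>X. of_nat m" 0 "of_nat m" e1 e2 e3 e4] by (simp add: QQ_def coeff_deriv_const)
  have dZ: "coeff_deriv (Z j) (fps_const 1 * fps_X)" for j
  proof -
    have "coeff_deriv (\<lambda>X. - of_nat (Suc j) - 2 * fps_X * fps_const ((e1 - 2 * X) / 4))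
       (0 - (0 * fps_const ((e1 - 2 * 0) / 4) + 2 * fps_X * fps_const (- 1/2)))"
      by (intro coeff_deriv_diff coeff_deriv_mult coeff_deriv_const coeff_deriv_fps_const[OF dc])
    moreover have "0 - (0 * fps_const ((e1 - 2 * 0) / 4) + 2 * fps_X * fps_const (- 1/2)) = fps_const 1 * (fps_X :: complex fps)"
      by (simp add: numeral_fps_const mult_ac)
    ultimately show ?thesis unfolding Z_def by (rule back_subst[where P = "coeff_deriv _"])
  qed
  have dB: "coeff_deriv (\<lambda>X. QQ X (Z j X)) (dqpoly e1 e2 e3 (reflpt e1 (Suc j)) + rqpoly e1 e2 e3 (reflpt e1 (Suc j)))" for j
    using coeff_deriv_qpoly[OF dZ[of j] Z0[of j], of e1 e2 e3 e4] by (simp add: QQ_def)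
  have dN: "coeff_deriv (N k) (fps_const (- 1/2) * fps_X)"
  proof -
    have "coeff_deriv (\<lambda>X. of_nat (Suc k) + fps_X * fps_const ((e1 - 2 * X) / 4))
       (0 + (0 * fps_const ((e1 - 2 * 0) / 4) + fps_X * fps_const (- 1/2)))"
      by (intro coeff_deriv_add coeff_deriv_mult coeff_deriv_const coeff_deriv_fps_const[OF dc])
    then show ?thesis unfolding N_def by (simp add: mult.commute)
  qed
  have nz: "fps_nth (QQ X (of_nat (Suc m))) 0 \<noteq> 0" "fps_nth (QQ X (Z m X)) 0 \<noteq> 0" for X m
    by (simp_all add: QQ_def qpoly_nth0 Z_def numeral_fps_const del: of_nat_Suc)
  have diA: "coeff_deriv (\<lambda>X. inverse (QQ X (of_nat (Suc m)))) (- dqpoly e1 e2 e3 (of_nat (Suc m)) * inverse (QQ 0 (of_nat (Suc m))) ^ 2)" for m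
    by (rule coeff_deriv_inverse[OF dA grA[OF graded_const] nz(1)])
  have dR: "coeff_deriv (\<lambda>X. \<Prod>j<k. QQ X (Z j X) * inverse (QQ X (of_nat (Suc j))))
     ((\<Prod>j<k. QQ 0 (Z j 0) * inverse (QQ 0 (of_nat (Suc j)))) *
      (\<Sum>j<k. ((dqpoly e1 e2 e3 (reflpt e1 (Suc j)) + rqpoly e1 e2 e3 (reflpt e1 (Suc j))) * inverse (QQ 0 (of_nat (Suc j))) +
          QQ 0 (Z j 0) * (- dqpoly e1 e2 e3 (of_nat (Suc j)) * inverse (QQ 0 (of_nat (Suc j))) ^ 2)) *
          inverse (QQ 0 (Z j 0) * inverse (QQ 0 (of_nat (Suc j))))))" for k
    by (rule coeff_deriv_prod, rule coeff_deriv_mult[OF dB diA]) (use nz[of 0] in simp)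
  have eq: "pfps e1 e2 e3 e4 k = (\<lambda>X. N k X * inverse (QQ X (of_nat (Suc k))) * (\<Prod>j<k. QQ X (Z j X) * inverse (QQ X (of_nat (Suc j)))))"
    by (rule ext) (simp add: pfps_def gsummand_def N_def QQ_def Z_def)
  show ?thesis unfolding eq
    by (rule back_subst[where P = "coeff_deriv _", OF coeff_deriv_mult[OF coeff_deriv_mult[OF dN diA] dR]])
       (simp add: pder_def qlogder_def Let_def QQ0 N0 Z0 del: of_nat_Suc)
qed

text \<open>The degree bound comes from \<open>graded_pfps\<close>; the derivative of each summand
  at X = 0 is its coefficient 1, which \<open>poly_series_limit\<close> sums.\<close>

lemma pcoef_poly:
  "\<exists>P. degree P \<le> n \<and> (\<forall>X. pcoef e1 e2 e3 e4 X n = poly P X) \<and> (\<lambda>k. fps_nth (pder e1 e2 e3 e4 k) n) sums coeff P 1"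
proof -
  have "\<forall>k. \<exists>p. degree p \<le> n \<and> (\<forall>X. fps_nth (pfps e1 e2 e3 e4 k X) n = poly p X)"
    using graded_pfps unfolding graded_def by (metis diff_zero div_by_1)
  then obtain p where p: "\<And>k. degree (p k) \<le> n" "\<And>k X. fps_nth (pfps e1 e2 e3 e4 k X) n = poly (p k) X" by metis
  have c: "fps_nth (pder e1 e2 e3 e4 k) n = coeff (p k) 1" for k
  proof -
    have "((\<lambda>X. poly (p k) X) has_field_derivative fps_nth (pder e1 e2 e3 e4 k) n) (at 0)"
      using coeff_deriv_pfps[of e1 e2 e3 e4 k, unfolded coeff_deriv_def, rule_format, of n] unfolding p(2) .
    from DERIV_unique[OF this poly_DERIV] show ?thesis by (simp add: poly_0_coeff_0 coeff_pderiv)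
  qed
  have "(\<lambda>k. poly (p k) X) sums pcoef e1 e2 e3 e4 X n" for X using pfps_sums[of e1 e2 e3 e4 X n] unfolding p(2) .
  from poly_series_limit[OF p(1) this] show ?thesis unfolding c by blast
qed

text \<open>Compare coefficients in \<open>P = P(0) + b Q\<close>: that of \<open>X\<close> is
  \<open>b e4\<close>, and that of \<open>X^5\<close> is \<open>b\<close>, which the degree bound
  annihilates for \<open>n < 5\<close>.\<close>

theorem pcoef_structure:
  assumes "n \<le> 6"
  shows "\<exists>b. (\<forall>X. pcoef e1 e2 e3 e4 X n = pcoef e1 e2 e3 e4 0 n + b * poly (quintic e1 e2 e3 e4) X) \<and>
     (\<lambda>k. fps_nth (pder e1 e2 e3 e4 k) n) sums (b * e4) \<and> (n < 5 \<longrightarrow> b = 0)"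
proof -
  obtain P where P: "degree P \<le> n" "\<And>X. pcoef e1 e2 e3 e4 X n = poly P X" "(\<lambda>k. fps_nth (pder e1 e2 e3 e4 k) n) sums coeff P 1"
    using pcoef_poly by metis
  have dQ: "degree (quintic e1 e2 e3 e4) = 5" "poly (quintic e1 e2 e3 e4) 0 = 0" by (simp_all add: quintic_def)
  have "\<exists>b. P = [:poly P 0:] + smult b (quintic e1 e2 e3 e4)"
    using P(1) assms dQ by (rule_tac poly_constant_on_fibres) (auto simp: P(2)[symmetric] intro: pcoef_fibre)
  then obtain b where b: "P = [:poly P 0:] + smult b (quintic e1 e2 e3 e4)" by blast
  have "poly P X = poly P 0 + b * poly (quintic e1 e2 e3 e4) X" for X by (subst b) simp
  moreover have "coeff P 1 = b * e4" by (subst b) (simp add: quintic_def)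
  moreover have "b = 0" if "n < 5"
  proof -
    have "coeff P 5 = 0" using P(1) that by (intro coeff_eq_0) simp
    moreover have "coeff P 5 = b" by (subst b) (simp add: quintic_def numeral_eq_Suc)
    ultimately show ?thesis by simp
  qed
  ultimately show ?thesis using P(2,3) by metis
qed

text \<open>
  The quartic with these coefficients is \<open>z^4 + z^2 + t z + 4\<close> in \<open>z = x + 2 a\<close> (for \<open>a = 1\<close>), so \<open>t\<close> has weight 3.
\<close>

lemma graded_pder: "graded 3 1 (\<lambda>t. pder 8 25 (36 + t) (24 + 2 * t) k)"
proof -
  have gX: "graded 3 1 (\<lambda>t. fps_X)" using graded_monom[of 1 1 "[:1:]" 3] by simp
  have X3: "fps_X ^ 3 * fps_const (36 + t) = fps_X ^ 3 * fps_const (poly [:36, 1:] t)" for t :: complex by simp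
  have g3: "graded 3 0 (\<lambda>t. fps_X ^ 3 * fps_const (36 + t))" unfolding X3 by (rule graded_monom) simp_all
  have gq: "graded 3 0 (\<lambda>t. qf 8 25 (36 + t) (24 + 2 * t) x)" for x
    by (rule graded_qpoly[OF graded_const, where ?q1.0 = "[:8:]" and ?q2.0 = "[:25:]" and ?q3.0 = "[:36, 1:]" and ?q4.0 = "[:24, 2:]"]) simp_all
  have gd: "graded 3 1 (\<lambda>t. dqpoly 8 25 (36 + t) x)" for x
    unfolding dqpoly_def by (intro graded_uminus graded_mult_shift(2)[OF _ gX] graded_add graded_const g3)
  have gr: "graded 3 1 (\<lambda>t. rqpoly 8 25 (36 + t) x)" for x
    unfolding rqpoly_def by (intro graded_mult_shift(2)[OF _ gX] graded_add graded_const g3)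
  have nz: "fps_nth (qf e1 e2 e3 e4 (of_nat (Suc j))) 0 \<noteq> 0" "fps_nth (qf e1 e2 e3 e4 (reflpt e1 (Suc j))) 0 \<noteq> 0" for e1 e2 e3 e4 j
    by (simp_all add: qpoly_nth0 reflpt_nth0 del: of_nat_Suc)
  have gi: "graded 3 0 (\<lambda>t. inverse (qf 8 25 (36 + t) (24 + 2 * t) (of_nat (Suc j))))" for j
    by (rule graded_inverse[OF gq nz(1)])
  have gl: "graded 3 1 (\<lambda>t. qlogder 8 25 (36 + t) (24 + 2 * t) j)" for j
    unfolding qlogder_def Let_def
    by (intro graded_mult_shift(2)[OF graded_inverse] graded_diff graded_mult_shift(2)[OF gi] graded_add gd gr
          graded_mult_shift(1)[OF gq] graded_mult_shift(2)[OF graded_power0] graded_mult0 gi gq) (use nz in simp)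
  have gp: "graded 3 0 (\<lambda>t. \<Prod>j<k. qf 8 25 (36 + t) (24 + 2 * t) (reflpt 8 (Suc j)) * inverse (qf 8 25 (36 + t) (24 + 2 * t) (of_nat (Suc j))))"
    by (intro graded_prod0 graded_mult0 gq gi)
  show ?thesis unfolding pder_def Let_def
    by (intro graded_add graded_mult_shift(2)[OF gp] graded_diff graded_mult_shift(2)[OF gi] graded_mult_shift(1)[OF graded_const]
       graded_mult_shift(1)[OF graded_mult0] graded_mult_shift(1)[OF gp] graded_sum gl gX gd graded_mult_shift(2)[OF graded_power0]
       gi graded_const)
qed

text \<open>
  The derivative \<open>b(t) (24 + 2 t)\<close> is a polynomial of degree at most 1 in \<open>t\<close> with zero \<open>t = -12\<close>, so \<open>b\<close> is constant. The target is \<open>t = 2\<close>,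
  whereas at \<open>t = 0\<close> the derivative can be computed.
\<close>

theorem pcoef_link:
  assumes n: "n \<in> {5, 6}"
  shows "\<exists>b. pcoef 8 25 38 28 2 n = pcoef 8 25 38 28 0 n + 8 * b \<and> (\<lambda>k. fps_nth (pder 8 25 36 24 k) n) sums (24 * b)"
proof -
  \<comment> \<open>The order 1 in \<open>graded_pder\<close> matters here: it lowers the degree
    bound in \<open>t\<close> for \<open>n = 6\<close> from 2 to 1.\<close>
  have n6: "n \<le> 6" and d1: "(n - 1) div 3 = 1" using n by auto
  have "\<forall>k. \<exists>p. degree p \<le> 1 \<and> (\<forall>t. fps_nth (pder 8 25 (36 + t) (24 + 2 * t) k) n = poly p t)"
    using graded_pder unfolding graded_def using d1 by metis
  then obtain p where p: "\<And>k. degree (p k) \<le> 1" "\<And>k t. fps_nth (pder 8 25 (36 + t) (24 + 2 * t) k) n = poly (p k) t" by metis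
  have "\<exists>b. (\<forall>X. pcoef 8 25 (36 + t) (24 + 2 * t) X n = pcoef 8 25 (36 + t) (24 + 2 * t) 0 n + b * poly (quintic 8 25 (36 + t) (24 + 2 * t)) X) \<and>
     (\<lambda>k. poly (p k) t) sums (b * (24 + 2 * t))" for t
    using pcoef_structure[OF n6, of 8 25 "36 + t" "24 + 2 * t"] unfolding p(2) by blast
  then obtain b where b: "\<And>t X. pcoef 8 25 (36 + t) (24 + 2 * t) X n =
       pcoef 8 25 (36 + t) (24 + 2 * t) 0 n + b t * poly (quintic 8 25 (36 + t) (24 + 2 * t)) X"
     "\<And>t. (\<lambda>k. poly (p k) t) sums (b t * (24 + 2 * t))" by metis
  obtain q where q: "degree q \<le> 1" "\<And>t. b t * (24 + 2 * t) = poly q t" using poly_series_limit[OF p(1) b(2)] by metis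
  define u v where "u = coeff q 0" and "v = coeff q 1"
  have uv: "q = [:u, v:]"
  proof (rule poly_eqI)
    fix i
    have "coeff q i = 0" if "i > 1" using q(1) that by (intro coeff_eq_0) simp
    then show "coeff q i = coeff [:u, v:] i" by (auto simp: u_def v_def coeff_pCons split: nat.split)
  qed
  have "u = 12 * v" using q(2)[of "-12"] by (simp add: uv)
  then have s0: "b 0 * 24 = 12 * v" and s2: "b 2 * 28 = 14 * v" using q(2)[of 0] q(2)[of 2] by (simp_all add: uv)
  have "v = 2 * b 2" using s2 by simp
  then have "b 0 * 24 = 24 * b 2" using s0 by simp
  moreover have "poly (p k) 0 = fps_nth (pder 8 25 36 24 k) n" for k using p(2)[of 0 k] by simp
  ultimately have "(\<lambda>k. fps_nth (pder 8 25 36 24 k) n) sums (24 * b 2)"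
    using b(2)[of 0] by (simp add: mult.commute)
  \<comment> \<open>The 8 is the value of \<open>quintic 8 25 38 28\<close> at 2, the product of 1,
    1, 2, 2, 2.\<close>
  moreover have "pcoef 8 25 38 28 2 n = pcoef 8 25 38 28 0 n + 8 * b 2"
    using b(1)[of 2 2] by (simp add: quintic_def)
  ultimately show ?thesis by blast
qed

lemma pcoef_low:
  assumes "n < 5" shows "pcoef 8 25 38 28 2 n = pcoef 8 25 38 28 0 n"
  using pcoef_structure[of n 8 25 38 28] assms by force

section \<open>Zeta values and the derivative in the even case\<close>

definition zser :: "nat \<Rightarrow> complex" where "zser n = (\<Sum>k. 1 / of_nat (Suc k) ^ n)"

definition dzser :: "nat \<Rightarrow> nat \<Rightarrow> complex" where
  "dzser a b = (\<Sum>k. 1 / of_nat (Suc k) ^ a * (\<Sum>j<k. 1 / of_nat (Suc j) ^ b))"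

lemma summable_zser: "n \<ge> 2 \<Longrightarrow> summable (\<lambda>k. 1 / of_nat (Suc k) ^ n :: complex)"
proof (rule summable_comparison_test'[OF summable_inverse_squares[of 1]])
  fix k assume "n \<ge> 2"
  have "real (Suc k) ^ 2 \<le> real (Suc k) ^ n" using \<open>n \<ge> 2\<close> by (intro power_increasing) auto
  then show "cmod (1 / of_nat (Suc k) ^ n) \<le> 1 / real (Suc k) ^ 2"
    by (simp add: norm_divide norm_power frac_le del: of_nat_Suc)
qed

lemma summable_dzser: "a \<ge> 3 \<Longrightarrow> summable (\<lambda>k. 1 / of_nat (Suc k) ^ a * (\<Sum>j<k. 1 / of_nat (Suc j) ^ b) :: complex)"
proof (rule summable_comparison_test'[OF summable_inverse_squares[of 1]])
  fix k assume a: "a \<ge> 3"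
  have "cmod (\<Sum>j<k. 1 / of_nat (Suc j) ^ b) \<le> (\<Sum>j<k. 1)"
    by (rule order_trans[OF norm_sum]) (intro sum_mono, simp add: norm_divide norm_power del: of_nat_Suc)
  then have "cmod (\<Sum>j<k. 1 / of_nat (Suc j) ^ b) \<le> real (Suc k)" by simp
  moreover have "cmod (1 / of_nat (Suc k) ^ a) \<le> 1 / real (Suc k) ^ 3"
  proof -
    have "real (Suc k) ^ 3 \<le> real (Suc k) ^ a" using a by (intro power_increasing) auto
    then show ?thesis by (simp add: norm_divide norm_power frac_le del: of_nat_Suc)
  qed
  ultimately have "cmod (1 / of_nat (Suc k) ^ a * (\<Sum>j<k. 1 / of_nat (Suc j) ^ b)) \<le> 1 / real (Suc k) ^ 3 * real (Suc k)"
    unfolding norm_mult by (intro mult_mono) auto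
  also have "\<dots> = 1 / real (Suc k) ^ 2" by (simp add: power2_eq_square power3_eq_cube)
  finally show "cmod (1 / of_nat (Suc k) ^ a * (\<Sum>j<k. 1 / of_nat (Suc j) ^ b)) \<le> 1 / real (Suc k) ^ 2" .
qed

text \<open>A finite square of index pairs splits into two triangles and the diagonal; with
  exponents at least 3 each piece converges.\<close>

lemma stuffle:
  assumes "a \<ge> 3" "b \<ge> 3"
  shows "zser a * zser b = dzser a b + dzser b a + zser (a + b)"
proof -
  define x y where "x k = (1 / of_nat (Suc k) ^ a :: complex)" and "y k = (1 / of_nat (Suc k) ^ b :: complex)" for k
  have fin: "(\<Sum>k<N. x k) * (\<Sum>k<N. y k) = (\<Sum>k<N. x k * (\<Sum>j<k. y j)) + (\<Sum>k<N. y k * (\<Sum>j<k. x j)) + (\<Sum>k<N. x k * y k)" for N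
    by (induction N) (simp_all add: algebra_simps)
  have "(\<lambda>N. (\<Sum>k<N. x k) * (\<Sum>k<N. y k)) \<longlonglongrightarrow> zser a * zser b"
    unfolding zser_def x_def y_def by (intro tendsto_mult summable_LIMSEQ summable_zser) (use assms in auto)
  moreover have "(\<lambda>N. (\<Sum>k<N. x k * (\<Sum>j<k. y j)) + (\<Sum>k<N. y k * (\<Sum>j<k. x j)) + (\<Sum>k<N. x k * y k)) \<longlonglongrightarrow> dzser a b + dzser b a + zser (a + b)"
  proof -
    have xy: "x k * y k = 1 / of_nat (Suc k) ^ (a + b)" for k by (simp add: x_def y_def power_add)
    show ?thesis unfolding xy unfolding zser_def dzser_def x_def y_def
      by (intro tendsto_add summable_LIMSEQ summable_dzser summable_zser) (use assms in auto)
  qed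
  ultimately show ?thesis unfolding fin by (rule LIMSEQ_unique)
qed

section \<open>Homogeneity: substituting \<open>X / m\<close> for the formal variable\<close>

definition fscale :: "complex \<Rightarrow> complex fps \<Rightarrow> complex fps" where
  "fscale m F = Abs_fps (\<lambda>n. fps_nth F n / m ^ n)"

lemma fscale_nth: "fps_nth (fscale m F) n = fps_nth F n / m ^ n" by (simp add: fscale_def)

lemma fscale_add: "fscale m (F + G) = fscale m F + fscale m G"
  by (simp add: fps_eq_iff fscale_nth add_divide_distrib)

lemma fscale_uminus: "fscale m (- F) = - fscale m F"
  by (simp add: fps_eq_iff fscale_nth)

lemma fscale_diff: "fscale m (F - G) = fscale m F - fscale m G"
  by (simp add: fps_eq_iff fscale_nth diff_divide_distrib)

lemma fscale_mult: "fscale m (F * G) = fscale m F * fscale m G"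
proof (rule fps_ext)
  fix n
  have "(\<Sum>i=0..n. fps_nth F i * fps_nth G (n - i)) / m ^ n = (\<Sum>i=0..n. (fps_nth F i / m ^ i) * (fps_nth G (n - i) / m ^ (n - i)))"
    unfolding sum_divide_distrib by (intro sum.cong refl) (simp flip: power_add)
  then show "fps_nth (fscale m (F * G)) n = fps_nth (fscale m F * fscale m G) n"
    by (simp add: fscale_nth fps_mult_nth)
qed

lemma fscale_const: "fscale m (fps_const c) = fps_const c"
  by (auto simp: fps_eq_iff fscale_nth)

lemma fscale_1: "fscale m 1 = 1" using fscale_const[of m 1] by simp

lemma fscale_power: "fscale m (F ^ n) = fscale m F ^ n"
  by (induction n) (simp_all add: fscale_1 fscale_mult)

lemma fscale_X: "fscale m fps_X = fps_const (1 / m) * fps_X"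
  by (auto simp: fps_eq_iff fscale_nth fps_X_def)

lemma fscale_numeral: "fscale m (numeral k) = numeral k"
  using fscale_const[of m "numeral k"] by (simp add: numeral_fps_const)

lemma fscale_inverse:
  assumes "fps_nth F 0 \<noteq> 0" shows "fscale m (inverse F) = inverse (fscale m F)"
proof -
  have "fscale m F * fscale m (inverse F) = 1"
    unfolding fscale_mult[symmetric] by (simp add: inverse_mult_eq_1'[OF assms] fscale_1)
  from fps_inverse_unique[OF this] show ?thesis by simp
qed

lemma of_nat_fps: "of_nat m = fps_const (of_nat m :: complex)" by (simp add: fps_of_nat)

lemma X_scale: "m \<noteq> 0 \<Longrightarrow> fps_X = fps_const m * fscale m fps_X"
  unfolding fscale_X mult.assoc[symmetric] fps_const_mult by simp

text \<open>All three are homogeneous of degree 4 in \<open>x\<close> and the formal variable. Hence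
  the quartic at the integer \<open>m\<close> is \<open>m^4\<close> times the quartic at 1 in the
  variable \<open>a / m\<close>, and the coefficient of \<open>a^n\<close> acquires the power
  \<open>1 / m^n\<close> from which zeta values are built.\<close>

lemma qf_scale:
  assumes "m \<noteq> 0"
  shows "qf e1 e2 e3 e4 (fps_const m * fscale m z) = fps_const (m ^ 4) * fscale m (qf e1 e2 e3 e4 z)"
    and "dqpoly e1 e2 e3 (fps_const m * fscale m z) = fps_const (m ^ 4) * fscale m (dqpoly e1 e2 e3 z)"
    and "rqpoly e1 e2 e3 (fps_const m * fscale m z) = fps_const (m ^ 4) * fscale m (rqpoly e1 e2 e3 z)"
proof -
  define y M w where "y = fscale m fps_X" and "M = fps_const m" and "w = fscale m z"
  have X: "fps_X = M * y" unfolding y_def M_def by (rule X_scale[OF assms])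
  have "fscale m (qf e1 e2 e3 e4 z) = w^4 + y * fps_const e1 * w^3 + y^2 * fps_const e2 * w^2 + y^3 * fps_const e3 * w + y^4 * fps_const e4"
    unfolding qpoly_def by (simp add: fscale_add fscale_mult fscale_power fscale_const y_def w_def)
  then show "qf e1 e2 e3 e4 (fps_const m * fscale m z) = fps_const (m ^ 4) * fscale m (qf e1 e2 e3 e4 z)"
    unfolding qpoly_def M_def[symmetric] w_def[symmetric] X fps_const_power[symmetric] by algebra
  have "fscale m (dqpoly e1 e2 e3 z) = - (y * (w^3 + y * fps_const e1 * w^2 + y^2 * fps_const e2 * w + y^3 * fps_const e3))"
    unfolding dqpoly_def by (simp add: fscale_add fscale_uminus fscale_mult fscale_power fscale_const y_def w_def)
  then show "dqpoly e1 e2 e3 (fps_const m * fscale m z) = fps_const (m ^ 4) * fscale m (dqpoly e1 e2 e3 z)"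
    unfolding dqpoly_def M_def[symmetric] w_def[symmetric] X fps_const_power[symmetric] by algebra
  have "fscale m (rqpoly e1 e2 e3 z) = y * (4 * w^3 + 3 * (y * fps_const e1) * w^2 + 2 * (y^2 * fps_const e2) * w + y^3 * fps_const e3)"
    unfolding rqpoly_def by (simp add: fscale_add fscale_mult fscale_power fscale_const fscale_numeral y_def w_def)
  then show "rqpoly e1 e2 e3 (fps_const m * fscale m z) = fps_const (m ^ 4) * fscale m (rqpoly e1 e2 e3 z)"
    unfolding rqpoly_def M_def[symmetric] w_def[symmetric] X fps_const_power[symmetric] by algebra
qed

lemma reflpt_scale:
  assumes "m \<noteq> 0" shows "reflpt e1 m = fps_const (of_nat m) * fscale (of_nat m) (reflpt e1 1)"
proof -
  define y M where "y = fscale (of_nat m) fps_X" and "M = fps_const (of_nat m :: complex)"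
  have X: "fps_X = M * y" unfolding y_def M_def using assms by (intro X_scale) simp
  have F: "fscale (of_nat m) (reflpt e1 1) = - 1 - 2 * y * fps_const (e1 / 4)"
    unfolding reflpt_def by (simp add: fscale_diff fscale_uminus fscale_mult fscale_1 fscale_const fscale_numeral y_def)
  show ?thesis unfolding F unfolding reflpt_def of_nat_fps M_def[symmetric] X by (simp add: algebra_simps)
qed

lemma qf_of_nat_scale:
  assumes "m \<noteq> 0"
  shows "qf e1 e2 e3 e4 (of_nat m) = fps_const (of_nat m ^ 4) * fscale (of_nat m) (qf e1 e2 e3 e4 1)"
    "dqpoly e1 e2 e3 (of_nat m) = fps_const (of_nat m ^ 4) * fscale (of_nat m) (dqpoly e1 e2 e3 1)"
  using qf_scale(1)[of "of_nat m" e1 e2 e3 e4 1] qf_scale(2)[of "of_nat m" e1 e2 e3 1] assms by (simp_all add: fscale_1 fps_of_nat)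

text \<open>
  These are the coefficients of \<open>z^4 + s z^2 + t\<close> in \<open>z = x + c\<close>. Evenness makes all factors of the product equal to 1 at \<open>X = 0\<close>, so that the derivative
  splits into single and double sums.
\<close>

locale even_base =
  fixes c s t e1 e2 e3 e4 :: complex
  assumes e: "e1 = 4 * c" "e2 = 6 * c^2 + s" "e3 = 4 * c^3 + 2 * s * c" "e4 = c^4 + s * c^2 + t"
begin

definition "Ah = qf e1 e2 e3 e4 1"
definition "Nh = 1 + fps_X * fps_const c"
definition "Sh = Nh * inverse Ah"
definition "Lh = (dqpoly e1 e2 e3 (reflpt e1 1) + rqpoly e1 e2 e3 (reflpt e1 1) - dqpoly e1 e2 e3 1) * inverse Ah"
definition "Fh = fps_const (- 1/2) * fps_X * inverse Ah - Nh * (dqpoly e1 e2 e3 1 * inverse Ah ^ 2)"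

lemma Ah0: "fps_nth Ah 0 = 1" by (simp add: Ah_def qpoly_nth0)

text \<open>In \<open>z = x + c a\<close> the reflection is \<open>z \<mapsto> - z\<close>, and the
  quartic is even in \<open>z\<close>.\<close>

lemma qf_refl: "qf e1 e2 e3 e4 (reflpt e1 m) = qf e1 e2 e3 e4 (of_nat m)"
proof -
  define x C S T :: "complex fps" where d: "x = of_nat m" "C = fps_const c" "S = fps_const s" "T = fps_const t"
  have "fps_const e1 = 4 * C" "fps_const e2 = 6 * C^2 + S" "fps_const e3 = 4 * C^3 + 2 * S * C" "fps_const e4 = C^4 + S * C^2 + T"
    unfolding e d by (simp_all add: numeral_fps_const fps_const_power[symmetric] fps_const_mult[symmetric] fps_const_add[symmetric]
       del: fps_const_power fps_const_mult fps_const_add)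
  moreover have "reflpt e1 m = - x - 2 * fps_X * C" unfolding reflpt_def d e by simp
  ultimately show ?thesis unfolding d(1)[symmetric] qpoly_def by algebra
qed

lemma scale_N:
  assumes "m \<noteq> 0" shows "of_nat m + fps_X * fps_const (e1 / 4) = fps_const (of_nat m) * fscale (of_nat m) Nh"
proof -
  define y M where "y = fscale (of_nat m) fps_X" and "M = fps_const (of_nat m :: complex)"
  have X: "fps_X = M * y" unfolding y_def M_def using assms by (intro X_scale) simp
  have "fscale (of_nat m) Nh = 1 + y * fps_const c"
    unfolding Nh_def by (simp add: fscale_add fscale_mult fscale_1 fscale_const y_def)
  moreover have "e1 / 4 = c" by (simp add: e)
  ultimately show ?thesis unfolding of_nat_fps M_def[symmetric] X by (simp add: algebra_simps)
qed

lemma scale_inv: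
  assumes "m \<noteq> 0" shows "inverse (qf e1 e2 e3 e4 (of_nat m)) = fps_const (1 / of_nat m ^ 4) * fscale (of_nat m) (inverse Ah)"
proof -
  have "inverse (qf e1 e2 e3 e4 (of_nat m)) = inverse (fps_const (of_nat m ^ 4)) * inverse (fscale (of_nat m) Ah)"
    unfolding qf_of_nat_scale(1)[OF assms] Ah_def by (rule fps_inverse_mult)
  then show ?thesis using Ah0 by (simp add: fscale_inverse fps_const_inverse inverse_eq_divide)
qed

text \<open>Numerator and denominator of each factor coincide at X = 0, so the logarithmic
  derivative is the difference of their derivatives over the common quartic.\<close>

lemma qlogder_eq: "qlogder e1 e2 e3 e4 j = fscale (of_nat (Suc j)) Lh"
proof -
  define m where "m = Suc j"
  have m: "m \<noteq> 0" and m': "of_nat m \<noteq> (0 :: complex)" by (simp_all add: m_def del: of_nat_Suc)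
  define A where "A = qf e1 e2 e3 e4 (of_nat m)"
  define M where "M = fps_const (of_nat m ^ 4 :: complex)"
  define M' where "M' = fps_const (1 / of_nat m ^ 4 :: complex)"
  have "fps_nth A 0 \<noteq> 0" unfolding A_def qpoly_nth0 m_def by (simp del: of_nat_Suc)
  then have A1: "A * inverse A = 1" by (rule inverse_mult_eq_1')
  have MM: "M * M' = 1" unfolding M_def M'_def using m by simp
  define d where "d = dqpoly e1 e2 e3 (reflpt e1 m) + rqpoly e1 e2 e3 (reflpt e1 m)"
  define f where "f = dqpoly e1 e2 e3 (of_nat m)"
  have f: "f = M * fscale (of_nat m) (dqpoly e1 e2 e3 1)"
    unfolding f_def M_def by (rule qf_of_nat_scale(2)[OF m])
  have d: "d = M * fscale (of_nat m) (dqpoly e1 e2 e3 (reflpt e1 1)) + M * fscale (of_nat m) (rqpoly e1 e2 e3 (reflpt e1 1))"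
    unfolding d_def reflpt_scale[OF m] qf_scale(2,3)[OF m'] M_def ..
  have "qlogder e1 e2 e3 e4 j = (d * inverse A - A * (f * inverse A ^ 2)) * inverse (A * inverse A)"
    unfolding qlogder_def Let_def m_def[symmetric] qf_refl d_def f_def A_def ..
  also have "\<dots> = d * inverse A - A * (f * inverse A ^ 2)" unfolding A1 by simp
  also have "\<dots> = (d - f) * inverse A" using A1 by algebra
  also have "\<dots> = (M * fscale (of_nat m) (dqpoly e1 e2 e3 (reflpt e1 1) + rqpoly e1 e2 e3 (reflpt e1 1) - dqpoly e1 e2 e3 1)) * (M' * fscale (of_nat m) (inverse Ah))"
    unfolding d f A_def scale_inv[OF m] fscale_add fscale_diff M'_def by (simp only: distrib_left right_diff_distrib)
  also have "\<dots> = (M * M') * fscale (of_nat m) Lh" unfolding Lh_def fscale_mult by (simp add: mult_ac)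
  finally show ?thesis unfolding MM m_def by simp
qed

text \<open>The product is 1, the linear numerator scales with \<open>m\<close> and the inverse
  quartic with \<open>m^-4\<close>. The remaining \<open>1 / m^3\<close> explains why the
  coefficient of \<open>a^n\<close> has weight \<open>n + 3\<close>.\<close>

lemma pder_eq: "pder e1 e2 e3 e4 k = fps_const (1 / of_nat (Suc k) ^ 3) * (fscale (of_nat (Suc k)) Fh +
    fscale (of_nat (Suc k)) Sh * (\<Sum>j<k. fscale (of_nat (Suc j)) Lh))"
proof -
  define m where "m = Suc k"
  have m: "m \<noteq> 0" by (simp add: m_def)
  define M where "M = fps_const (of_nat m :: complex)"
  define I where "I = fps_const (1 / of_nat m :: complex)"
  have MI: "M * I = 1" unfolding M_def I_def using m by simp
  have c: "fps_const (of_nat m ^ 4) = M ^ 4" "fps_const (1 / of_nat m ^ 4) = I ^ 4" "fps_const (1 / of_nat m ^ 3) = I ^ 3" "fps_const (of_nat m) = M"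
    by (simp_all add: M_def I_def fps_const_power power_one_over)
  have R: "(\<Prod>j<k. qf e1 e2 e3 e4 (reflpt e1 (Suc j)) * inverse (qf e1 e2 e3 e4 (of_nat (Suc j)))) = 1"
  proof (rule prod.neutral, rule ballI)
    fix j
    have "fps_nth (qf e1 e2 e3 e4 (of_nat (Suc j))) 0 \<noteq> 0" unfolding qpoly_nth0 by (simp del: of_nat_Suc)
    then show "qf e1 e2 e3 e4 (reflpt e1 (Suc j)) * inverse (qf e1 e2 e3 e4 (of_nat (Suc j))) = 1"
      unfolding qf_refl by (rule inverse_mult_eq_1')
  qed
  have o: "dqpoly e1 e2 e3 (of_nat m) = M ^ 4 * fscale (of_nat m) (dqpoly e1 e2 e3 1)"
    using qf_of_nat_scale(2)[OF m] by (simp only: c)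
  define y where "y = fscale (of_nat m) fps_X"
  have X: "fps_X = M * y" unfolding y_def M_def using m by (intro X_scale) simp
  define i n d l h where "i = fscale (of_nat m) (inverse Ah)" and "n = fscale (of_nat m) Nh" and "d = fscale (of_nat m) (dqpoly e1 e2 e3 1)"
    and "l = (\<Sum>j<k. fscale (of_nat (Suc j)) Lh)" and "h = fps_const (- 1/2 :: complex)"
  have F: "fscale (of_nat m) Fh = h * y * i - n * (d * i ^ 2)"
    unfolding Fh_def by (simp add: fscale_diff fscale_mult fscale_power fscale_const y_def i_def n_def d_def h_def)
  have S: "fscale (of_nat m) Sh = n * i" unfolding Sh_def by (simp add: fscale_mult n_def i_def)
  have "pder e1 e2 e3 e4 k = (h * (M * y) * (I ^ 4 * i) - M * n * (M ^ 4 * d * (I ^ 4 * i) ^ 2)) + (M * n) * (I ^ 4 * i) * l"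
    unfolding pder_def Let_def R mult_1_right unfolding m_def[symmetric] scale_N[OF m] scale_inv[OF m] o qlogder_eq c
    unfolding i_def[symmetric] n_def[symmetric] d_def[symmetric] l_def[symmetric] h_def[symmetric] X by (simp only: mult_1_left)
  also have "\<dots> = I ^ 3 * ((h * y * i - n * (d * i ^ 2)) + n * i * l)" using MI by algebra
  finally show ?thesis unfolding m_def[symmetric] c F S l_def .
qed

lemma Lh0: "fps_nth Lh 0 = 0"
proof -
  have "Lh = fps_X * (- (reflpt e1 1 ^ 3 + fps_X * fps_const e1 * reflpt e1 1 ^ 2 + fps_X^2 * fps_const e2 * reflpt e1 1 + fps_X^3 * fps_const e3) +
     (4 * reflpt e1 1 ^ 3 + 3 * (fps_X * fps_const e1) * reflpt e1 1 ^ 2 + 2 * (fps_X^2 * fps_const e2) * reflpt e1 1 + fps_X^3 * fps_const e3) +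
     (1 ^ 3 + fps_X * fps_const e1 * 1 ^ 2 + fps_X^2 * fps_const e2 * 1 + fps_X^3 * fps_const e3)) * inverse Ah"
    unfolding Lh_def dqpoly_def rqpoly_def by (simp only: distrib_left mult_minus_right diff_minus_eq_add)
  then obtain G where "Lh = fps_X * G * inverse Ah" by blast
  then show ?thesis by (simp add: mult.assoc)
qed

theorem pder_sums: "(\<lambda>k. fps_nth (pder e1 e2 e3 e4 k) n) sums
   (fps_nth Fh n * zser (n + 3) + (\<Sum>i<n. fps_nth Sh i * fps_nth Lh (n - i) * dzser (3 + i) (n - i)))"
proof -
  have eq: "fps_nth (pder e1 e2 e3 e4 k) n = fps_nth Fh n * (1 / of_nat (Suc k) ^ (n + 3)) +
     (\<Sum>i<n. fps_nth Sh i * fps_nth Lh (n - i) * (1 / of_nat (Suc k) ^ (3 + i) * (\<Sum>j<k. 1 / of_nat (Suc j) ^ (n - i))))" for k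
  proof -
    have "fps_nth (fscale (of_nat (Suc k)) Sh * (\<Sum>j<k. fscale (of_nat (Suc j)) Lh)) n =
       (\<Sum>i=0..n. fps_nth Sh i / of_nat (Suc k) ^ i * (\<Sum>j<k. fps_nth Lh (n - i) / of_nat (Suc j) ^ (n - i)))"
      by (simp only: fps_mult_nth fscale_nth fps_sum_nth)
    also have "\<dots> = (\<Sum>i<n. fps_nth Sh i / of_nat (Suc k) ^ i * (\<Sum>j<k. fps_nth Lh (n - i) / of_nat (Suc j) ^ (n - i)))"
      by (intro sum.mono_neutral_right) (auto simp: Lh0)
    finally have "fps_nth (pder e1 e2 e3 e4 k) n = 1 / of_nat (Suc k) ^ 3 * (fps_nth Fh n / of_nat (Suc k) ^ n +
       (\<Sum>i<n. fps_nth Sh i / of_nat (Suc k) ^ i * (\<Sum>j<k. fps_nth Lh (n - i) / of_nat (Suc j) ^ (n - i))))"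
      unfolding pder_eq by (simp only: fps_mult_left_const_nth fps_add_nth fscale_nth)
    also have "\<dots> = fps_nth Fh n * (1 / of_nat (Suc k) ^ (n + 3)) +
     (\<Sum>i<n. fps_nth Sh i * fps_nth Lh (n - i) * (1 / of_nat (Suc k) ^ (3 + i) * (\<Sum>j<k. 1 / of_nat (Suc j) ^ (n - i))))"
      by (simp add: distrib_left sum_distrib_left sum_divide_distrib power_add mult_ac del: of_nat_Suc)
    finally show ?thesis .
  qed
  show ?thesis unfolding eq zser_def dzser_def
    by (intro sums_add sums_mult sums_sum summable_sums summable_zser summable_dzser) auto
qed

end

section \<open>Explicit coefficients in the even case\<close>

lemma fps_quartic_recurrence:
  fixes F G :: "complex fps"
  assumes "F * (1 + fps_X * fps_const p1 + fps_X^2 * fps_const p2 + fps_X^3 * fps_const p3 + fps_X^4 * fps_const p4) = G"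
  shows "fps_nth G n = fps_nth F n + (if n < 1 then 0 else p1 * fps_nth F (n - 1)) + (if n < 2 then 0 else p2 * fps_nth F (n - 2)) +
     (if n < 3 then 0 else p3 * fps_nth F (n - 3)) + (if n < 4 then 0 else p4 * fps_nth F (n - 4))"
proof -
  have "G = F + fps_X^1 * (fps_const p1 * F) + fps_X^2 * (fps_const p2 * F) + fps_X^3 * (fps_const p3 * F) + fps_X^4 * (fps_const p4 * F)"
    unfolding assms[symmetric] by (simp add: algebra_simps)
  then show ?thesis by (simp add: fps_X_power_mult_nth)
qed

context even_base begin

definition "Ih = inverse Ah"

lemma Ah_eq: "Ah = 1 + fps_X * fps_const e1 + fps_X^2 * fps_const e2 + fps_X^3 * fps_const e3 + fps_X^4 * fps_const e4"
  by (simp add: Ah_def qpoly_def)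

lemma Ih_Ah: "Ih * Ah = 1" unfolding Ih_def using Ah0 by (simp add: inverse_mult_eq_1)

lemma Sh_eq: "Sh = Ih + fps_X * (fps_const c * Ih)"
  unfolding Sh_def Nh_def Ih_def by (simp add: algebra_simps)

text \<open>Evenness collapses the numerator of \<open>Lh\<close> to
  \<open>- 2 a (1 + c a) (1 + 2 c a)\<close>. All coefficients in the double sums are thus read off
  from the single series \<open>Ih\<close>.\<close>

lemma Lh_eq: "Lh = fps_const (-2) * (fps_X ^ 1 * Sh + fps_X ^ 2 * (fps_const (2 * c) * Sh))"
proof -
  define C S T :: "complex fps" where d: "C = fps_const c" "S = fps_const s" "T = fps_const t"
  have E: "fps_const e1 = 4 * C" "fps_const e2 = 6 * C^2 + S" "fps_const e3 = 4 * C^3 + 2 * S * C"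
    unfolding e d by (simp_all add: numeral_fps_const fps_const_power[symmetric] fps_const_mult[symmetric] fps_const_add[symmetric]
       del: fps_const_power fps_const_mult fps_const_add)
  have r: "reflpt e1 1 = - 1 - 2 * fps_X * C" unfolding reflpt_def d e by simp
  have n: "fps_const (-2) = (-2 :: complex fps)" "fps_const (2 * c) = 2 * C"
    by (simp_all add: d numeral_fps_const fps_const_mult[symmetric] fps_const_neg[symmetric] del: fps_const_mult fps_const_neg)
  show ?thesis unfolding Lh_def Sh_def Nh_def dqpoly_def rqpoly_def E r n d(1)[symmetric] power_one mult_1_right by algebra
qed

lemma Fh_eq: "Fh = fps_X ^ 1 * (Sh - fps_const (1/2) * Ih) - fps_X ^ 5 * (fps_const e4 * (Sh * Ih))"
proof -
  \<comment> \<open>At the point 1 all powers of \<open>x\<close> are 1, so \<open>dqpoly\<close>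
    becomes \<open>- fps_X\<close> times the quartic without its last term.\<close>
  have a: "dqpoly e1 e2 e3 1 = - (fps_X * (Ah - fps_X ^ 4 * fps_const e4))"
    unfolding dqpoly_def Ah_eq by simp
  have n: "fps_const (- 1/2) = - fps_const (1/2 :: complex)" by simp
  show ?thesis unfolding Fh_def Sh_def a n Ih_def[symmetric] using Ih_Ah by algebra
qed

lemma Ih_nth:
  "fps_nth Ih 0 = 1" "fps_nth Ih 1 = - e1" "fps_nth Ih 2 = - e1 * fps_nth Ih 1 - e2"
  "fps_nth Ih 3 = - e1 * fps_nth Ih 2 - e2 * fps_nth Ih 1 - e3"
  "fps_nth Ih 4 = - e1 * fps_nth Ih 3 - e2 * fps_nth Ih 2 - e3 * fps_nth Ih 1 - e4"
  "fps_nth Ih 5 = - e1 * fps_nth Ih 4 - e2 * fps_nth Ih 3 - e3 * fps_nth Ih 2 - e4 * fps_nth Ih 1"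
proof -
  note r = fps_quartic_recurrence[OF Ih_Ah[unfolded Ah_eq]]
  show 0: "fps_nth Ih 0 = 1" using r[of 0] by simp
  show 1: "fps_nth Ih 1 = - e1" using r[of 1] 0 by (simp add: eq_neg_iff_add_eq_0)
  show "fps_nth Ih 2 = - e1 * fps_nth Ih 1 - e2" using r[of 2] 0 by (simp add: algebra_simps eq_neg_iff_add_eq_0)
  show "fps_nth Ih 3 = - e1 * fps_nth Ih 2 - e2 * fps_nth Ih 1 - e3" using r[of 3] 0 by (simp add: algebra_simps eq_neg_iff_add_eq_0)
  show "fps_nth Ih 4 = - e1 * fps_nth Ih 3 - e2 * fps_nth Ih 2 - e3 * fps_nth Ih 1 - e4" using r[of 4] 0 by (simp add: algebra_simps eq_neg_iff_add_eq_0)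
  show "fps_nth Ih 5 = - e1 * fps_nth Ih 4 - e2 * fps_nth Ih 3 - e3 * fps_nth Ih 2 - e4 * fps_nth Ih 1" using r[of 5] 0 by (simp add: algebra_simps eq_neg_iff_add_eq_0)
qed

lemma Sh_nth: "fps_nth Sh n = fps_nth Ih n + (if n = 0 then 0 else c * fps_nth Ih (n - 1))"
  unfolding Sh_eq by simp

lemma Lh_nth: "fps_nth Lh n = -2 * ((if n < 1 then 0 else fps_nth Sh (n - 1)) + (if n < 2 then 0 else 2 * c * fps_nth Sh (n - 2)))"
  unfolding Lh_eq by (auto simp: fps_X_power_mult_nth)

lemma Fh_nth: "fps_nth Fh 5 = fps_nth Sh 4 - fps_nth Ih 4 / 2 - e4"
   "fps_nth Fh 6 = fps_nth Sh 5 - fps_nth Ih 5 / 2 - e4 * (fps_nth Sh 1 + fps_nth Ih 1)"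
proof -
  have "fps_nth (Sh * Ih) 0 = 1" by (simp add: Sh_nth Ih_nth)
  then show "fps_nth Fh 5 = fps_nth Sh 4 - fps_nth Ih 4 / 2 - e4" unfolding Fh_eq by (simp add: fps_X_power_mult_nth)
  have "fps_nth (Sh * Ih) 1 = fps_nth Sh 1 + fps_nth Ih 1" by (simp add: fps_mult_nth Sh_nth[of 0] Ih_nth(1))
  then show "fps_nth Fh 6 = fps_nth Sh 5 - fps_nth Ih 5 / 2 - e4 * (fps_nth Sh 1 + fps_nth Ih 1)"
    unfolding Fh_eq by (simp add: fps_X_power_mult_nth)
qed

definition "evensum n = fps_nth Fh n * zser (n + 3) + (\<Sum>i<n. fps_nth Sh i * fps_nth Lh (n - i) * dzser (3 + i) (n - i))"

text \<open>The derivative equals \<open>b * e4\<close>, which is known to vanish here although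
  \<open>b\<close> itself is unknown.\<close>

lemma evensum_zero:
  assumes "n \<le> 6" "e4 = 0" shows "evensum n = 0"
proof -
  from pcoef_structure[OF assms(1), of e1 e2 e3 e4] obtain b where "(\<lambda>k. fps_nth (pder e1 e2 e3 e4 k) n) sums (b * e4)" by blast
  from sums_unique2[OF pder_sums[of n] this] show ?thesis unfolding evensum_def by (simp add: assms(2))
qed

lemmas nth_rules = Fh_nth Lh_nth Sh_nth Ih_nth Ih_nth(2)[unfolded One_nat_def]

end

text \<open>
  In the last three cases \<open>e4 = 0\<close>, so \<open>evensum\<close> vanishes there and yields linear relations between double zeta values of fixed weight.
  The multipliers in the next two lemmas are chosen so that all double zeta values but the stated ones cancel.
\<close>

interpretation B0: even_base 2 1 4 8 25 36 24 by unfold_locales simp_all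
interpretation B1: even_base 1 "-1" 0 4 5 2 0 by unfold_locales simp_all
interpretation B2: even_base 1 0 "-1" 4 6 4 0 by unfold_locales simp_all
interpretation B3: even_base 1 1 "-2" 4 7 6 0 by unfold_locales simp_all

lemma sum_less_5: "(\<Sum>i<5. f i) = f 0 + f 1 + f 2 + f 3 + f (4 :: nat)" for f :: "nat \<Rightarrow> complex"
  by (simp add: eval_nat_numeral)

lemma sum_less_6: "(\<Sum>i<6. f i) = f 0 + f 1 + f 2 + f 3 + f 4 + f (5 :: nat)" for f :: "nat \<Rightarrow> complex"
  by (simp add: eval_nat_numeral)

lemma evensum_5: "B0.evensum 5 = - 24 * zser 8 - 48 * dzser 5 3"
proof -
  have "B1.evensum 5 = 0" "B2.evensum 5 = 0" "B3.evensum 5 = 0" by (rule B1.evensum_zero B2.evensum_zero B3.evensum_zero; simp)+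
  then have "B0.evensum 5 = B0.evensum 5 + 27/2 * B1.evensum 5 - 39 * B2.evensum 5 + 19/2 * B3.evensum 5" by simp
  also have "\<dots> = - 24 * zser 8 - 48 * dzser 5 3"
    unfolding B0.evensum_def B1.evensum_def B2.evensum_def B3.evensum_def
    by (simp add: sum_less_5 sum_less_6 B0.nth_rules B1.nth_rules B2.nth_rules B3.nth_rules algebra_simps del: One_nat_def)
  finally show ?thesis .
qed

lemma evensum_6: "B0.evensum 6 = 1968 * zser 9 - 1440 * (zser 4 * zser 5)"
proof -
  have "B1.evensum 6 = 0" "B2.evensum 6 = 0" "B3.evensum 6 = 0" by (rule B1.evensum_zero B2.evensum_zero B3.evensum_zero; simp)+
  then have "B0.evensum 6 = B0.evensum 6 + 21 * B1.evensum 6 - 72 * B2.evensum 6 + 49 * B3.evensum 6" by simp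
  also have "\<dots> = 528 * zser 9 - 1440 * (dzser 4 5 + dzser 5 4)"
    unfolding B0.evensum_def B1.evensum_def B2.evensum_def B3.evensum_def
    by (simp add: sum_less_5 sum_less_6 B0.nth_rules B1.nth_rules B2.nth_rules B3.nth_rules algebra_simps del: One_nat_def)
  \<comment> \<open>In weight 9 the surviving double values form a stuffle pair and reduce to
    products; in weight 8 the value \<open>dzser 5 3\<close> remains.\<close>
  also have "\<dots> = 1968 * zser 9 - 1440 * (zser 4 * zser 5)"
    using stuffle[of 4 5] by (simp add: algebra_simps)
  finally show ?thesis .
qed

section \<open>The coefficients at \<open>X = 0\<close> and \<open>X = 2\<close>\<close>

text \<open>The Euler derivation is used instead of \<open>fps_deriv\<close> because it commutes
  with \<open>fscale\<close>.\<close>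

definition Xder :: "complex fps \<Rightarrow> complex fps" where "Xder F = fps_X * fps_deriv F"

lemma Xder_nth: "fps_nth (Xder F) n = of_nat n * fps_nth F n"
  by (cases n) (simp_all add: Xder_def)

lemma Xder_mult: "Xder (F * G) = Xder F * G + F * Xder G"
  by (simp add: Xder_def algebra_simps)

lemma Xder_1: "Xder 1 = 0" by (simp add: Xder_def)

lemma Xder_fscale: "Xder (fscale m F) = fscale m (Xder F)"
  by (simp add: fps_eq_iff Xder_nth fscale_nth)

text \<open>
  Newton's identities for an infinite product: \<open>q\<close> is the logarithmic derivative of \<open>r\<close>, whose power sums over all
  scalings are zeta values.
\<close>

lemma fscale_prod_limit:
  assumes r0: "fps_nth r 0 = 1" and q: "Xder r = r * q" and low: "\<And>i. i < 2 \<Longrightarrow> fps_nth q i = 0"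
  shows "\<exists>h. h 0 = 1 \<and> (\<forall>n. (\<lambda>K. fps_nth (\<Prod>j<K. fscale (of_nat (Suc j)) r) n) \<longlonglongrightarrow> h n) \<and>
     (\<forall>n. of_nat n * h n = (\<Sum>i=2..n. fps_nth q i * zser i * h (n - i)))"
proof -
  define H where "H K = (\<Prod>j<K. fscale (of_nat (Suc j)) r)" for K
  define p where "p i K = (\<Sum>j<K. 1 / of_nat (Suc j) ^ i :: complex)" for i K
  have D: "Xder (H K) = H K * (\<Sum>j<K. fscale (of_nat (Suc j)) q)" for K
    by (induction K) (simp_all add: H_def Xder_1 Xder_mult Xder_fscale q fscale_mult algebra_simps)
  have rec: "of_nat n * fps_nth (H K) n = (\<Sum>i=2..n. fps_nth q i * p i K * fps_nth (H K) (n - i))" for n K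
  proof -
    have "fps_nth (\<Sum>j<K. fscale (of_nat (Suc j)) q) i = fps_nth q i * p i K" for i
      by (simp add: fps_sum_nth fscale_nth p_def sum_distrib_left)
    then have "of_nat n * fps_nth (H K) n = (\<Sum>i=0..n. fps_nth q i * p i K * fps_nth (H K) (n - i))"
      unfolding Xder_nth[symmetric] D by (subst mult.commute) (simp add: fps_mult_nth)
    also have "\<dots> = (\<Sum>i=2..n. fps_nth q i * p i K * fps_nth (H K) (n - i))"
      by (rule sum.mono_neutral_right) (auto simp: low)
    finally show ?thesis .
  qed
  have H0: "fps_nth (H K) 0 = 1" for K by (induction K) (simp_all add: H_def fscale_nth r0)
  have pl: "p i \<longlonglongrightarrow> zser i" if "i \<ge> 2" for i
    unfolding p_def zser_def by (rule summable_LIMSEQ[OF summable_zser[OF that]])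
  have conv: "convergent (\<lambda>K. fps_nth (H K) n)" for n
  proof (induction n rule: less_induct)
    case (less n)
    show ?case
    proof (cases "n = 0")
      case False
      have "fps_nth (H K) n = (\<Sum>i=2..n. fps_nth q i * p i K * fps_nth (H K) (n - i)) * inverse (of_nat n)" for K
        using rec[of n K] False by (simp add: field_simps)
      moreover have "convergent (\<lambda>K. (\<Sum>i=2..n. fps_nth q i * p i K * fps_nth (H K) (n - i)) * inverse (of_nat n))"
        using pl less False by (intro convergent_mult convergent_sum convergent_const) (auto simp: convergent_def)
      ultimately show ?thesis by simp
    qed (simp add: H0 convergent_const)
  qed
  define h where "h n = lim (\<lambda>K. fps_nth (H K) n)" for n
  have hl: "(\<lambda>K. fps_nth (H K) n) \<longlonglongrightarrow> h n" for n unfolding h_def using conv by (simp add: convergent_LIMSEQ_iff)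
  have "of_nat n * h n = (\<Sum>i=2..n. fps_nth q i * zser i * h (n - i))" for n
  proof (rule LIMSEQ_unique)
    show "(\<lambda>K. of_nat n * fps_nth (H K) n) \<longlonglongrightarrow> of_nat n * h n" by (intro tendsto_intros hl)
    show "(\<lambda>K. of_nat n * fps_nth (H K) n) \<longlonglongrightarrow> (\<Sum>i=2..n. fps_nth q i * zser i * h (n - i))"
      unfolding rec by (intro tendsto_intros hl pl) auto
  qed
  moreover have "h 0 = 1" using LIMSEQ_unique[OF hl[of 0]] by (simp add: H0)
  ultimately show ?thesis using hl unfolding H_def by blast
qed

section \<open>The telescoping product for (8, 25, 38, 28)\<close>

definition Ap :: "complex fps" where "Ap = qf 8 25 38 28 1"
definition Bp :: "complex fps" where "Bp = qf 8 25 38 28 (reflpt 8 1)"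

lemma fps_const_numerals: "fps_const (numeral k :: complex) = numeral k" by (simp add: numeral_fps_const)

lemma Ap_eq: "Ap = 1 + fps_X * fps_const 8 + fps_X^2 * fps_const 25 + fps_X^3 * fps_const 38 + fps_X^4 * fps_const 28"
  by (simp add: Ap_def qpoly_def)

lemma Bp_eq: "Bp = 1 + fps_X * fps_const 8 + fps_X^2 * fps_const 25 + fps_X^3 * fps_const 34 + fps_X^4 * fps_const 20"
proof -
  have "reflpt 8 1 = - 1 - 4 * fps_X" by (simp add: reflpt_def fps_const_numerals)
  then show ?thesis unfolding Bp_def qpoly_def fps_const_numerals by algebra
qed

lemma ApBp0: "fps_nth Ap 0 = 1" "fps_nth Bp 0 = 1" by (simp_all add: Ap_def Bp_def qpoly_nth0 reflpt_nth0)

lemma ratio_scale: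
  "qf 8 25 38 28 (reflpt 8 (Suc j)) * inverse (qf 8 25 38 28 (of_nat (Suc j))) = fscale (of_nat (Suc j)) (Bp * inverse Ap)"
proof -
  define M where "M = (of_nat (Suc j) ^ 4 :: complex)"
  have M: "fps_const M * inverse (fps_const M) = 1" unfolding M_def by (simp add: fps_const_inverse del: of_nat_Suc)
  have A: "qf 8 25 38 28 (of_nat (Suc j)) = fps_const M * fscale (of_nat (Suc j)) Ap"
    unfolding M_def Ap_def by (rule qf_of_nat_scale(1)) simp
  have B: "qf 8 25 38 28 (reflpt 8 (Suc j)) = fps_const M * fscale (of_nat (Suc j)) Bp"
    unfolding M_def Bp_def reflpt_scale[OF nat.distinct(2)] by (rule qf_scale(1)) (simp del: of_nat_Suc)
  have "qf 8 25 38 28 (reflpt 8 (Suc j)) * inverse (qf 8 25 38 28 (of_nat (Suc j))) =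
     (fps_const M * inverse (fps_const M)) * (fscale (of_nat (Suc j)) Bp * inverse (fscale (of_nat (Suc j)) Ap))"
    unfolding A B fps_inverse_mult by (simp only: mult_ac)
  then show ?thesis unfolding M using ApBp0 by (simp add: fscale_mult fscale_inverse)
qed

text \<open>
  The summand telescopes at \<open>X = 0\<close> because there the difference of the two quartics is \<open>4 a^3\<close> times the linear numerator.
\<close>

lemma telescoped_sum:
  "fps_const 4 * fps_X ^ 3 * (\<Sum>k<K. pfps 8 25 38 28 k 0) = 1 - (\<Prod>j<K. fscale (of_nat (Suc j)) (Bp * inverse Ap))"
proof (induction K)
  case (Suc K)
  define A where "A = qf 8 25 38 28 (of_nat (Suc K))"
  define B where "B = qf 8 25 38 28 (reflpt 8 (Suc K))"
  have r: "reflpt 8 m = - of_nat m - 2 * fps_X * 2" for m by (simp add: reflpt_def fps_const_numerals)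
  define R where "R = (\<Prod>j<K. fscale (of_nat (Suc j)) (Bp * inverse Ap))"
  have "fps_nth A 0 \<noteq> 0" unfolding A_def qpoly_nth0 by (simp del: of_nat_Suc)
  then have A1: "A * inverse A = 1" by (rule inverse_mult_eq_1')
  have p: "pfps 8 25 38 28 K 0 = (of_nat (Suc K) + fps_X * 2) * inverse A * R"
    unfolding pfps_def gsummand_def R_def A_def ratio_scale[symmetric] by (simp add: fps_const_numerals r)
  have AB: "A - B = 4 * fps_X ^ 3 * (of_nat (Suc K) + fps_X * 2)"
    unfolding A_def B_def r qpoly_def fps_const_numerals by algebra
  have "fps_const 4 * fps_X ^ 3 * (\<Sum>k<Suc K. pfps 8 25 38 28 k 0) = 1 - R + (A - B) * inverse A * R"
    using Suc.IH unfolding R_def[symmetric] AB by (simp add: distrib_left p fps_const_numerals mult.assoc)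
  also have "\<dots> = 1 - R * (B * inverse A)" using A1 by algebra
  also have "B * inverse A = fscale (of_nat (Suc K)) (Bp * inverse Ap)" unfolding A_def B_def by (rule ratio_scale)
  finally show ?case unfolding R_def by simp
qed simp

text \<open>For \<open>n \<ge> 1\<close> the \<open>n\<close>-th coefficient is, up to the sign
  \<open>(-1)^(n-1)\<close>, the \<open>n\<close>-th power sum of the \<open>yi\<close> when the
  quartic is written as a product of factors \<open>1 + yi X\<close>.\<close>

definition UA :: "complex fps" where "UA = Xder Ap * inverse Ap"
definition UB :: "complex fps" where "UB = Xder Bp * inverse Bp"

lemma UAB: "Xder (Bp * inverse Ap) = (Bp * inverse Ap) * (UB - UA)"
proof -
  have a: "Ap * inverse Ap = 1" "Bp * inverse Bp = 1" using ApBp0 by (simp_all add: inverse_mult_eq_1')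
  have "Xder (Ap * inverse Ap) = 0" unfolding a Xder_1 ..
  then have "Xder Ap * inverse Ap + Ap * Xder (inverse Ap) = 0" unfolding Xder_mult .
  then show ?thesis unfolding Xder_mult UA_def UB_def using a by algebra
qed

lemma quartic_nth: "fps_nth (1 + fps_X * fps_const p1 + fps_X^2 * fps_const p2 + fps_X^3 * fps_const p3 + fps_X^4 * fps_const p4) n =
   (if n = 0 then 1 else if n = 1 then p1 else if n = 2 then p2 else if n = 3 then p3 else if n = 4 then p4 else (0 :: complex))"
  by (auto simp: fps_X_power_nth)

lemma U_recurrence:
  assumes "P = 1 + fps_X * fps_const p1 + fps_X^2 * fps_const p2 + fps_X^3 * fps_const p3 + fps_X^4 * fps_const (p4 :: complex)"
  defines "U \<equiv> Xder P * inverse P"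
  shows "fps_nth U n = of_nat n * (if n = 0 then 1 else if n = 1 then p1 else if n = 2 then p2 else if n = 3 then p3 else if n = 4 then p4 else 0)
     - ((if n < 1 then 0 else p1 * fps_nth U (n - 1)) + (if n < 2 then 0 else p2 * fps_nth U (n - 2)) +
     (if n < 3 then 0 else p3 * fps_nth U (n - 3)) + (if n < 4 then 0 else p4 * fps_nth U (n - 4)))"
proof -
  have "fps_nth P 0 = 1" unfolding assms(1) quartic_nth by simp
  then have "U * P = Xder P" unfolding U_def by (simp add: mult.assoc inverse_mult_eq_1)
  from fps_quartic_recurrence[OF this[unfolded assms(1)], of n] show ?thesis
    unfolding Xder_nth quartic_nth by (simp add: algebra_simps)
qed

text \<open>The quartics \<open>Ap\<close> and \<open>Bp\<close> agree up to \<open>X^2\<close>, so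
  the difference of power sums starts in order 3. This secures the order 2 asked for in
  \<open>fscale_prod_limit\<close>, which keeps the harmonic series out.\<close>

lemma UA_nth: "fps_nth (UB - UA) 0 = 0" "fps_nth (UB - UA) 1 = 0" "fps_nth (UB - UA) 2 = 0" "fps_nth (UB - UA) 3 = -12" "fps_nth (UB - UA) 4 = 96"
  "fps_nth (UB - UA) 5 = -460" "fps_nth (UB - UA) 6 = 1680" "fps_nth (UB - UA) 7 = -4956" "fps_nth (UB - UA) 8 = 11200" "fps_nth (UB - UA) 9 = -12396"
proof -
  note a = U_recurrence[OF Ap_eq, folded UA_def]
  note b = U_recurrence[OF Bp_eq, folded UB_def]
  have a0: "fps_nth UA 0 = 0" "fps_nth UB 0 = 0" by (subst a b; simp)+
  have a1: "fps_nth UA (Suc 0) = 8" "fps_nth UB (Suc 0) = 8" by (subst a b; simp add: a0)+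
  have a2: "fps_nth UA 2 = -14" "fps_nth UB 2 = -14" by (subst a b; simp add: a0 a1)+
  have a3: "fps_nth UA 3 = 26" "fps_nth UB 3 = 14" by (subst a b; simp add: a0 a1 a2)+
  have a4: "fps_nth UA 4 = -50" "fps_nth UB 4 = 46" by (subst a b; simp add: a0 a1 a2 a3)+
  have a5: "fps_nth UA 5 = 58" "fps_nth UB 5 = -402" by (subst a b; simp add: a0 a1 a2 a3 a4)+
  have a6: "fps_nth UA 6 = 190" "fps_nth UB 6 = 1870" by (subst a b; simp add: a0 a1 a2 a3 a4 a5)+
  have a7: "fps_nth UA 7 = -1798" "fps_nth UB 7 = -6754" by (subst a b; simp add: a0 a1 a2 a3 a4 a5 a6)+
  have a8: "fps_nth UA 8 = 8830" "fps_nth UB 8 = 20030" by (subst a b; simp add: a0 a1 a2 a3 a4 a5 a6 a7)+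
  have a9: "fps_nth UA 9 = -34534" "fps_nth UB 9 = -46930" by (subst a b; simp add: a0 a1 a2 a3 a4 a5 a6 a7 a8)+
  show "fps_nth (UB - UA) 0 = 0" "fps_nth (UB - UA) 1 = 0" "fps_nth (UB - UA) 2 = 0" "fps_nth (UB - UA) 3 = -12" "fps_nth (UB - UA) 4 = 96"
    "fps_nth (UB - UA) 5 = -460" "fps_nth (UB - UA) 6 = 1680"  "fps_nth (UB - UA) 7 = -4956" "fps_nth (UB - UA) 8 = 11200" "fps_nth (UB - UA) 9 = -12396"
    by (simp_all add: a0 a1 a2 a3 a4 a5 a6 a7 a8 a9)
qed

text \<open>By \<open>telescoped_sum\<close>, coefficient \<open>n\<close> is
  \<open>- h (n + 3) / 4\<close> for the coefficients \<open>h\<close> of the infinite product, the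
  shift by 3 coming from the factor \<open>4 X^3\<close>. The values of \<open>h\<close> follow from
  Newton's recursion.\<close>

theorem pcoef_at_0:
  "pcoef 8 25 38 28 0 0 = zser 3"
  "pcoef 8 25 38 28 0 1 = - 6 * zser 4"
  "pcoef 8 25 38 28 0 2 = 23 * zser 5"
  "pcoef 8 25 38 28 0 3 = - 70 * zser 6 - 2 * zser 3 ^ 2"
  "pcoef 8 25 38 28 0 4 = 177 * zser 7 + 24 * zser 3 * zser 4"
  "pcoef 8 25 38 28 0 5 = - 350 * zser 8 - 92 * zser 3 * zser 5 - 72 * zser 4 ^ 2"
  "pcoef 8 25 38 28 0 6 = 1033/3 * zser 9 + 280 * zser 3 * zser 6 + 552 * zser 4 * zser 5 + 8/3 * zser 3 ^ 3"
proof -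
  have low: "fps_nth (UB - UA) i = 0" if "i < 2" for i
    using that UA_nth(1,2) by (cases i) (auto simp: less_Suc_eq)
  obtain h where h: "h 0 = 1" "\<And>n. (\<lambda>K. fps_nth (\<Prod>j<K. fscale (of_nat (Suc j)) (Bp * inverse Ap)) n) \<longlonglongrightarrow> h n"
     "\<And>n. of_nat n * h n = (\<Sum>i=2..n. fps_nth (UB - UA) i * zser i * h (n - i))"
    using fscale_prod_limit[of "Bp * inverse Ap" "UB - UA", OF _ UAB low] ApBp0 by auto
  have p: "pcoef 8 25 38 28 0 n = - h (n + 3) / 4" for n
  proof -
    have "(\<Sum>k<K. fps_nth (pfps 8 25 38 28 k 0) n) = - fps_nth (\<Prod>j<K. fscale (of_nat (Suc j)) (Bp * inverse Ap)) (n + 3) / 4" for K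
    proof -
      have "fps_nth (fps_const 4 * fps_X ^ 3 * (\<Sum>k<K. pfps 8 25 38 28 k 0)) (n + 3) = 4 * (\<Sum>k<K. fps_nth (pfps 8 25 38 28 k 0) n)"
        by (simp only: mult.assoc fps_mult_left_const_nth fps_X_power_mult_nth fps_sum_nth) simp
      moreover have "fps_nth (1 - (\<Prod>j<K. fscale (of_nat (Suc j)) (Bp * inverse Ap))) (n + 3) =
          - fps_nth (\<Prod>j<K. fscale (of_nat (Suc j)) (Bp * inverse Ap)) (n + 3)" by simp
      ultimately show ?thesis unfolding telescoped_sum by simp
    qed
    moreover have "(\<lambda>K. - fps_nth (\<Prod>j<K. fscale (of_nat (Suc j)) (Bp * inverse Ap)) (n + 3) / 4) \<longlonglongrightarrow> - h (n + 3) / 4"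
      by (intro tendsto_intros h(2)) simp
    ultimately have "(\<lambda>k. fps_nth (pfps 8 25 38 28 k 0) n) sums (- h (n + 3) / 4)" unfolding sums_def by simp
    then show ?thesis using pfps_sums sums_unique2 by blast
  qed
  define q where "q = UB - UA"
  note hq = h(3)[folded q_def] and qn = UA_nth[folded q_def]
  have S2: "(\<Sum>i=2..2. f i) = f 2" and S3: "(\<Sum>i=2..3. f i) = f 2 + f 3" and S4: "(\<Sum>i=2..4. f i) = f 2 + f 3 + f 4"
    and S5: "(\<Sum>i=2..5. f i) = f 2 + f 3 + f 4 + f 5" and S6: "(\<Sum>i=2..6. f i) = f 2 + f 3 + f 4 + f 5 + f 6"
    and S7: "(\<Sum>i=2..7. f i) = f 2 + f 3 + f 4 + f 5 + f 6 + f 7" and S8: "(\<Sum>i=2..8. f i) = f 2 + f 3 + f 4 + f 5 + f 6 + f 7 + f 8"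
    and S9: "(\<Sum>i=2..9. f i) = f 2 + f 3 + f 4 + f 5 + f 6 + f 7 + f 8 + f 9" for f :: "nat \<Rightarrow> complex"
    by (simp_all add: eval_nat_numeral)
  have h1: "h (Suc 0) = 0" using hq[of 1] by simp
  have h2: "h 2 = 0" using hq[of 2] by (simp add: qn)
  have h3: "h 3 = - 4 * zser 3" using hq[of 3] unfolding S3 by (simp add: qn h(1) h1 h2)
  have h4: "h 4 = 24 * zser 4" using hq[of 4] unfolding S4 by (simp add: qn h(1) h1 h2)
  have h5: "h 5 = - 92 * zser 5" using hq[of 5] unfolding S5 by (simp add: qn h(1) h1 h2)
  have h6: "h 6 = 280 * zser 6 + 8 * zser 3 ^ 2"
  proof -
    have "6 * h 6 = 6 * (280 * zser 6 + 8 * zser 3 ^ 2)"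
      using hq[of 6] unfolding S6 by (simp add: qn h(1) h1 h2 h3 power2_eq_square algebra_simps)
    then show ?thesis by (simp only: mult_cancel_left) simp
  qed
  have h7: "h 7 = - 708 * zser 7 - 96 * zser 3 * zser 4"
  proof -
    have "7 * h 7 = 7 * (- 708 * zser 7 - 96 * zser 3 * zser 4)"
      using hq[of 7] unfolding S7 by (simp add: qn h(1) h1 h2 h3 h4 algebra_simps)
    then show ?thesis by (simp only: mult_cancel_left) simp
  qed
  have h8: "h 8 = 1400 * zser 8 + 368 * zser 3 * zser 5 + 288 * zser 4 ^ 2"
  proof -
    have "8 * h 8 = 8 * (1400 * zser 8 + 368 * zser 3 * zser 5 + 288 * zser 4 ^ 2)"
      using hq[of 8] unfolding S8 by (simp add: qn h(1) h1 h2 h3 h4 h5 power2_eq_square algebra_simps)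
    then show ?thesis by (simp only: mult_cancel_left) simp
  qed
  have h9: "h 9 = - (4132/3) * zser 9 - 1120 * zser 3 * zser 6 - 2208 * zser 4 * zser 5 - 32/3 * zser 3 ^ 3"
  proof -
    have "9 * h 9 = 9 * (- (4132/3) * zser 9 - 1120 * zser 3 * zser 6 - 2208 * zser 4 * zser 5 - 32/3 * zser 3 ^ 3)"
      using hq[of 9] unfolding S9 by (simp add: qn h(1) h1 h2 h3 h4 h5 h6 power2_eq_square power3_eq_cube algebra_simps)
    then show ?thesis by (simp only: mult_cancel_left) simp
  qed
  show "pcoef 8 25 38 28 0 0 = zser 3"
    "pcoef 8 25 38 28 0 1 = - 6 * zser 4"
    "pcoef 8 25 38 28 0 2 = 23 * zser 5"
    "pcoef 8 25 38 28 0 3 = - 70 * zser 6 - 2 * zser 3 ^ 2"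
    "pcoef 8 25 38 28 0 4 = 177 * zser 7 + 24 * zser 3 * zser 4"
    "pcoef 8 25 38 28 0 5 = - 350 * zser 8 - 92 * zser 3 * zser 5 - 72 * zser 4 ^ 2"
    "pcoef 8 25 38 28 0 6 = 1033/3 * zser 9 + 280 * zser 3 * zser 6 + 552 * zser 4 * zser 5 + 8/3 * zser 3 ^ 3"
    unfolding p by (simp_all add: h3 h4 h5 h6 h7 h8 h9 field_simps)
qed

theorem pcoef_at_2:
  "pcoef 8 25 38 28 2 0 = zser 3"
  "pcoef 8 25 38 28 2 1 = - 6 * zser 4"
  "pcoef 8 25 38 28 2 2 = 23 * zser 5"
  "pcoef 8 25 38 28 2 3 = - 70 * zser 6 - 2 * zser 3 ^ 2"
  "pcoef 8 25 38 28 2 4 = 177 * zser 7 + 24 * zser 3 * zser 4"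
  "pcoef 8 25 38 28 2 5 = - 358 * zser 8 - 92 * zser 3 * zser 5 - 72 * zser 4 ^ 2 - 16 * dzser 5 3"
  "pcoef 8 25 38 28 2 6 = 3001/3 * zser 9 + 280 * zser 3 * zser 6 + 72 * zser 4 * zser 5 + 8/3 * zser 3 ^ 3"
proof -
  show "pcoef 8 25 38 28 2 0 = zser 3"
  "pcoef 8 25 38 28 2 1 = - 6 * zser 4"
  "pcoef 8 25 38 28 2 2 = 23 * zser 5"
  "pcoef 8 25 38 28 2 3 = - 70 * zser 6 - 2 * zser 3 ^ 2"
  "pcoef 8 25 38 28 2 4 = 177 * zser 7 + 24 * zser 3 * zser 4"
    using pcoef_at_0(1-5) by (simp_all add: pcoef_low)
  have "\<exists>b. pcoef 8 25 38 28 2 n = pcoef 8 25 38 28 0 n + 8 * b \<and> B0.evensum n = 24 * b" if "n \<in> {5, 6}" for n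
    using pcoef_link[OF that] B0.pder_sums[of n] sums_unique2 unfolding B0.evensum_def by blast
  then obtain b5 b6 where b: "pcoef 8 25 38 28 2 5 = pcoef 8 25 38 28 0 5 + 8 * b5" "B0.evensum 5 = 24 * b5"
     "pcoef 8 25 38 28 2 6 = pcoef 8 25 38 28 0 6 + 8 * b6" "B0.evensum 6 = 24 * b6" by blast
  \<comment> \<open>The correction \<open>8 b\<close> is one third of \<open>evensum\<close>, since
    the latter is \<open>24 b\<close>.\<close>
  have "3 * (8 * b5) = 3 * (- 8 * zser 8 - 16 * dzser 5 3)" using b(2) unfolding evensum_5 by (simp add: algebra_simps)
  then have "8 * b5 = - 8 * zser 8 - 16 * dzser 5 3" by (simp only: mult_cancel_left) simp
  then show "pcoef 8 25 38 28 2 5 = - 358 * zser 8 - 92 * zser 3 * zser 5 - 72 * zser 4 ^ 2 - 16 * dzser 5 3"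
    unfolding b(1) pcoef_at_0 by simp
  have "3 * (8 * b6) = 3 * (656 * zser 9 - 480 * (zser 4 * zser 5))" using b(4) unfolding evensum_6 by (simp add: algebra_simps)
  then have "8 * b6 = 656 * zser 9 - 480 * (zser 4 * zser 5)" by (simp only: mult_cancel_left) simp
  then show "pcoef 8 25 38 28 2 6 = 3001/3 * zser 9 + 280 * zser 3 * zser 6 + 72 * zser 4 * zser 5 + 8/3 * zser 3 ^ 3"
    unfolding b(3) pcoef_at_0 by simp
qed

section \<open>The Gamma quotient and even zeta values\<close>

lemma Polygamma_1_eq:
  assumes "n > 0" shows "Polygamma n (1 :: complex) / fact n = (-1) ^ Suc n * zser (Suc n)"
proof -
  have "(\<lambda>k. inverse ((1 + of_nat k) ^ Suc n) :: complex) sums ((-1) ^ Suc n * Polygamma n 1 / fact n)"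
    by (rule Polygamma_LIMSEQ) (use assms in auto)
  then have "zser (Suc n) = (-1) ^ Suc n * Polygamma n 1 / fact n"
    unfolding zser_def by (simp add: sums_iff inverse_eq_divide)
  then have "(-1) ^ Suc n * zser (Suc n) = ((-1) ^ Suc n * (-1) ^ Suc n) * (Polygamma n 1 / fact n)" by simp
  also have "(-1) ^ Suc n * (-1) ^ Suc n = (1 :: complex)" by (simp flip: power_mult_distrib)
  finally show ?thesis by simp
qed

text \<open>The constant coefficient, minus the Euler-Mascheroni constant, is left unevaluated: it
  cancels in both differences of digamma functions formed below.\<close>

lemma Digamma_expansion:
  "(\<lambda>x. Digamma (1 + c * x) :: complex) has_fps_expansion Abs_fps (\<lambda>n. c ^ n * (Polygamma n 1 / fact n))"
proof -
  have "(\<lambda>x. Digamma (1 + x) :: complex) has_fps_expansion fps_expansion Digamma 1"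
    by (intro analytic_at_imp_has_fps_expansion analytic_on_Polygamma) auto
  also have "fps_expansion Digamma 1 = Abs_fps (\<lambda>n. Polygamma n 1 / fact n :: complex)"
    unfolding fps_expansion_def by (subst higher_deriv_Polygamma) auto
  finally have 1: "(\<lambda>x. Digamma (1 + x) :: complex) has_fps_expansion Abs_fps (\<lambda>n. Polygamma n 1 / fact n)" .
  have "(\<lambda>x. c * x) has_fps_expansion fps_const c * fps_X" by (intro fps_expansion_intros)
  from has_fps_expansion_compose[OF 1 this] show ?thesis
    by (simp add: o_def fps_compose_linear)
qed

lemma fps_logderiv:
  fixes f D :: "complex \<Rightarrow> complex"
  assumes "f has_fps_expansion F" "D has_fps_expansion G"
    "eventually (\<lambda>x. (f has_field_derivative f x * D x) (at x)) (nhds 0)"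
  shows "fps_deriv F = F * G"
proof -
  have "deriv f has_fps_expansion fps_deriv F" by (intro fps_expansion_intros assms)
  moreover have "(\<lambda>x. f x * D x) has_fps_expansion F * G" by (intro fps_expansion_intros assms)
  moreover have "eventually (\<lambda>x. deriv f x = f x * D x) (nhds 0)"
    using assms(3) by eventually_elim (rule DERIV_imp_deriv)
  ultimately show ?thesis using fps_expansion_unique_complex has_fps_expansion_cong by metis
qed

lemma not_nonpos_Int_near_1:
  fixes z :: complex assumes "cmod z < 1" shows "1 + z \<notin> \<int>\<^sub>\<le>\<^sub>0"
proof
  assume "1 + z \<in> \<int>\<^sub>\<le>\<^sub>0"
  then obtain n where "1 + z = - of_nat n" by (auto elim!: nonpos_Ints_cases')
  then have "z = - of_nat (Suc n)" by (simp add: algebra_simps eq_neg_iff_add_eq_0)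
  then have "cmod z = real (Suc n)" by (metis norm_minus_cancel norm_of_nat)
  with assms show False by simp
qed

lemma eventually_small: "r > 0 \<Longrightarrow> eventually (\<lambda>x::complex. cmod x < r) (nhds 0)"
  using eventually_nhds_in_open[of "ball 0 r" "0::complex"] by simp

lemma eventually_half: "eventually (\<lambda>x::complex. cmod x < 1/2) (nhds 0)"
  and eventually_one: "eventually (\<lambda>x::complex. cmod x < 1) (nhds 0)"
  by (rule eventually_small; simp)+

definition gratio :: "complex \<Rightarrow> complex" where "gratio a = Gamma (1 + a) ^ 4 / Gamma (1 + 2 * a) ^ 2"

lemma gratio_holomorphic: "gratio holomorphic_on ball 0 (1/2)"
  unfolding gratio_def
proof (intro holomorphic_intros)
  fix a :: complex assume "a \<in> ball 0 (1/2)"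
  then show "1 + a \<notin> \<int>\<^sub>\<le>\<^sub>0" "1 + 2 * a \<notin> \<int>\<^sub>\<le>\<^sub>0" by (auto intro!: not_nonpos_Int_near_1 simp: norm_mult)
  then show "Gamma (1 + 2 * a) ^ 2 \<noteq> 0" by (simp add: Gamma_eq_zero_iff)
qed

lemma gratio_expansion: "gratio has_fps_expansion fps_expansion gratio 0"
  by (rule has_fps_expansion_fps_expansion[OF _ _ gratio_holomorphic]) auto

text \<open>The logarithmic derivative \<open>4 \<psi>(1 + a) - 4 \<psi>(1 + 2 a)\<close> has
  explicit zeta coefficients, and \<open>P' = P G\<close> determines \<open>P\<close>
  recursively.\<close>

lemma gratio_coeffs:
  defines "P \<equiv> fps_expansion gratio 0"
  shows "fps_nth P 0 = 1" "fps_nth P 1 = 0" "fps_nth P 2 = - 2 * zser 2" "fps_nth P 3 = 4 * zser 3"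
    "fps_nth P 4 = - 7 * zser 4 + 2 * zser 2 ^ 2" "fps_nth P 5 = 12 * zser 5 - 8 * zser 2 * zser 3"
    "fps_nth P 6 = - 62/3 * zser 6 + 14 * zser 2 * zser 4 + 8 * zser 3 ^ 2 - 4/3 * zser 2 ^ 3"
proof -
  define G where "G = Abs_fps (\<lambda>n. if n = 0 then 0 else 4 * (1 - 2 ^ n) * ((-1) ^ Suc n * zser (Suc n)))"
  have "(\<lambda>x::complex. 4 * Digamma (1 + 1 * x) - 4 * Digamma (1 + 2 * x)) has_fps_expansion
     fps_const 4 * Abs_fps (\<lambda>n. 1 ^ n * (Polygamma n (1::complex) / fact n)) - fps_const 4 * Abs_fps (\<lambda>n. 2 ^ n * (Polygamma n (1::complex) / fact n))"
    by (intro fps_expansion_intros Digamma_expansion)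
  moreover have "fps_const 4 * Abs_fps (\<lambda>n. 1 ^ n * (Polygamma n (1::complex) / fact n)) - fps_const 4 * Abs_fps (\<lambda>n. 2 ^ n * (Polygamma n (1::complex) / fact n)) = G"
  proof (rule fps_ext)
    fix n show "fps_nth (fps_const 4 * Abs_fps (\<lambda>n. 1 ^ n * (Polygamma n (1::complex) / fact n)) - fps_const 4 * Abs_fps (\<lambda>n. 2 ^ n * (Polygamma n (1::complex) / fact n))) n = fps_nth G n"
    proof (cases "n = 0")
      case False
      then have n: "n > 0" by simp
      show ?thesis unfolding G_def fps_sub_nth fps_mult_left_const_nth fps_nth_Abs_fps Polygamma_1_eq[OF n]
        using False by (simp add: algebra_simps)
    qed (simp add: G_def)
  qed
  ultimately have G: "(\<lambda>x::complex. 4 * Digamma (1 + 1 * x) - 4 * Digamma (1 + 2 * x)) has_fps_expansion G" by simp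
  have "fps_deriv P = P * G" unfolding P_def
  proof (rule fps_logderiv[OF gratio_expansion G])
    show "eventually (\<lambda>x. (gratio has_field_derivative gratio x * (4 * Digamma (1 + 1 * x) - 4 * Digamma (1 + 2 * x))) (at x)) (nhds 0)"
      using eventually_half
    proof (eventually_elim, goal_cases)
      case (1 x)
      have a: "1 + x \<notin> \<int>\<^sub>\<le>\<^sub>0" "1 + 2 * x \<notin> \<int>\<^sub>\<le>\<^sub>0" using 1 by (auto intro!: not_nonpos_Int_near_1 simp: norm_mult)
      then have nz: "Gamma (1 + x) \<noteq> 0" "Gamma (1 + 2 * x) \<noteq> 0" by (simp_all add: Gamma_eq_zero_iff)
      have "((\<lambda>x. Gamma (1 + x) ^ 4 / Gamma (1 + 2 * x) ^ 2) has_field_derivative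
        (Gamma (1 + x) ^ 4 / Gamma (1 + 2 * x) ^ 2) * (4 * Digamma (1 + 1 * x) - 4 * Digamma (1 + 2 * x))) (at x)"
        by (rule derivative_eq_intros refl a nz power_not_zero | simp add: a)+
           (use nz in \<open>simp add: field_simps power2_eq_square power3_eq_cube power4_eq_xxxx\<close>)
      then show ?case unfolding gratio_def[abs_def] .
    qed
  qed
  then have "fps_nth (fps_deriv P) n = fps_nth (P * G) n" for n by simp
  then have r: "of_nat (Suc n) * fps_nth P (Suc n) = (\<Sum>i=0..n. fps_nth P i * fps_nth G (n - i))" for n
    by (simp add: fps_mult_nth)
  have G0: "fps_nth G 0 = 0" "fps_nth G (Suc 0) = - 4 * zser 2" "fps_nth G 2 = 12 * zser 3" "fps_nth G 3 = - 28 * zser 4" "fps_nth G 4 = 60 * zser 5" "fps_nth G 5 = - 124 * zser 6"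
    by (simp_all add: G_def eval_nat_numeral)
  show p0: "fps_nth P 0 = 1" unfolding P_def fps_expansion_def by (simp add: gratio_def)
  show p1: "fps_nth P 1 = 0" using r[of 0] by (simp add: G0 p0)
  have p1': "fps_nth P (Suc 0) = 0" using p1 by simp
  have S1: "(\<Sum>i=0..1. f i) = f 0 + f (Suc 0)" and S2: "(\<Sum>i=0..2. f i) = f 0 + f (Suc 0) + f 2" and S3: "(\<Sum>i=0..3. f i) = f 0 + f (Suc 0) + f 2 + f 3"
    and S4: "(\<Sum>i=0..4. f i) = f 0 + f (Suc 0) + f 2 + f 3 + f 4" and S5: "(\<Sum>i=0..5. f i) = f 0 + f (Suc 0) + f 2 + f 3 + f 4 + f 5" for f :: "nat \<Rightarrow> complex"
    by (simp_all add: eval_nat_numeral)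
  note r2 = r[of 1, unfolded S1] and r3 = r[of 2, unfolded S2] and r4 = r[of 3, unfolded S3] and r5 = r[of 4, unfolded S4] and r6 = r[of 5, unfolded S5]
  have "2 * fps_nth P 2 = 2 * (- 2 * zser 2)" using r2 by (simp add: p0 p1' G0 eval_nat_numeral)
  then show p2: "fps_nth P 2 = - 2 * zser 2" by (simp only: mult_cancel_left) simp
  have "3 * fps_nth P 3 = 3 * (4 * zser 3)" using r3 by (simp add: p0 p1' p2 G0)
  then show p3: "fps_nth P 3 = 4 * zser 3" by (simp only: mult_cancel_left) simp
  have "4 * fps_nth P 4 = 4 * (- 7 * zser 4 + 2 * zser 2 ^ 2)" using r4 by (simp add: p0 p1' p2 p3 G0 power2_eq_square algebra_simps)
  then show p4: "fps_nth P 4 = - 7 * zser 4 + 2 * zser 2 ^ 2" by (simp only: mult_cancel_left) simp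
  have "5 * fps_nth P 5 = 5 * (12 * zser 5 - 8 * zser 2 * zser 3)" using r5 by (simp add: p0 p1' p2 p3 p4 G0 power2_eq_square algebra_simps)
  then show p5: "fps_nth P 5 = 12 * zser 5 - 8 * zser 2 * zser 3" by (simp only: mult_cancel_left) simp
  have "6 * fps_nth P 6 = 6 * (- 62/3 * zser 6 + 14 * zser 2 * zser 4 + 8 * zser 3 ^ 2 - 4/3 * zser 2 ^ 3)"
    using r6 by (simp add: p0 p1' p2 p3 p4 p5 G0 power2_eq_square power3_eq_cube algebra_simps)
  then show "fps_nth P 6 = - 62/3 * zser 6 + 14 * zser 2 * zser 4 + 8 * zser 3 ^ 2 - 4/3 * zser 2 ^ 3" by (simp only: mult_cancel_left) simp
qed

text \<open>
  With \<open>L\<close> the logarithmic derivative of \<open>\<Gamma>(1 + a) \<Gamma>(1 - a) = \<pi> a / sin(\<pi> a)\<close>, the differential equation of the sine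
  becomes a Riccati equation for \<open>L\<close>, whose coefficients are the stated relations.
\<close>

lemma even_zeta_products:
  "2 * zser 2 ^ 2 = 5 * zser 4" "4 * zser 2 * zser 4 = 7 * zser 6" "4 * zser 2 * zser 6 + 2 * zser 4 ^ 2 = 9 * zser 8"
proof -
  define R where "R a = Gamma (1 + a) * Gamma (1 - a)" for a :: complex
  define L where "L = Abs_fps (\<lambda>n. if odd n then 2 * zser (Suc n) else 0)"
  have "(\<lambda>x::complex. Digamma (1 + 1 * x) - Digamma (1 + (-1) * x)) has_fps_expansion
     Abs_fps (\<lambda>n. 1 ^ n * (Polygamma n (1::complex) / fact n)) - Abs_fps (\<lambda>n. (-1) ^ n * (Polygamma n (1::complex) / fact n))"
    by (intro fps_expansion_intros Digamma_expansion)
  moreover have "Abs_fps (\<lambda>n. 1 ^ n * (Polygamma n (1::complex) / fact n)) - Abs_fps (\<lambda>n. (-1) ^ n * (Polygamma n (1::complex) / fact n)) = L"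
  proof (rule fps_ext)
    fix n show "fps_nth (Abs_fps (\<lambda>n. 1 ^ n * (Polygamma n (1::complex) / fact n)) - Abs_fps (\<lambda>n. (-1) ^ n * (Polygamma n (1::complex) / fact n))) n = fps_nth L n"
    proof (cases "n = 0")
      case False
      then have n: "n > 0" by simp
      show ?thesis unfolding L_def fps_sub_nth fps_nth_Abs_fps Polygamma_1_eq[OF n] by (cases "odd n") simp_all
    qed (simp add: L_def)
  qed
  ultimately have L: "(\<lambda>x::complex. Digamma (1 + 1 * x) - Digamma (1 + (-1) * x)) has_fps_expansion L" by simp
  have hol: "R holomorphic_on ball 0 1" unfolding R_def
  proof (intro holomorphic_intros)
    fix a :: complex assume "a \<in> ball 0 1"
    then show "1 + a \<notin> \<int>\<^sub>\<le>\<^sub>0" "1 - a \<notin> \<int>\<^sub>\<le>\<^sub>0" using not_nonpos_Int_near_1[of a] not_nonpos_Int_near_1[of "-a"] by auto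
  qed
  define F where "F = fps_expansion R 0"
  have F: "R has_fps_expansion F" unfolding F_def by (rule has_fps_expansion_fps_expansion[OF _ _ hol]) auto
  have dF: "fps_deriv F = F * L"
  proof (rule fps_logderiv[OF F L])
    show "eventually (\<lambda>x. (R has_field_derivative R x * (Digamma (1 + 1 * x) - Digamma (1 + (-1) * x))) (at x)) (nhds 0)"
      using eventually_one
    proof (eventually_elim, goal_cases)
      case (1 x)
      have a: "1 + x \<notin> \<int>\<^sub>\<le>\<^sub>0" "1 - x \<notin> \<int>\<^sub>\<le>\<^sub>0" using 1 not_nonpos_Int_near_1[of x] not_nonpos_Int_near_1[of "-x"] by auto
      have "((\<lambda>x. Gamma (1 + x) * Gamma (1 - x)) has_field_derivative
        (Gamma (1 + x) * Gamma (1 - x)) * (Digamma (1 + 1 * x) - Digamma (1 + (-1) * x))) (at x)"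
        by (rule derivative_eq_intros refl a | simp add: a)+ (simp add: algebra_simps)
      then show ?case unfolding R_def[abs_def] .
    qed
  qed
  define s c where "s = fps_sin (of_real pi :: complex)" and "c = fps_cos (of_real pi :: complex)"
  define p where "p = fps_const (of_real pi :: complex)"
  have ds: "fps_deriv s = p * c" "fps_deriv c = - p * s" by (simp_all add: s_def c_def p_def fps_sin_deriv fps_cos_deriv)
  have Fs: "F * s = p * fps_X"
  proof -
    have "(\<lambda>x. R x * sin (of_real pi * x)) has_fps_expansion F * s" unfolding s_def by (intro fps_expansion_intros F)
    moreover have "(\<lambda>x. of_real pi * x) has_fps_expansion p * fps_X" unfolding p_def by (intro fps_expansion_intros)
    moreover have "eventually (\<lambda>x. R x * sin (of_real pi * x) = of_real pi * x) (nhds 0)"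
      using eventually_one
    proof (eventually_elim, goal_cases)
      case (1 x)
      show ?case
      proof (cases "x = 0")
        case False
        have "x \<notin> \<int>\<^sub>\<le>\<^sub>0"
        proof
          assume "x \<in> \<int>\<^sub>\<le>\<^sub>0"
          then obtain n where n: "x = - of_nat n" by (auto elim!: nonpos_Ints_cases')
          then have "cmod x = real n" by simp
          with 1 n False show False by simp
        qed
        then have "Gamma (1 + x) = x * Gamma x" using Gamma_plus1[of x] by (simp add: add.commute)
        then have Rx: "R x = x * (Gamma x * Gamma (1 - x))" unfolding R_def by simp
        moreover have "R x \<noteq> 0" unfolding R_def using 1 not_nonpos_Int_near_1[of x] not_nonpos_Int_near_1[of "-x"] by (auto simp: Gamma_eq_zero_iff)
        ultimately have "sin (of_real pi * x) \<noteq> 0" using Gamma_reflection_complex[of x] Rx by auto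
        then show ?thesis using Rx Gamma_reflection_complex[of x] by simp
      qed simp
    qed
    ultimately show ?thesis using fps_expansion_unique_complex has_fps_expansion_cong by metis
  qed
  have s0: "s \<noteq> 0" using Fs by (auto simp: p_def)
  have F0: "F \<noteq> 0" using Fs by (auto simp: p_def)
  have 1: "F * L * s + F * (p * c) = p" using arg_cong[OF Fs, of fps_deriv] by (simp add: dF ds p_def add.commute)
  have "F * L * L * s + F * fps_deriv L * s + F * L * (p * c) + F * L * (p * c) + F * (p * (- p * s)) = 0"
    using arg_cong[OF 1, of fps_deriv] by (simp add: dF ds p_def algebra_simps)
  then have "F * (L * L * s + fps_deriv L * s + 2 * L * (p * c) - p * p * s) = 0" by algebra
  then have 2: "L * L * s + fps_deriv L * s + 2 * L * (p * c) - p * p * s = 0" using F0 by simp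
  \<comment> \<open>Multiplying equation 1 by \<open>fps_X\<close> and using
    \<open>F s = p X\<close> expresses the cosine through \<open>s\<close> and \<open>L\<close>;
    inserted into equation 2 it leaves a multiple of \<open>s\<close>, which can be
    cancelled.\<close>
  have 3: "fps_X * (p * c) = s - fps_X * L * s"
  proof -
    have a: "F * (p * c) = p - F * L * s" using 1 by (simp add: eq_diff_eq add.commute)
    have "F * (fps_X * (p * c)) = fps_X * (F * (p * c))" by (simp only: mult_ac)
    also have "\<dots> = p * fps_X - fps_X * (F * L * s)" unfolding a by (simp add: algebra_simps)
    also have "\<dots> = F * (s - fps_X * L * s)" unfolding Fs[symmetric] by (simp add: algebra_simps)
    finally have "F * (fps_X * (p * c)) = F * (s - fps_X * L * s)" .
    then show ?thesis using F0 by simp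
  qed
  have "s * (fps_X * (fps_deriv L - L * L - p * p) + 2 * L) =
     fps_X * (L * L * s + fps_deriv L * s + 2 * L * (p * c) - p * p * s) - 2 * L * (fps_X * (p * c) - (s - fps_X * L * s))"
    by algebra
  then have "s * (fps_X * (fps_deriv L - L * L - p * p) + 2 * L) = 0" unfolding 2 3 by simp
  then have "fps_X * (fps_deriv L - L * L - p * p) + 2 * L = 0" using s0 by simp
  then have k: "fps_nth (fps_X * (fps_deriv L - L * L - p * p) + 2 * L) n = 0" for n by simp
  \<comment> \<open>The square of pi sits in the constant coefficient only, so the relations
    extracted from higher coefficients are free of it.\<close>
  have pp: "fps_nth (p * p) (Suc n) = 0" for n by (simp add: p_def)
  have k': "of_nat (n + 2) * fps_nth L (n + 2) - fps_nth (L * L) (Suc n) + 2 * fps_nth L (n + 2) = 0" for n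
    using k[of "n + 2"] pp[of n] by (simp add: numeral_fps_const)
  have S: "fps_nth (L * L) 2 = 4 * zser 2 ^ 2" "fps_nth (L * L) 4 = 8 * zser 2 * zser 4" "fps_nth (L * L) 6 = 8 * zser 2 * zser 6 + 4 * zser 4 ^ 2"
  proof -
    have sum: "(\<Sum>i=0..2. f i) = f 0 + f 1 + f 2" "(\<Sum>i=0..4. f i) = f 0 + f 1 + f 2 + f 3 + f 4"
      "(\<Sum>i=0..6. f i) = f 0 + f 1 + f 2 + f 3 + f 4 + f 5 + f 6" for f :: "nat \<Rightarrow> complex" by (simp_all add: eval_nat_numeral)
    show "fps_nth (L * L) 2 = 4 * zser 2 ^ 2" "fps_nth (L * L) 4 = 8 * zser 2 * zser 4" "fps_nth (L * L) 6 = 8 * zser 2 * zser 6 + 4 * zser 4 ^ 2"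
      unfolding fps_mult_nth sum by (simp_all add: L_def power2_eq_square flip: numeral_2_eq_2)
  qed
  have l: "fps_nth L 3 = 2 * zser 4" "fps_nth L 5 = 2 * zser 6" "fps_nth L 7 = 2 * zser 8" by (simp_all add: L_def)
  have "2 * (2 * zser 2 ^ 2) = 2 * (5 * zser 4)" using k'[of 1] S(1) l(1) by (simp add: algebra_simps flip: numeral_2_eq_2)
  then show "2 * zser 2 ^ 2 = 5 * zser 4" by (simp only: mult_cancel_left) simp
  have "2 * (4 * zser 2 * zser 4) = 2 * (7 * zser 6)" using k'[of 3] S(2) l(2) by (simp add: algebra_simps)
  then show "4 * zser 2 * zser 4 = 7 * zser 6" by (simp only: mult_cancel_left) simp
  have "2 * (4 * zser 2 * zser 6 + 2 * zser 4 ^ 2) = 2 * (9 * zser 8)" using k'[of 5] S(3) l(3) by (simp add: algebra_simps)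
  then show "4 * zser 2 * zser 6 + 2 * zser 4 ^ 2 = 9 * zser 8" by (simp only: mult_cancel_left) simp
qed

section \<open>Summation of \<open>f5\<close>\<close>

definition vterm :: "complex \<Rightarrow> nat \<Rightarrow> complex" where
  "vterm a k = (\<Prod>j<k. (of_nat (Suc j) / (of_nat (Suc j) + 2 * a)) ^ 2) / ((of_nat (Suc k) + a) * (of_nat (Suc k) + 2 * a) ^ 2)"

definition F5 :: "complex \<Rightarrow> complex" where
  "F5 z = ((30 * z - 11) * Gamma z ^ 4) / (4 * z * (2 * z - 1) * Gamma (2 * z) ^ 2)"

text \<open>Besides X = 2 the parameters are 1, 1, 2, 2, so the quartic is
  \<open>(x + 2 a)^2 (x + a)^2\<close>. At the reflected point \<open>- m - 2 a\<close> it equals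
  \<open>m^2 (m + a)^2\<close>, and the factors \<open>m + a\<close> cancel in each ratio.\<close>

lemma psum_vterm:
  assumes "cmod a < 1"
  shows "psum 8 25 38 28 2 a = (\<Sum>k. vterm a k)"
proof -
  have 0: "((8 :: complex) - 2 * 2) / 4 = 1" "(8 :: complex) - 2 = 6" "(25 :: complex) - 2 * 6 = 13" "(38 :: complex) - 2 * 13 = 12" "(28 :: complex) - 2 * 12 = 4" by simp_all
  have q: "qpoly 6 13 12 4 a x = (x + 2 * a) ^ 2 * (x + a) ^ 2" for x unfolding qpoly_def by algebra
  have nz: "of_nat (Suc m) + a \<noteq> 0" for m
  proof
    assume "of_nat (Suc m) + a = 0"
    then have "a = - of_nat (Suc m)" unfolding eq_neg_iff_add_eq_0 by (simp only: add.commute)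
    then have "cmod a = real (Suc m)" by (metis norm_minus_cancel norm_of_nat)
    with assms show False by simp
  qed
  have "gsummand 1 6 13 12 4 a k = vterm a k" for k
  proof -
    have r: "qpoly 6 13 12 4 a (- of_nat (Suc j) - 2 * a * 1) * inverse (qpoly 6 13 12 4 a (of_nat (Suc j))) = (of_nat (Suc j) / (of_nat (Suc j) + 2 * a)) ^ 2" for j
    proof -
      define m where "m = (of_nat (Suc j) :: complex)"
      have m: "m + a \<noteq> 0" using nz[of j] by (simp add: m_def)
      have e: "qpoly 6 13 12 4 a (- m - 2 * a * 1) = m ^ 2 * (m + a) ^ 2" unfolding q by algebra
      define w where "w = m + a"
      show ?thesis unfolding m_def[symmetric] e unfolding q w_def[symmetric] using m[folded w_def]
        by (simp add: divide_inverse power_mult_distrib power_inverse)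
    qed
    define m where "m = (of_nat (Suc k) :: complex)"
    have m: "m + a \<noteq> 0" using nz[of k] by (simp add: m_def)
    have "(m + a * 1) * inverse (qpoly 6 13 12 4 a m) = 1 / ((m + a) * (m + 2 * a) ^ 2)"
      unfolding q using m by (simp add: divide_inverse power2_eq_square)
    then show ?thesis unfolding gsummand_def r vterm_def m_def by simp
  qed
  then have "gsummand 1 6 13 12 4 a = vterm a" by (rule ext)
  then show ?thesis unfolding psum_def gsum_def 0 by simp
qed

text \<open>
  The certificate polynomial for the recurrence under \<open>a \<mapsto> a + 1\<close>, again from Gosper's algorithm.
\<close>

definition wtau :: "complex \<Rightarrow> complex \<Rightarrow> complex" where
  "wtau a n = (2 + 23/2 * a + 45/2 * a^2 + 15 * a^3 + (7/2 + 31/2 * a + 17 * a^2) * n + (3 + 7 * a) * n^2 + n^3)"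

lemma wtau_identity:
  "(2 + 4 * a) * ((n+1+2 * a)^2 * (n+2+2 * a)^2 * (n+1+a) - (1+a)^4 * (n+a)) = wtau a n * (n+2+2 * a)^2 * (n+1+a) - n^2 * (n+a) * wtau a (n + 1)"
proof -
  have 2: "2 * wtau a n = 4 + 23 * a + 45 * a^2 + 30 * a^3 + (7 + 31 * a + 34 * a^2) * n + (6 + 14 * a) * n^2 + 2 * n^3" for n
    unfolding wtau_def by (simp add: field_simps)
  have "2 * ((2 + 4 * a) * ((n+1+2 * a)^2 * (n+2+2 * a)^2 * (n+1+a) - (1+a)^4 * (n+a))) =
     (2 * wtau a n) * (n+2+2 * a)^2 * (n+1+a) - n^2 * (n+a) * (2 * wtau a (n + 1))"
    unfolding 2 by algebra
  then have "2 * ((2 + 4 * a) * ((n+1+2 * a)^2 * (n+2+2 * a)^2 * (n+1+a) - (1+a)^4 * (n+a))) =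
     2 * (wtau a n * (n+2+2 * a)^2 * (n+1+a) - n^2 * (n+a) * wtau a (n + 1))" by (simp add: algebra_simps)
  then show ?thesis by (simp only: mult_cancel_left) simp
qed

definition vcert :: "complex \<Rightarrow> nat \<Rightarrow> complex" where
  "vcert a k = vterm a k * (wtau a (of_nat (Suc k)) / ((2 + 4 * a) * (of_nat (Suc k) + 1 + 2 * a) ^ 2))"

text \<open>This is also \<open>gratio (a + 1) / gratio a\<close>. Multiplied by
  \<open>gratio a\<close>, the recurrence of the series therefore becomes an exact difference, which
  is why the sum over \<open>f5\<close> telescopes.\<close>

definition vrho :: "complex \<Rightarrow> complex" where
  "vrho a = (1 + a) ^ 4 / ((1 + 2 * a) ^ 2 * (2 + 2 * a) ^ 2)"

lemma nz_Re:
  assumes "Re a > -1/4"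
  shows "of_nat (Suc m) + a \<noteq> 0" "of_nat (Suc m) + 2 * a \<noteq> 0" "2 + 4 * a \<noteq> 0"
proof -
  have "Re (of_nat (Suc m) + a) > 0" "Re (of_nat (Suc m) + 2 * a) > 0" "Re (2 + 4 * a) > 0" using assms by simp_all
  then show "of_nat (Suc m) + a \<noteq> 0" "of_nat (Suc m) + 2 * a \<noteq> 0" "2 + 4 * a \<noteq> 0" by (metis less_irrefl zero_complex.simps(1))+
qed

lemma vterm_relation:
  assumes "Re a > -1/4"
  shows "vterm a k - vrho a * vterm (a + 1) k = vcert a k - vcert a (Suc k)"
proof -
  note nz = nz_Re[OF assms]
  define G where "G k = (\<Prod>j<k. (of_nat (Suc j) / (of_nat (Suc j) + 2 * a)))" for k
  define G' where "G' k = (\<Prod>j<k. (of_nat (Suc j) / (of_nat (Suc j) + 2 * (a + 1))))" for k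
  \<comment> \<open>Passing to \<open>a + 1\<close> moves every denominator by two places, so the
    two products differ by boundary factors only.\<close>
  have G': "G' k * ((of_nat (Suc k) + 2 * a) * (of_nat (Suc (Suc k)) + 2 * a)) = G k * ((1 + 2 * a) * (2 + 2 * a))" for k
  proof (induction k)
    case (Suc k)
    define m where "m = (of_nat (Suc k) :: complex)"
    have m: "m + 2 * a \<noteq> 0" "m + 1 + 2 * a \<noteq> 0" "m + 2 + 2 * a \<noteq> 0"
      using nz(2)[of k] nz(2)[of "Suc k"] nz(2)[of "Suc (Suc k)"] by (simp_all add: m_def add_ac)
    have e: "of_nat (Suc (Suc k)) = m + 1" "of_nat (Suc (Suc (Suc k))) = m + 2" by (simp_all add: m_def)
    have GS: "G' (Suc k) = G' k * (m / (m + 2 + 2 * a))" unfolding G'_def m_def by (simp add: algebra_simps)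
    define x y z where "x = m + 2 * a" and "y = m + 1 + 2 * a" and "z = m + 2 + 2 * a"
    have "G' (Suc k) * ((m + 1 + 2 * a) * (m + 2 + 2 * a)) = G' k * ((m + 2 * a) * (m + 1 + 2 * a)) * (m / (m + 2 * a))"
      using m unfolding GS x_def[symmetric] y_def[symmetric] z_def[symmetric] by simp
    also have "\<dots> = G (Suc k) * ((1 + 2 * a) * (2 + 2 * a))" using Suc unfolding e m_def[symmetric] by (simp add: G_def m_def)
    finally show ?case unfolding e .
  qed (simp add: G_def G'_def)
  define n where "n = (of_nat (Suc k) :: complex)"
  define p q r u v where d: "p = n + 2 * a" "q = n + 1 + 2 * a" "r = n + 2 + 2 * a" "u = n + a" "v = n + 1 + a"
  have nzs: "p \<noteq> 0" "q \<noteq> 0" "r \<noteq> 0" "u \<noteq> 0" "v \<noteq> 0" "2 + 4 * a \<noteq> 0"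
    using nz(2)[of k] nz(2)[of "Suc k"] nz(2)[of "Suc (Suc k)"] nz(1)[of k] nz(1)[of "Suc k"] nz(3) by (simp_all add: n_def d add_ac)
  have nz2: "(1 + 2 * a) * (2 + 2 * a) \<noteq> 0" using nz(2)[of 0] nz(2)[of 1] by simp
  have e: "of_nat (Suc (Suc k)) = n + 1" by (simp add: n_def)
  have v1: "vterm a k = G k ^ 2 / (u * p ^ 2)" unfolding vterm_def G_def n_def d by (simp add: prod_power_distrib)
  have "vterm a (Suc k) = G (Suc k) ^ 2 / ((of_nat (Suc (Suc k)) + a) * (of_nat (Suc (Suc k)) + 2 * a) ^ 2)"
    unfolding vterm_def G_def prod_power_distrib ..
  moreover have "G (Suc k) = G k * (n / p)" unfolding G_def n_def d by simp
  ultimately have v2: "vterm a (Suc k) = (G k * (n / p)) ^ 2 / (v * q ^ 2)" unfolding e d by simp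
  have v3: "vterm (a + 1) k = G' k ^ 2 / (v * r ^ 2)" unfolding vterm_def G'_def n_def d by (simp add: prod_power_distrib algebra_simps)
  have "vrho a * G' k ^ 2 = (1 + a) ^ 4 * (G' k * (p * q)) ^ 2 / (((1 + 2 * a) * (2 + 2 * a)) ^ 2 * (p * q) ^ 2)"
    unfolding vrho_def using nzs by (simp add: power_mult_distrib)
  also have "G' k * (p * q) = G k * ((1 + 2 * a) * (2 + 2 * a))" using G'[of k] unfolding e d n_def by simp
  also have "(1 + a) ^ 4 * (G k * ((1 + 2 * a) * (2 + 2 * a))) ^ 2 / (((1 + 2 * a) * (2 + 2 * a)) ^ 2 * (p * q) ^ 2) = (1 + a) ^ 4 * G k ^ 2 / (p * q) ^ 2"
    using nz2 by (simp add: power_mult_distrib)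
  finally have v4: "vrho a * vterm (a + 1) k = (1 + a) ^ 4 * G k ^ 2 / (p * q) ^ 2 / (v * r ^ 2)" unfolding v3 by simp
  define I where "I = G k ^ 2 / ((2 + 4 * a) * u * v * p ^ 2 * q ^ 2 * r ^ 2)"
  define T T' w where "T = wtau a n" and "T' = wtau a (n + 1)" and "w = 2 + 4 * a"
  define z where "z = (1 + a) ^ 4"
  have w: "w \<noteq> 0" using nzs by (simp add: w_def)
  have id: "w * (q ^ 2 * r ^ 2 * v - z * u) = T * r ^ 2 * v - n ^ 2 * u * T'"
    using wtau_identity[of a n] unfolding T_def T'_def w_def z_def d .
  have "vterm a k = I * (w * (q ^ 2 * r ^ 2 * v))" unfolding v1 I_def w_def[symmetric] using nzs(1-5) w by (simp add: divide_simps)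
  moreover have "vrho a * vterm (a + 1) k = I * (w * (z * u))" unfolding v4 I_def w_def[symmetric] z_def[symmetric] using nzs(1-5) w by (simp add: divide_simps power_mult_distrib)
  moreover have "vcert a k = I * (T * r ^ 2 * v)"
  proof -
    have vc: "vcert a k = G k ^ 2 / (u * p ^ 2) * (T / (w * q ^ 2))" unfolding vcert_def v1 T_def w_def n_def d by simp
    show ?thesis unfolding vc I_def w_def[symmetric] using nzs(1-5) w by (simp add: divide_simps)
  qed
  moreover have "vcert a (Suc k) = I * (n ^ 2 * u * T')"
  proof -
    have vc: "vcert a (Suc k) = (G k * (n / p)) ^ 2 / (v * q ^ 2) * (T' / (w * r ^ 2))" unfolding vcert_def v2 T'_def w_def e d by (simp add: add_ac)
    show ?thesis unfolding vc I_def w_def[symmetric] using nzs(1-5) w by (simp add: divide_simps power_mult_distrib)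
  qed
  ultimately show ?thesis using arg_cong[OF id, of "\<lambda>x. I * x"] by (simp add: right_diff_distrib)
qed

text \<open>A half-plane is used because the bound is applied at all \<open>a + N\<close>. Moduli
  are bounded below by real parts, and -1/50 becomes the tolerance 1/25 for
  \<open>2 a\<close>.\<close>

lemma vterm_bound:
  assumes "Re a \<ge> - 1/50"
  shows "cmod (\<Prod>j<k. (of_nat (Suc j) / (of_nat (Suc j) + 2 * a)) ^ 2) \<le> real (Suc k)" "cmod (vterm a k) \<le> 2 / real (Suc k) ^ 2"
proof -
  have f: "cmod ((of_nat (Suc j) / (of_nat (Suc j) + 2 * a)) ^ 2) \<le> 1 + 1 / real (Suc j)" for j
  proof -
    have "cmod (of_nat (Suc j) + 2 * a) \<ge> real (Suc j) - 1/25"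
      using complex_Re_le_cmod[of "of_nat (Suc j) + 2 * a"] assms by simp
    moreover have "cmod (of_nat (Suc j) :: complex) \<le> real (Suc j) + 1/25" unfolding norm_of_nat by simp
    ultimately have "cmod (of_nat (Suc j) / (of_nat (Suc j) + 2 * a)) \<le> 1 + 1 / (12 * real (Suc j))"
      by (intro cmod_ratio_le[where M = "real (Suc j)"]) simp_all
    then have "cmod (of_nat (Suc j) / (of_nat (Suc j) + 2 * a) * (of_nat (Suc j) / (of_nat (Suc j) + 2 * a)) * 1 * 1) \<le> 1 + 1 / real (Suc j)"
      by (intro prod4_bound) auto
    then show ?thesis by (simp only: power2_eq_square mult_1_right)
  qed
  have "cmod (\<Prod>j<k. (of_nat (Suc j) / (of_nat (Suc j) + 2 * a)) ^ 2) \<le> (\<Prod>j<k. 1 + 1 / real (Suc j))"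
    unfolding prod_norm[symmetric] using f by (intro prod_mono conjI norm_ge_zero) auto
  then show "cmod (\<Prod>j<k. (of_nat (Suc j) / (of_nat (Suc j) + 2 * a)) ^ 2) \<le> real (Suc k)" by (simp only: prod_Suc_quotient)
  have lb: "cmod (of_nat (Suc k) + c * a) \<ge> 24/25 * real (Suc k)" if "c = 1 \<or> c = 2" for c :: complex
  proof -
    have "Re (of_nat (Suc k) + c * a) \<ge> real (Suc k) - 1/25" using that assms by auto
    moreover have "24/25 * real (Suc k) \<le> real (Suc k) - 1/25" by simp
    ultimately have "Re (of_nat (Suc k) + c * a) \<ge> 24/25 * real (Suc k)" by (rule order_trans[rotated])
    then show ?thesis using complex_Re_le_cmod order_trans by blast
  qed
  have p: "cmod (1 / ((of_nat (Suc k) + a) * (of_nat (Suc k) + 2 * a) ^ 2)) \<le> 2 / real (Suc k) ^ 3"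
  proof -
    have "(24/25 * real (Suc k)) * (24/25 * real (Suc k)) ^ 2 \<le> cmod (of_nat (Suc k) + a) * cmod (of_nat (Suc k) + 2 * a) ^ 2"
      using lb[of 1] lb[of 2] by (intro mult_mono power_mono) auto
    moreover have "real (Suc k) ^ 3 / 2 \<le> (24/25 * real (Suc k)) * (24/25 * real (Suc k)) ^ 2"
    proof -
      define x where "x = real (Suc k)"
      have "1/2 * x ^ 3 \<le> (24/25) ^ 3 * x ^ 3" by (intro mult_right_mono) (simp_all add: x_def power3_eq_cube)
      then show ?thesis unfolding x_def[symmetric] by (simp add: power2_eq_square power3_eq_cube)
    qed
    ultimately have "real (Suc k) ^ 3 / 2 \<le> cmod ((of_nat (Suc k) + a) * (of_nat (Suc k) + 2 * a) ^ 2)" by (simp add: norm_mult norm_power)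
    then have "1 / cmod ((of_nat (Suc k) + a) * (of_nat (Suc k) + 2 * a) ^ 2) \<le> 1 / (real (Suc k) ^ 3 / 2)"
      by (intro frac_le) auto
    then show ?thesis by (simp add: norm_divide)
  qed
  have "cmod (1 / ((of_nat (Suc k) + a) * (of_nat (Suc k) + 2 * a) ^ 2) * (\<Prod>j<k. (of_nat (Suc j) / (of_nat (Suc j) + 2 * a)) ^ 2)) \<le> 2 / real (Suc k) ^ 2"
    by (rule cmod_times_prod_le[OF p f])
  then show "cmod (vterm a k) \<le> 2 / real (Suc k) ^ 2" unfolding vterm_def by simp
qed

lemma vterm_summable: "Re a \<ge> - 1/50 \<Longrightarrow> summable (vterm a)"
  by (rule summable_comparison_test'[OF summable_inverse_squares[of 2]]) (rule vterm_bound(2))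

lemma vcert_tendsto:
  assumes "Re a \<ge> - 1/50" shows "vcert a \<longlonglongrightarrow> 0"
proof -
  define b where "b k = inverse (of_nat (Suc k) :: complex)" for k
  define g where "g k = wtau a (of_nat (Suc k)) / of_nat (Suc k) ^ 3 / ((2 + 4 * a) * ((of_nat (Suc k) + (1 + 2 * a)) / of_nat (Suc k)) ^ 2)" for k
  have w: "(\<lambda>k. wtau a (of_nat (Suc k)) / of_nat (Suc k) ^ 3) \<longlonglongrightarrow> 1"
  proof -
    have b: "b \<longlonglongrightarrow> 0" unfolding b_def by (rule LIMSEQ_Suc[OF lim_inverse_n])
    have "(\<lambda>k. (2 + 23/2 * a + 45/2 * a^2 + 15 * a^3) * b k ^ 3 + (7/2 + 31/2 * a + 17 * a^2) * b k ^ 2 + (3 + 7 * a) * b k + 1) \<longlonglongrightarrow>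
      (2 + 23/2 * a + 45/2 * a^2 + 15 * a^3) * 0 ^ 3 + (7/2 + 31/2 * a + 17 * a^2) * 0 ^ 2 + (3 + 7 * a) * 0 + 1"
      by (intro tendsto_intros b)
    moreover have "(2 + 23/2 * a + 45/2 * a^2 + 15 * a^3) * b k ^ 3 + (7/2 + 31/2 * a + 17 * a^2) * b k ^ 2 + (3 + 7 * a) * b k + 1 =
       wtau a (of_nat (Suc k)) / of_nat (Suc k) ^ 3" for k
    proof -
      define n where "n = (of_nat (Suc k) :: complex)"
      have n: "n * inverse n = 1" unfolding n_def by (simp del: of_nat_Suc)
      define A B C where "A = 2 + 23/2 * a + 45/2 * a^2 + 15 * a^3" and "B = 7/2 + 31/2 * a + 17 * a^2" and "C = 3 + 7 * a"
      show ?thesis unfolding b_def wtau_def n_def[symmetric] A_def[symmetric] B_def[symmetric] C_def[symmetric]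
        unfolding divide_inverse power_inverse[symmetric] using n by algebra
    qed
    ultimately show ?thesis by simp
  qed
  have nz: "2 + 4 * a \<noteq> 0" using nz_Re(3)[of a] assms by simp
  have "g \<longlonglongrightarrow> 1 / ((2 + 4 * a) * 1 ^ 2)" unfolding g_def
    using nz by (intro tendsto_intros w tendsto_shift_quotient) auto
  then have "(\<lambda>k. (of_nat (Suc k) * vterm a k) * g k) \<longlonglongrightarrow> 0 * (1 / ((2 + 4 * a) * 1 ^ 2))"
  proof (rule tendsto_mult[rotated])
    show "(\<lambda>k. of_nat (Suc k) * vterm a k) \<longlonglongrightarrow> 0"
    proof (rule Lim_null_comparison[OF always_eventually], rule allI)
      show "(\<lambda>k. 2 * inverse (real (Suc k))) \<longlonglongrightarrow> 0" using tendsto_mult[OF tendsto_const LIMSEQ_Suc[OF lim_inverse_n], of 2] by simp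
      fix k
      have "cmod (of_nat (Suc k) * vterm a k) \<le> real (Suc k) * (2 / real (Suc k) ^ 2)"
        unfolding norm_mult norm_of_nat by (intro mult_left_mono vterm_bound(2) assms) auto
      also have "\<dots> = 2 * inverse (real (Suc k))" by (simp add: power2_eq_square divide_inverse del: of_nat_Suc)
      finally show "cmod (of_nat (Suc k) * vterm a k) \<le> 2 * inverse (real (Suc k))" .
    qed
  qed
  moreover have "(of_nat (Suc k) * vterm a k) * g k = vcert a k" for k
  proof -
    define n where "n = (of_nat (Suc k) :: complex)"
    have n: "n \<noteq> 0" unfolding n_def by (simp del: of_nat_Suc)
    define q w where "q = n + (1 + 2 * a)" and "w = 2 + 4 * a"
    have "(n * vterm a k) * (wtau a n / n ^ 3 / (w * (q / n) ^ 2)) = vterm a k * (wtau a n / (w * q ^ 2))"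
      using n by (simp add: power_divide power2_eq_square power3_eq_cube)
    then show ?thesis unfolding g_def vcert_def n_def q_def w_def by (simp only: add.assoc)
  qed
  ultimately show ?thesis by simp
qed

lemma vterm_recurrence:
  assumes "Re a \<ge> - 1/50"
  shows "suminf (vterm a) - vrho a * suminf (vterm (a + 1)) = (30 * a + 19) / (16 * (1 + a) * (1 + 2 * a) ^ 3)"
proof -
  have a: "Re a > -1/4" using assms by simp
  have "(\<lambda>k. vterm a k - vrho a * vterm (a + 1) k) sums (suminf (vterm a) - vrho a * suminf (vterm (a + 1)))"
    using assms by (intro sums_diff sums_mult summable_sums vterm_summable) auto
  moreover have "(\<lambda>k. vcert a k - vcert a (Suc k)) sums (vcert a 0 - 0)"
    by (rule telescope_sums'[OF vcert_tendsto[OF assms]])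
  ultimately have "suminf (vterm a) - vrho a * suminf (vterm (a + 1)) = vcert a 0"
    unfolding vterm_relation[OF a] using sums_unique2 by fastforce
  also have "vcert a 0 = (30 * a + 19) / (16 * (1 + a) * (1 + 2 * a) ^ 3)"
  proof -
    \<comment> \<open>Here the factor \<open>30 x - 11\<close> of \<open>f5\<close> arises, as
      \<open>30 a + 19\<close> with \<open>x = a + 1\<close>.\<close>
    have t: "wtau a 1 = (1 + a) ^ 2 * (30 * a + 19) / 2" unfolding wtau_def by (simp add: field_simps power2_eq_square power3_eq_cube)
    define u v where "u = 1 + a" and "v = 1 + 2 * a"
    have uv: "u \<noteq> 0" "v \<noteq> 0" using nz_Re(1)[OF a, of 0] nz_Re(2)[OF a, of 0] by (simp_all add: u_def v_def)
    have e: "2 + 4 * a = 2 * v" "1 + 1 + 2 * a = 2 * u" by (simp_all add: u_def v_def)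
    have "vcert a 0 = 1 / (u * v ^ 2) * ((u ^ 2 * (30 * a + 19) / 2) / (2 * v * (2 * u) ^ 2))"
    proof -
      have "vcert a 0 = 1 / ((1 + a) * (1 + 2 * a) ^ 2) * (wtau a 1 / ((2 + 4 * a) * (1 + 1 + 2 * a) ^ 2))"
        unfolding vcert_def vterm_def by simp
      then show ?thesis unfolding t e u_def[symmetric] v_def[symmetric] .
    qed
    also have "\<dots> = (30 * a + 19) / (16 * u * v ^ 3)" using uv by (simp add: power2_eq_square power3_eq_cube)
    finally show ?thesis unfolding u_def v_def .
  qed
  finally show ?thesis .
qed

section \<open>Telescoping with the Gamma factor\<close>

lemma half_plane_not_nonpos_Int: "Re z > 0 \<Longrightarrow> z \<notin> \<int>\<^sub>\<le>\<^sub>0"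
  using nonpos_Ints_subset_nonpos_Reals by (auto simp: complex_nonpos_Reals_iff)

lemma F5_shift:
  assumes "Re a > - 1/4"
  shows "gratio (a + 1) = gratio a * vrho a" "F5 (a + 1) = gratio a * ((30 * a + 19) / (4 * (1 + a) * (1 + 2 * a) ^ 3))"
proof -
  have n: "1 + a \<notin> \<int>\<^sub>\<le>\<^sub>0" "1 + 2 * a \<notin> \<int>\<^sub>\<le>\<^sub>0" "1 + 2 * a + 1 \<notin> \<int>\<^sub>\<le>\<^sub>0"
    using assms by (auto intro!: half_plane_not_nonpos_Int)
  have g1: "Gamma (1 + (a + 1)) = (1 + a) * Gamma (1 + a)" using Gamma_plus1[OF n(1)] by (simp add: add_ac)
  have g2: "Gamma (1 + 2 * a + 1) = (1 + 2 * a) * Gamma (1 + 2 * a)" using Gamma_plus1[OF n(2)] .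
  have "Gamma (1 + 2 * a + 1 + 1) = (1 + 2 * a + 1) * Gamma (1 + 2 * a + 1)" using Gamma_plus1[OF n(3)] .
  moreover have "1 + 2 * (a + 1) = 1 + 2 * a + 1 + 1" by simp
  ultimately have g3: "Gamma (1 + 2 * (a + 1)) = (2 + 2 * a) * ((1 + 2 * a) * Gamma (1 + 2 * a))" by (simp only: g2) simp
  show "gratio (a + 1) = gratio a * vrho a"
    unfolding gratio_def vrho_def g1 g3 by (simp only: power_mult_distrib times_divide_times_eq) (simp only: mult_ac)
  have e: "30 * (a + 1) - 11 = 30 * a + 19" "2 * (a + 1) - 1 = 1 + 2 * a" "a + 1 = 1 + a" "2 * (1 + a) = 1 + 2 * a + 1" by simp_all
  define u v where "u = 1 + a" and "v = 1 + 2 * a"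
  show "F5 (a + 1) = gratio a * ((30 * a + 19) / (4 * (1 + a) * (1 + 2 * a) ^ 3))"
    unfolding F5_def gratio_def e(1,2) unfolding e(3) unfolding e(4) g2
    unfolding u_def[symmetric] v_def[symmetric] by (simp add: power_mult_distrib power2_eq_square power3_eq_cube mult_ac)
qed

lemma F5_telescope:
  assumes "Re a \<ge> - 1/50"
  shows "F5 (a + 1) = 4 * gratio a * suminf (vterm a) - 4 * gratio (a + 1) * suminf (vterm (a + 1))"
proof -
  have a: "Re a > -1/4" using assms by simp
  define u v w where "u = 1 + a" and "v = (1 + 2 * a) ^ 3" and "w = 30 * a + 19"
  have "4 * gratio a * (suminf (vterm a) - vrho a * suminf (vterm (a + 1))) = F5 (a + 1)"
    unfolding vterm_recurrence[OF assms] F5_shift(2)[OF a] unfolding u_def[symmetric] v_def[symmetric] w_def[symmetric] by (simp add: mult_ac)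
  then show ?thesis unfolding F5_shift(1)[OF a] by (simp add: algebra_simps)
qed

lemma F5_partial_sum:
  assumes "Re a \<ge> - 1/50"
  shows "(\<Sum>k<N. F5 (of_nat (Suc k) + a)) = 4 * gratio a * suminf (vterm a) - 4 * gratio (a + of_nat N) * suminf (vterm (a + of_nat N))"
proof (induction N)
  case (Suc N)
  have "Re (a + of_nat N) \<ge> - 1/50" using assms by simp
  note t = F5_telescope[OF this]
  have s: "of_nat (Suc N) + a = a + of_nat N + 1" "a + of_nat (Suc N) = a + of_nat N + 1" by simp_all
  show ?case unfolding sum.lessThan_Suc Suc.IH s t by simp
qed simp

text \<open>In \<open>v = 1 + 2 b\<close> the factor is the square of
  \<open>(v + 1) / (4 v)\<close>, at most 9/16 in modulus on the half-plane. Together with the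
  uniform bound on the series this makes the telescoping remainder decay geometrically.\<close>

lemma vrho_bound:
  assumes "Re b \<ge> - 1/50"
  shows "cmod (vrho b) \<le> 1/3"
proof -
  define v where "v = 1 + 2 * b"
  have v: "cmod v \<ge> 24/25" using complex_Re_le_cmod[of v] assms by (simp add: v_def)
  have nz: "1 + b \<noteq> 0" "v \<noteq> 0" using nz_Re(1,2)[of b 0] assms by (simp_all add: v_def)
  define u where "u = (v + 1) / 2"
  have u: "1 + b = u" "2 + 2 * b = 2 * u" by (simp_all add: u_def v_def field_simps)
  have "vrho b = u ^ 4 / (v ^ 2 * (2 * u) ^ 2)" unfolding vrho_def u v_def ..
  also have "\<dots> = (u / (2 * v)) ^ 2" using nz(1) unfolding u by (simp add: power2_eq_square power4_eq_xxxx)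
  also have "u / (2 * v) = (v + 1) / (4 * v)" by (simp add: u_def)
  finally have e: "vrho b = ((v + 1) / (4 * v)) ^ 2" .
  have "cmod (v + 1) \<le> cmod v + 1" using norm_triangle_ineq[of v 1] by simp
  also have "\<dots> \<le> 9/16 * (4 * cmod v)" using v by simp
  finally have "cmod ((v + 1) / (4 * v)) \<le> 9/16" using nz(2) by (simp add: norm_divide norm_mult pos_divide_le_eq)
  then have "cmod ((v + 1) / (4 * v)) ^ 2 \<le> (9/16) ^ 2" by (intro power_mono) auto
  then show ?thesis unfolding e norm_power by (simp add: power2_eq_square)
qed

lemma gratio_decay:
  assumes "Re a \<ge> - 1/50"
  shows "cmod (gratio (a + of_nat N)) \<le> cmod (gratio a) * (1/3) ^ N"
proof (induction N)
  case (Suc N)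
  have r: "Re (a + of_nat N) \<ge> - 1/50" using assms by simp
  then have "gratio (a + of_nat N + 1) = gratio (a + of_nat N) * vrho (a + of_nat N)" by (intro F5_shift) simp
  then have "cmod (gratio (a + of_nat (Suc N))) = cmod (gratio (a + of_nat N)) * cmod (vrho (a + of_nat N))"
    by (simp add: add_ac norm_mult)
  also have "\<dots> \<le> (cmod (gratio a) * (1/3) ^ N) * (1/3)" using Suc.IH vrho_bound[OF r] by (intro mult_mono) auto
  finally show ?case by simp
qed simp

lemma F5_holomorphic: "F5 holomorphic_on {z. Re z > 1/2}"
  unfolding F5_def
proof (intro holomorphic_intros)
  show "{z. Re z > 1/2} \<inter> \<int>\<^sub>\<le>\<^sub>0 = {}" using half_plane_not_nonpos_Int by force
  fix z :: complex assume z: "z \<in> {z. Re z > 1/2}"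
  then show "2 * z \<notin> \<int>\<^sub>\<le>\<^sub>0" by (auto intro!: half_plane_not_nonpos_Int)
  then have "Gamma (2 * z) \<noteq> 0" by (simp add: Gamma_eq_zero_iff)
  moreover have "z \<noteq> 0" using z by auto
  moreover have "2 * z - 1 \<noteq> 0"
  proof
    assume "2 * z - 1 = 0"
    then have "Re (2 * z - 1) = 0" by simp
    with z show False by simp
  qed
  ultimately show "4 * z * (2 * z - 1) * Gamma (2 * z) ^ 2 \<noteq> 0" by simp
qed

lemma F5_uniform_limit:
  "uniform_limit (ball 0 (1/50)) (\<lambda>N a. \<Sum>k<N. F5 (of_nat (Suc k) + a)) (\<lambda>a. 4 * gratio a * suminf (vterm a)) sequentially"
proof -
  have "compact (gratio ` cball 0 (1/50))"
    by (intro compact_continuous_image holomorphic_on_imp_continuous_on[OF holomorphic_on_subset[OF gratio_holomorphic]]) auto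
  then have "bounded (gratio ` cball 0 (1/50))" by (rule compact_imp_bounded)
  then obtain C where C: "C > 0" "\<And>a. a \<in> cball 0 (1/50) \<Longrightarrow> cmod (gratio a) \<le> C" by (force simp: bounded_pos)
  define S where "S = (\<Sum>k. 2 / real (Suc k) ^ 2)"
  have V: "cmod (suminf (vterm a)) \<le> S" if "Re a \<ge> - 1/50" for a
    unfolding S_def using that by (intro norm_suminf_le summable_inverse_squares vterm_bound(2))
  have "0 \<le> cmod (suminf (vterm 0))" by simp
  also have "\<dots> \<le> S" by (rule V) simp
  finally have S: "S \<ge> 0" .
  show ?thesis
  proof (rule uniform_limitI)
    fix e :: real assume e: "e > 0"
    have "(\<lambda>N. 4 * (C * (1/3) ^ N) * S) \<longlonglongrightarrow> 4 * (C * 0) * S"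
      by (intro tendsto_intros LIMSEQ_power_zero) simp
    then have "eventually (\<lambda>N. 4 * (C * (1/3) ^ N) * S < e) sequentially" using e by (intro order_tendstoD(2)[where y = "4 * (C * 0) * S"]) simp_all
    then show "\<forall>\<^sub>F N in sequentially. \<forall>a\<in>ball 0 (1/50). dist (\<Sum>k<N. F5 (of_nat (Suc k) + a)) (4 * gratio a * suminf (vterm a)) < e"
    proof (eventually_elim, intro ballI)
      fix N and a :: complex assume 1: "4 * (C * (1/3) ^ N) * S < e" and b: "a \<in> ball 0 (1/50)"
      have a: "Re a \<ge> - 1/50" "a \<in> cball 0 (1/50)" using b abs_Re_le_cmod[of a] by auto
      have "dist (\<Sum>k<N. F5 (of_nat (Suc k) + a)) (4 * gratio a * suminf (vterm a)) = 4 * cmod (gratio (a + of_nat N)) * cmod (suminf (vterm (a + of_nat N)))"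
        unfolding F5_partial_sum[OF a(1)] dist_norm by (simp add: norm_mult)
      also have "\<dots> \<le> 4 * (C * (1/3) ^ N) * S"
        using order_trans[OF gratio_decay[OF a(1), of N] mult_right_mono[OF C(2)[OF a(2)]]] C(1) a(1) by (intro mult_mono V) auto
      also note 1
      finally show "dist (\<Sum>k<N. F5 (of_nat (Suc k) + a)) (4 * gratio a * suminf (vterm a)) < e" .
    qed
  qed
qed

text \<open>Uniform convergence allows termwise differentiation in \<open>a\<close>; the right-hand
  side is the Cauchy product of the two Taylor series times \<open>4 * fact m\<close>.\<close>

theorem F5_deriv_sums:
  "(\<lambda>k. (deriv ^^ m) F5 (of_nat (Suc k))) sums
     (4 * fact m * (\<Sum>i=0..m. fps_nth (fps_expansion gratio 0) i * pcoef 8 25 38 28 2 (m - i)))"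
proof -
  have shift: "(\<lambda>a. F5 (of_nat (Suc k) + a)) holomorphic_on ball 0 (1/50)"
    "(deriv ^^ m) (\<lambda>a. F5 (of_nat (Suc k) + a)) 0 = (deriv ^^ m) F5 (of_nat (Suc k))" for k
  proof -
    have sub: "of_nat (Suc k) + a \<in> {z. Re z > 1/2}" if "a \<in> ball 0 (1/50)" for a
      using that abs_Re_le_cmod[of a] by (simp add: abs_le_iff)
    then have sub: "(\<lambda>a. of_nat (Suc k) + a) ` ball 0 (1/50) \<subseteq> {z. Re z > 1/2}" by blast
    have "F5 \<circ> (\<lambda>a. of_nat (Suc k) + a) holomorphic_on ball 0 (1/50)"
      by (rule holomorphic_on_compose_gen[OF _ F5_holomorphic]) (use sub in \<open>auto intro!: holomorphic_intros simp del: of_nat_Suc\<close>)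
    then show "(\<lambda>a. F5 (of_nat (Suc k) + a)) holomorphic_on ball 0 (1/50)" by (simp only: o_def)
    show "(deriv ^^ m) (\<lambda>a. F5 (of_nat (Suc k) + a)) 0 = (deriv ^^ m) F5 (of_nat (Suc k))"
      using higher_deriv_shift_0[of m F5 "of_nat (Suc k)"] by (simp only: o_def)
  qed
  have partial: "(deriv ^^ m) (\<lambda>a. \<Sum>k<N. F5 (of_nat (Suc k) + a)) 0 = (\<Sum>k<N. (deriv ^^ m) F5 (of_nat (Suc k)))" for N
  proof (induction N)
    case (Suc N)
    have "(deriv ^^ m) (\<lambda>a. (\<Sum>k<N. F5 (of_nat (Suc k) + a)) + F5 (of_nat (Suc N) + a)) 0 =
      (deriv ^^ m) (\<lambda>a. \<Sum>k<N. F5 (of_nat (Suc k) + a)) 0 + (deriv ^^ m) (\<lambda>a. F5 (of_nat (Suc N) + a)) 0"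
      by (rule higher_deriv_add[where S = "ball 0 (1/50)"]) (auto intro!: holomorphic_on_sum shift(1) simp del: of_nat_Suc)
    then show ?case unfolding Suc.IH shift(2) sum.lessThan_Suc .
  qed simp
  define f where "f = (\<lambda>a. 4 * gratio a * suminf (vterm a))"
  have "(\<lambda>N. (deriv ^^ m) (\<lambda>a. \<Sum>k<N. F5 (of_nat (Suc k) + a)) 0) \<longlonglongrightarrow> (deriv ^^ m) f 0"
    unfolding f_def by (rule higher_deriv_complex_uniform_limit[OF F5_uniform_limit])
      (auto intro!: always_eventually holomorphic_on_sum shift(1) simp del: of_nat_Suc)
  then have "(\<lambda>k. (deriv ^^ m) F5 (of_nat (Suc k))) sums (deriv ^^ m) f 0" unfolding sums_def partial .
  moreover have "f has_fps_expansion fps_const 4 * fps_expansion gratio 0 * fps_expansion (psum 8 25 38 28 2) 0"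
  proof -
    obtain r where "r > 0" "psum 8 25 38 28 2 holomorphic_on ball 0 r"
      using gsum_taylor unfolding psum_def[abs_def] by blast
    then have "psum 8 25 38 28 2 has_fps_expansion fps_expansion (psum 8 25 38 28 2) 0"
      by (intro has_fps_expansion_fps_expansion[where A = "ball 0 r"]) auto
    then have "(\<lambda>a. 4 * gratio a * psum 8 25 38 28 2 a) has_fps_expansion fps_const 4 * fps_expansion gratio 0 * fps_expansion (psum 8 25 38 28 2) 0"
      by (intro fps_expansion_intros gratio_expansion)
    moreover have "eventually (\<lambda>a. 4 * gratio a * psum 8 25 38 28 2 a = f a) (nhds 0)"
      using eventually_one by eventually_elim (simp add: f_def psum_vterm)
    ultimately show ?thesis by (rule has_fps_expansion_cong[THEN iffD1, rotated -1]) simp_all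
  qed
  then have "fps_nth (fps_const 4 * (fps_expansion gratio 0 * fps_expansion (psum 8 25 38 28 2) 0)) m = (deriv ^^ m) f 0 / fact m"
    by (subst mult.assoc[symmetric]) (rule fps_nth_fps_expansion)
  then have "(deriv ^^ m) f 0 = 4 * fact m * (\<Sum>i=0..m. fps_nth (fps_expansion gratio 0) i * pcoef 8 25 38 28 2 (m - i))"
    unfolding fps_mult_left_const_nth unfolding fps_mult_nth pcoef_def by (simp add: field_simps)
  ultimately show ?thesis by simp
qed

text \<open>Inductively each derivative is real on \<open>T\<close>, so its derivative along the
  real axis has imaginary part 0.\<close>

lemma higher_deriv_of_real:
  assumes F: "F holomorphic_on S" and S: "open S" and T: "open T"
    and sub: "\<And>y. y \<in> T \<Longrightarrow> complex_of_real y \<in> S" and eq: "\<And>y. y \<in> T \<Longrightarrow> F (complex_of_real y) = complex_of_real (g y)"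
  shows "x \<in> T \<Longrightarrow> (deriv ^^ n) F (complex_of_real x) = complex_of_real ((deriv ^^ n) g x)"
proof (induction n arbitrary: x)
  case (Suc n)
  define G h where "G = (deriv ^^ n) F" and "h = (deriv ^^ n) g"
  define D where "D = deriv G (complex_of_real x)"
  have "G holomorphic_on S" unfolding G_def using F S by (rule holomorphic_higher_deriv)
  then have "(G has_field_derivative D) (at (complex_of_real x))"
    unfolding D_def using S sub[OF Suc.prems] holomorphic_derivI by blast
  then have "((\<lambda>y. G (complex_of_real y)) has_vector_derivative D) (at x)" by (rule has_vector_derivative_real_field)
  then have v: "((\<lambda>y. complex_of_real (h y)) has_vector_derivative D) (at x)"
    by (rule has_vector_derivative_transform_within_open[OF _ T Suc.prems]) (simp add: G_def h_def Suc.IH)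
  have 1: "(h has_vector_derivative Re D) (at x)" using bounded_linear.has_vector_derivative[OF bounded_linear_Re v] by simp
  have "((\<lambda>y. 0 :: real) has_vector_derivative Im D) (at x)" using bounded_linear.has_vector_derivative[OF bounded_linear_Im v] by simp
  then have "Im D = 0" using has_vector_derivative_const vector_derivative_unique_at by blast
  moreover have "deriv h x = Re D" using 1 by (simp add: has_real_derivative_iff_has_vector_derivative[symmetric] DERIV_imp_deriv)
  ultimately have "D = complex_of_real (deriv h x)" by (simp add: complex_eq_iff)
  then show ?case by (simp add: D_def G_def h_def)
qed (simp add: eq)

lemma of_real_zeta:
  assumes "n \<ge> 2" shows "complex_of_real (zeta (real n)) = zser n"
proof -
  have c: "complex_of_real (1 / real (Suc k) ^ n) = 1 / of_nat (Suc k) ^ n" for k by simp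
  have "summable (\<lambda>k. 1 / real (Suc k) ^ n)"
    using summable_zser[OF assms] unfolding c[symmetric] summable_of_real_iff .
  then have "(\<lambda>k. 1 / real (Suc k) ^ n) sums (\<Sum>k. 1 / real (Suc k) ^ n)" by (rule summable_sums)
  then have "(\<lambda>k. 1 / of_nat (Suc k) ^ n) sums complex_of_real (\<Sum>k. 1 / real (Suc k) ^ n)"
    unfolding c[symmetric] sums_of_real_iff .
  then have "zser n = complex_of_real (\<Sum>k. 1 / real (Suc k) ^ n)" unfolding zser_def by (rule sums_unique[symmetric])
  then show ?thesis unfolding zeta_def by (simp add: powr_realpow del: of_nat_Suc)
qed

text \<open>Nonnegativity turns the iterated series into an unordered sum over pairs, and the
  bijection shifts both indices by 1.\<close>

lemma of_real_double_zeta: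
  assumes "a \<ge> 3" shows "complex_of_real (double_zeta a b) = dzser a b"
proof -
  define g where "g k = 1 / real (Suc k) ^ a * (\<Sum>j<k. 1 / real (Suc j) ^ b)" for k
  have c: "complex_of_real (g k) = 1 / of_nat (Suc k) ^ a * (\<Sum>j<k. 1 / of_nat (Suc j) ^ b)" for k by (simp add: g_def)
  have s: "summable g" using summable_dzser[OF assms, of b] unfolding c[symmetric] summable_of_real_iff .
  then have "g sums suminf g" by (rule summable_sums)
  then have "(\<lambda>k. complex_of_real (g k)) sums complex_of_real (suminf g)" unfolding sums_of_real_iff .
  then have d: "dzser a b = complex_of_real (suminf g)" unfolding dzser_def c by (rule sums_unique[symmetric])
  define A where "A = {(k1 :: nat, k2 :: nat). k2 > 0 \<and> k1 > k2}"
  define f where "f = (\<lambda>(k, j). 1 / (real (Suc k) ^ a * real (Suc j) ^ b))"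
  have i: "((\<lambda>j. f (k, j)) has_sum g k) {..<k}" for k
    by (rule has_sum_finiteI) (simp_all add: f_def g_def sum_distrib_left)
  have g: "(g has_sum suminf g) UNIV"
    by (rule sums_nonneg_imp_has_sum[OF summable_sums[OF s]]) (auto simp: g_def intro!: divide_nonneg_nonneg sum_nonneg)
  have "f summable_on Sigma UNIV (\<lambda>k. {..<k})"
    by (rule summable_on_SigmaI[OF i]) (use g has_sum_imp_summable in \<open>auto simp: f_def\<close>)
  then have "(f has_sum suminf g) (Sigma UNIV (\<lambda>k. {..<k}))"
    by (rule has_sum_SigmaI[OF i g])
  moreover have "bij_betw (\<lambda>(k, j). (Suc k, Suc j)) (Sigma UNIV (\<lambda>k. {..<k})) A"
    by (rule bij_betwI[where g = "\<lambda>(k, j). (k - 1, j - 1)"]) (auto simp: A_def)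
  from has_sum_reindex_bij_betw[OF this, of "\<lambda>(k1, k2). 1 / (real k1 ^ a * real k2 ^ b)" "suminf g"]
  have "((\<lambda>(k1, k2). 1 / (real k1 ^ a * real k2 ^ b)) has_sum suminf g) A \<longleftrightarrow> (f has_sum suminf g) (Sigma UNIV (\<lambda>k. {..<k}))"
    by (simp add: f_def case_prod_unfold)
  ultimately have "double_zeta a b = suminf g" unfolding double_zeta_def A_def by (simp add: infsumI)
  then show ?thesis using d by simp
qed

lemma f5_deriv_sums:
  assumes "complex_of_real r = 4 * fact m * (\<Sum>i=0..m. fps_nth (fps_expansion gratio 0) i * pcoef 8 25 38 28 2 (m - i))"
  shows "(\<lambda>k. (deriv ^^ m) f5 (real (Suc k))) sums r"
proof -
  have G: "Gamma (2 * complex_of_real y) = complex_of_real (Gamma (2 * y))" for y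
    using Gamma_complex_of_real[of "2 * y"] by simp
  have f: "F5 (complex_of_real y) = complex_of_real (f5 y)" for y
    unfolding F5_def f5_def G Gamma_complex_of_real by simp
  have "(deriv ^^ m) F5 (complex_of_real (real (Suc k))) = complex_of_real ((deriv ^^ m) f5 (real (Suc k)))" for k
    by (rule higher_deriv_of_real[OF F5_holomorphic open_halfspace_Re_gt open_greaterThan[of "1/2"]]) (auto simp: f)
  then have e: "(deriv ^^ m) F5 (of_nat (Suc k)) = complex_of_real ((deriv ^^ m) f5 (real (Suc k)))" for k
    by (simp only: of_real_of_nat_eq)
  show ?thesis using F5_deriv_sums[of m] unfolding e assms[symmetric] sums_of_real_iff .
qed

theorem theorem1p7:
  shows "(\<lambda>k. deriv f5 (real (Suc k))) sums (- 24 * zeta 4) \<and>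
    (\<lambda>k. (deriv ^^ 2) f5 (real (Suc k))) sums (8 * (23 * zeta 5 - 2 * zeta 2 * zeta 3)) \<and>
    (\<lambda>k. (deriv ^^ 3) f5 (real (Suc k))) sums (24 * (2 * zeta 3 ^ 2 - 49 * zeta 6)) \<and>
    (\<lambda>k. (deriv ^^ 4) f5 (real (Suc k))) sums
      (96 * (177 * zeta 7 - 46 * zeta 2 * zeta 5 - 2 * zeta 3 * zeta 4)) \<and>
    (\<lambda>k. (deriv ^^ 5) f5 (real (Suc k))) sums
      (640 * (9 * zeta 3 * zeta 5 - 3 * zeta 2 * zeta 3 ^ 2 - 12 * double_zeta 5 3
              - 146 * zeta 8)) \<and>
    summable (\<lambda>k. (deriv ^^ 6) f5 (real (Suc k))) \<and>
    1 / 960 * (\<Sum>k. (deriv ^^ 6) f5 (real (Suc k))) =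
      3001 * zeta 9 + 8 * zeta 3 ^ 3 - 6 * zeta 3 * zeta 6 - 138 * zeta 4 * zeta 5
        - 1062 * zeta 2 * zeta 7"
proof -
  \<comment> \<open>Writing all even zeta values through \<zeta>(2) turns the six claims into
    polynomial identities in these quantities, with no relation left to apply.\<close>
  define x2 x3 x5 x7 x9 d where "x2 = zser 2" and "x3 = zser 3" and "x5 = zser 5" and "x7 = zser 7" and "x9 = zser 9" and "d = dzser 5 3"
  have x4: "zser 4 = 2/5 * x2 ^ 2" using even_zeta_products(1) by (simp add: x2_def)
  have "7 * zser 6 = 7 * (8/35 * x2 ^ 3)" using even_zeta_products(2) unfolding x4
    by (simp add: x2_def power2_eq_square power3_eq_cube)
  then have x6: "zser 6 = 8/35 * x2 ^ 3" by (simp only: mult_cancel_left) simp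
  have "9 * zser 8 = 9 * (24/175 * x2 ^ 4)" using even_zeta_products(3) unfolding x4 x6
    by (simp add: x2_def power2_eq_square power3_eq_cube power4_eq_xxxx)
  then have x8: "zser 8 = 24/175 * x2 ^ 4" by (simp only: mult_cancel_left) simp
  have z: "complex_of_real (zeta 2) = x2" "complex_of_real (zeta 3) = x3" "complex_of_real (zeta 4) = 2/5 * x2 ^ 2"
    "complex_of_real (zeta 5) = x5" "complex_of_real (zeta 6) = 8/35 * x2 ^ 3" "complex_of_real (zeta 7) = x7"
    "complex_of_real (zeta 8) = 24/175 * x2 ^ 4" "complex_of_real (zeta 9) = x9" "complex_of_real (double_zeta 5 3) = d"
    using of_real_zeta[of 2] of_real_zeta[of 3] of_real_zeta[of 4] of_real_zeta[of 5] of_real_zeta[of 6] of_real_zeta[of 7]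
      of_real_zeta[of 8] of_real_zeta[of 9] of_real_double_zeta[of 5 3]
    unfolding x2_def[symmetric] x3_def[symmetric] x5_def[symmetric] x7_def[symmetric] x9_def[symmetric] d_def[symmetric] x4 x6 x8 by simp_all
  define P u where "P = fps_nth (fps_expansion gratio 0)" and "u = pcoef 8 25 38 28 2"
  have P: "P 0 = 1" "P 1 = 0" "P 2 = - 2 * x2" "P 3 = 4 * x3" "P 4 = - 4/5 * x2 ^ 2" "P 5 = 12 * x5 - 8 * x2 * x3"
    "P 6 = - 16/35 * x2 ^ 3 + 8 * x3 ^ 2"
    unfolding P_def gratio_coeffs x4 x6 unfolding x2_def[symmetric] x3_def[symmetric] x5_def[symmetric]
    by (simp_all add: power2_eq_square power3_eq_cube)
  have u: "u 0 = x3" "u 1 = - 12/5 * x2 ^ 2" "u 2 = 23 * x5" "u 3 = - 16 * x2 ^ 3 - 2 * x3 ^ 2" "u 4 = 177 * x7 + 48/5 * x3 * x2 ^ 2"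
    "u 5 = - 10608/175 * x2 ^ 4 - 92 * x3 * x5 - 16 * d"
    "u 6 = 3001/3 * x9 + 64 * x3 * x2 ^ 3 + 144/5 * x2 ^ 2 * x5 + 8/3 * x3 ^ 3"
    unfolding u_def pcoef_at_2 x4 x6 x8 unfolding x2_def[symmetric] x3_def[symmetric] x5_def[symmetric] x7_def[symmetric] x9_def[symmetric] d_def[symmetric]
    by (simp_all add: power2_eq_square power4_eq_xxxx)
  note D = f5_deriv_sums[folded P_def u_def]
  have sum: "(\<Sum>i=0..1. f i) = f 0 + f 1" "(\<Sum>i=0..2. f i) = f 0 + f 1 + f 2" "(\<Sum>i=0..3. f i) = f 0 + f 1 + f 2 + f 3"
    "(\<Sum>i=0..4. f i) = f 0 + f 1 + f 2 + f 3 + f 4" "(\<Sum>i=0..5. f i) = f 0 + f 1 + f 2 + f 3 + f 4 + f 5"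
    "(\<Sum>i=0..6. f i) = f 0 + f 1 + f 2 + f 3 + f 4 + f 5 + f 6" for f :: "nat \<Rightarrow> complex"
    by (simp_all add: eval_nat_numeral)
  have diffs: "1 - 0 = (1::nat)" "1 - 1 = (0::nat)" "2 - 0 = (2::nat)" "2 - 1 = (1::nat)" "2 - 2 = (0::nat)"
    "3 - 0 = (3::nat)" "3 - 1 = (2::nat)" "3 - 2 = (1::nat)" "3 - 3 = (0::nat)"
    "4 - 0 = (4::nat)" "4 - 1 = (3::nat)" "4 - 2 = (2::nat)" "4 - 3 = (1::nat)" "4 - 4 = (0::nat)"
    "5 - 0 = (5::nat)" "5 - 1 = (4::nat)" "5 - 2 = (3::nat)" "5 - 3 = (2::nat)" "5 - 4 = (1::nat)" "5 - 5 = (0::nat)"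
    "6 - 0 = (6::nat)" "6 - 1 = (5::nat)" "6 - 2 = (4::nat)" "6 - 3 = (3::nat)" "6 - 4 = (2::nat)" "6 - 5 = (1::nat)" "6 - 6 = (0::nat)" by simp_all
  have fact: "fact 1 = (1 :: complex)" "fact 2 = (2 :: complex)" "fact 3 = (6 :: complex)" "fact 4 = (24 :: complex)" "fact 5 = (120 :: complex)" "fact 6 = (720 :: complex)"
    by (simp_all add: fact_numeral)
  note rs = of_real_mult of_real_add of_real_diff of_real_minus of_real_power of_real_numeral z sum diffs P u fact
  have 1: "(\<lambda>k. (deriv ^^ 1) f5 (real (Suc k))) sums (- 24 * zeta 4)"
    by (rule D) (simp only: rs, simp)
  have 2: "(\<lambda>k. (deriv ^^ 2) f5 (real (Suc k))) sums (8 * (23 * zeta 5 - 2 * zeta 2 * zeta 3))"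
    by (rule D) (simp only: rs, simp)
  have 3: "(\<lambda>k. (deriv ^^ 3) f5 (real (Suc k))) sums (24 * (2 * zeta 3 ^ 2 - 49 * zeta 6))"
    by (rule D) (simp only: rs, simp add: power2_eq_square power3_eq_cube field_simps)
  have 4: "(\<lambda>k. (deriv ^^ 4) f5 (real (Suc k))) sums (96 * (177 * zeta 7 - 46 * zeta 2 * zeta 5 - 2 * zeta 3 * zeta 4))"
    by (rule D) (simp only: rs, simp add: power2_eq_square power3_eq_cube field_simps)
  have 5: "(\<lambda>k. (deriv ^^ 5) f5 (real (Suc k))) sums
      (640 * (9 * zeta 3 * zeta 5 - 3 * zeta 2 * zeta 3 ^ 2 - 12 * double_zeta 5 3 - 146 * zeta 8))"
    by (rule D) (simp only: rs, simp add: power2_eq_square power3_eq_cube power4_eq_xxxx field_simps)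
  have 6: "(\<lambda>k. (deriv ^^ 6) f5 (real (Suc k))) sums (960 *
     (3001 * zeta 9 + 8 * zeta 3 ^ 3 - 6 * zeta 3 * zeta 6 - 138 * zeta 4 * zeta 5 - 1062 * zeta 2 * zeta 7))"
    by (rule D) (simp only: rs, simp add: power2_eq_square power3_eq_cube power4_eq_xxxx field_simps)
  have 7: "summable (\<lambda>k. (deriv ^^ 6) f5 (real (Suc k))) \<and>
    1 / 960 * (\<Sum>k. (deriv ^^ 6) f5 (real (Suc k))) =
      3001 * zeta 9 + 8 * zeta 3 ^ 3 - 6 * zeta 3 * zeta 6 - 138 * zeta 4 * zeta 5 - 1062 * zeta 2 * zeta 7"
    using sums_summable[OF 6] sums_unique[OF 6, symmetric] by simp
  show ?thesis using 1 2 3 4 5 7 by simp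
qed

end
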